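(* Let $G$ be a graph and $M$ an eardrum in $G$ with $\mathcal{P}_f\neq\emptyset$ for all $f\in M$. Then a maximum earmuff for $M$ in $G$ can be computed in $O(|V(G)||E(G)|)$ time, and $$\mu(G,M)=\min\Bigl\{|M|-\sum_{W\in\mathcal{W}}\mathrm{sur}(W) : \mathcal{W}\text{ is a partition of } V(G)\setminus V_M\Bigr\}.$$
   Context: Graphs are finite, undirected, may have parallel edges, no loops. An eardrum in $G$ is the set $M$ of vertex sets of the connected components of an induced subgraph of $G$ in which every vertex has degree at most 1 (so each element of $M$ is a 1- or 2-element vertex set); $V_M=\bigcup M$. For $f\in M$, $\mathcal{P}_f$ is the set of paths $P$ in $G$ whose set of internal vertices (all vertices except the two endpoints) is exactly $f$, and $U_f$ is the set of endpoints of paths in $\mathcal{P}_f$. An earmuff for $M$ in $G$ is a set $\{P_f: f\in F\}$ with $F\subseteq M$ and $P_f\in\mathcal{P}_f$ such that $(V(G),\bigcup_{f\in F}E(P_f))$ is a forest; its size is $|F|$, and $\mu(G,M)$ denotes the maximum size of an earmuff. For $W\subseteq V(G)\setminus V_M$, the surplus is $\mathrm{sur}(W)=|\{f\in M: U_f\subseteq W\}|-(|W|-1)$. *)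

theory Defs
  imports Complex_Main "HOL-Library.Disjoint_Sets"
begin

section \<open>Multigraphs\<close>

record ('v, 'e) mgraph =
  verts :: "'v set"
  edges :: "'e set"
  ends :: "'e \<Rightarrow> 'v set"

definition multigraph :: "('v, 'e) mgraph \<Rightarrow> bool" where
  "multigraph G \<longleftrightarrow> finite (verts G) \<and> finite (edges G) \<and>
     (\<forall>e\<in>edges G. ends G e \<subseteq> verts G \<and> card (ends G e) = 2)"

definition induced :: "('v, 'e) mgraph \<Rightarrow> 'v set \<Rightarrow> ('v, 'e) mgraph" where
  "induced G X = G\<lparr>verts := X, edges := {e \<in> edges G. ends G e \<subseteq> X}\<rparr>"

definition degree :: "('v, 'e) mgraph \<Rightarrow> 'v \<Rightarrow> nat" where
  "degree G v = card {e \<in> edges G. v \<in> ends G e}"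

text \<open>A path is given by one of its traversals: its vertex sequence and its edge sequence.
  The edge sequence is needed because of parallel edges.\<close>

definition path :: "('v, 'e) mgraph \<Rightarrow> 'v list \<Rightarrow> 'e list \<Rightarrow> bool" where
  "path G vs es \<longleftrightarrow> length vs = Suc (length es) \<and> distinct vs \<and>
     set vs \<subseteq> verts G \<and> set es \<subseteq> edges G \<and>
     (\<forall>i<length es. ends G (es ! i) = {vs ! i, vs ! Suc i})"

text \<open>Two parallel edges form a cycle of length 2.\<close>

definition cycle :: "('v, 'e) mgraph \<Rightarrow> 'v list \<Rightarrow> 'e list \<Rightarrow> bool" where
  "cycle G vs es \<longleftrightarrow> length es \<ge> 2 \<and> length vs = length es \<and> distinct vs \<and> distinct es \<and>
     set vs \<subseteq> verts G \<and> set es \<subseteq> edges G \<and>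
     (\<forall>i<length es. ends G (es ! i) = {vs ! i, vs ! (Suc i mod length es)})"

definition forest :: "('v, 'e) mgraph \<Rightarrow> bool" where
  "forest G \<longleftrightarrow> \<not> (\<exists>vs es. cycle G vs es)"

definition joined :: "('v, 'e) mgraph \<Rightarrow> 'v \<Rightarrow> 'v \<Rightarrow> bool" where
  "joined G u v \<longleftrightarrow> (\<exists>vs es. path G vs es \<and> hd vs = u \<and> last vs = v)"

definition components :: "('v, 'e) mgraph \<Rightarrow> 'v set set" where
  "components G = {{v \<in> verts G. joined G u v} | u. u \<in> verts G}"


section \<open>Eardrums and earmuffs\<close>

definition eardrum :: "('v, 'e) mgraph \<Rightarrow> 'v set set \<Rightarrow> bool" where
  "eardrum G M \<longleftrightarrow> (\<exists>X \<subseteq> verts G. (\<forall>v\<in>X. degree (induced G X) v \<le> 1) \<and>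
     M = components (induced G X))"

definition ear_paths :: "('v, 'e) mgraph \<Rightarrow> 'v set \<Rightarrow> ('v list \<times> 'e list) set" where
  "ear_paths G f = {(vs, es). path G vs es \<and> set (butlast (tl vs)) = f}"

definition ear_ends :: "('v, 'e) mgraph \<Rightarrow> 'v set \<Rightarrow> 'v set" where
  "ear_ends G f = (\<Union>(vs, es) \<in> ear_paths G f. {hd vs, last vs})"

text \<open>The earmuff itself is the set \<open>P ` F\<close>, and its size is \<open>card F\<close>.\<close>

definition earmuff ::
  "('v, 'e) mgraph \<Rightarrow> 'v set set \<Rightarrow> 'v set set \<Rightarrow> ('v set \<Rightarrow> 'v list \<times> 'e list) \<Rightarrow> bool" where
  "earmuff G M F P \<longleftrightarrow> F \<subseteq> M \<and> (\<forall>f\<in>F. P f \<in> ear_paths G f) \<and>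
     forest (G\<lparr>edges := (\<Union>f\<in>F. set (snd (P f)))\<rparr>)"

definition mu :: "('v, 'e) mgraph \<Rightarrow> 'v set set \<Rightarrow> nat" where
  "mu G M = Max {card F | F P. earmuff G M F P}"

definition sur :: "('v, 'e) mgraph \<Rightarrow> 'v set set \<Rightarrow> 'v set \<Rightarrow> int" where
  "sur G M W = int (card {f \<in> M. ear_ends G f \<subseteq> W}) - (int (card W) - 1)"


section \<open>A unit-cost random access machine\<close>

text \<open>Structured programs over finitely many registers and arrays of natural numbers.
  Addition and truncated subtraction are the only arithmetic operations.\<close>

record ram_state =
  reg :: "string \<Rightarrow> nat"
  arr :: "string \<Rightarrow> nat \<Rightarrow> nat"

datatype aexp = N nat | Reg string | Arr string aexp | Plus aexp aexp | Minus aexp aexp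

datatype bexp = Less aexp aexp | Not bexp | And bexp bexp

datatype com = Skip | Set_Reg string aexp | Set_Arr string aexp aexp
  | Seq com com | If bexp com com | While bexp com

fun aval :: "aexp \<Rightarrow> ram_state \<Rightarrow> nat" where
  "aval (N n) s = n"
| "aval (Reg x) s = reg s x"
| "aval (Arr x a) s = arr s x (aval a s)"
| "aval (Plus a b) s = aval a s + aval b s"
| "aval (Minus a b) s = aval a s - aval b s"

fun bval :: "bexp \<Rightarrow> ram_state \<Rightarrow> bool" where
  "bval (Less a b) s \<longleftrightarrow> aval a s < aval b s"
| "bval (Not b) s \<longleftrightarrow> \<not> bval b s"
| "bval (And b c) s \<longleftrightarrow> bval b s \<and> bval c s"

fun acost :: "aexp \<Rightarrow> nat" where
  "acost (N n) = 1"
| "acost (Reg x) = 1"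
| "acost (Arr x a) = 1 + acost a"
| "acost (Plus a b) = 1 + acost a + acost b"
| "acost (Minus a b) = 1 + acost a + acost b"

fun bcost :: "bexp \<Rightarrow> nat" where
  "bcost (Less a b) = 1 + acost a + acost b"
| "bcost (Not b) = 1 + bcost b"
| "bcost (And b c) = 1 + bcost b + bcost c"

text \<open>\<open>exec B c s t s'\<close>: started in \<open>s\<close>, program \<open>c\<close> terminates in \<open>s'\<close> after \<open>t\<close> unit-cost
  operations. The word bound \<open>B\<close> rules out packing a lot of data into one cell: a program that
  would store a value above \<open>B\<close> has no execution. Since expressions in a program have fixed size,
  all intermediate values and all addresses are then bounded by a constant (depending on the
  program) times \<open>max 1 B\<close>, if this holds for the initial state.\<close>

inductive exec :: "nat \<Rightarrow> com \<Rightarrow> ram_state \<Rightarrow> nat \<Rightarrow> ram_state \<Rightarrow> bool" for B where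
  exec_Skip: "exec B Skip s 1 s"
| exec_Set_Reg: "aval a s \<le> B \<Longrightarrow>
    exec B (Set_Reg x a) s (1 + acost a) (s\<lparr>reg := (reg s)(x := aval a s)\<rparr>)"
| exec_Set_Arr: "aval a s \<le> B \<Longrightarrow>
    exec B (Set_Arr x i a) s (1 + acost i + acost a)
      (s\<lparr>arr := (arr s)(x := (arr s x)(aval i s := aval a s))\<rparr>)"
| exec_Seq: "exec B c s t s' \<Longrightarrow> exec B d s' u s'' \<Longrightarrow> exec B (Seq c d) s (t + u) s''"
| exec_If_True: "bval b s \<Longrightarrow> exec B c s t s' \<Longrightarrow> exec B (If b c d) s (1 + bcost b + t) s'"
| exec_If_False: "\<not> bval b s \<Longrightarrow> exec B d s t s' \<Longrightarrow> exec B (If b c d) s (1 + bcost b + t) s'"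
| exec_While_False: "\<not> bval b s \<Longrightarrow> exec B (While b c) s (1 + bcost b) s"
| exec_While_True: "bval b s \<Longrightarrow> exec B c s t s' \<Longrightarrow> exec B (While b c) s' u s'' \<Longrightarrow>
    exec B (While b c) s (1 + bcost b + t + u) s''"

text \<open>Input: vertices are numbered \<open>0, \<dots>, n - 1\<close> and edges \<open>0, \<dots>, m - 1\<close>. Edge \<open>e\<close> joins
  \<open>a[e]\<close> and \<open>b[e]\<close>. The \<open>k\<close> elements of \<open>M\<close> are \<open>{p[j], q[j]}\<close>, with \<open>p[j] = q[j]\<close> for a
  one-element set. All other cells are zero.\<close>

definition encodes :: "ram_state \<Rightarrow> (nat, nat) mgraph \<Rightarrow> nat set set \<Rightarrow> bool" where
  "encodes s G M \<longleftrightarrow>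
     verts G = {..<reg s ''n''} \<and> edges G = {..<reg s ''m''} \<and>
     (\<forall>e\<in>edges G. ends G e = {arr s ''a'' e, arr s ''b'' e}) \<and>
     bij_betw (\<lambda>j. {arr s ''p'' j, arr s ''q'' j}) {..<reg s ''k''} M \<and>
     (\<forall>x. x \<notin> {''n'', ''m'', ''k''} \<longrightarrow> reg s x = 0) \<and>
     (\<forall>x i. \<not> (x \<in> {''a'', ''b''} \<and> i < reg s ''m'') \<longrightarrow>
            \<not> (x \<in> {''p'', ''q''} \<and> i < reg s ''k'') \<longrightarrow> arr s x i = 0)"

text \<open>Output: \<open>count\<close> paths, the \<open>i\<close>-th having \<open>len[i]\<close> edges \<open>e0[i], e1[i], \<dots>\<close> and vertices
  \<open>v0[i], v1[i], \<dots>\<close>. Paths whose internal vertices form an element of an eardrum have at most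
  three edges.\<close>

definition output_paths :: "ram_state \<Rightarrow> (nat list \<times> nat list) list" where
  "output_paths s = map (\<lambda>i.
     (take (Suc (arr s ''len'' i)) (map (\<lambda>x. arr s x i) [''v0'', ''v1'', ''v2'', ''v3'']),
      take (arr s ''len'' i) (map (\<lambda>x. arr s x i) [''e0'', ''e1'', ''e2'']))) [0..<reg s ''count'']"

definition max_earmuff_list ::
  "('v, 'e) mgraph \<Rightarrow> 'v set set \<Rightarrow> ('v list \<times> 'e list) list \<Rightarrow> bool" where
  "max_earmuff_list G M ps \<longleftrightarrow>
     (\<exists>F P. earmuff G M F P \<and> card F = mu G M \<and> distinct ps \<and> set ps = P ` F)"

text \<open>Time \<open>T\<close> is a function of the numbers of vertices and edges. The asymptotic bound is taken
  over all inputs, with \<open>max 1\<close> because even on an edgeless graph at least one step is made.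
  Cells hold \<open>O(log (|V| + |E|))\<close> bits.\<close>

definition max_earmuff_computable_in :: "(nat \<Rightarrow> nat \<Rightarrow> nat) \<Rightarrow> bool" where
  "max_earmuff_computable_in T \<longleftrightarrow> (\<exists>c C K. \<forall>G M s.
     multigraph G \<and> eardrum G M \<and> (\<forall>f\<in>M. ear_paths G f \<noteq> {}) \<and> encodes s G M \<longrightarrow>
     (\<exists>t s'. exec ((card (verts G) + card (edges G) + 2) ^ K) c s t s' \<and>
        t \<le> C * max 1 (T (card (verts G)) (card (edges G))) \<and>
        max_earmuff_list G M (output_paths s')))"

end

theory Submission imports Defs begin

text \<open>
  The internal vertices of an ear are private to it, so a set of ears is a forest iff the pairs of their
  ends form a forest on the remaining vertices. The pairs available to \<open>f\<close> form a connected graph on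
  \<open>U\<^sub>f\<close>. Members of \<open>M\<close> are inserted one at a time. To insert \<open>f\<close>, grow the subtree \<open>S\<close> of the current forest
  spanned by \<open>U\<^sub>f\<close> and by the sets \<open>U\<^sub>g\<close> of all ears \<open>g\<close> met in \<open>S\<close>. If some \<open>U\<^sub>g\<close> leaves the tree, then moving one
  end of \<open>g\<close> there frees the tree edge of \<open>g\<close>, which lets the ear through which \<open>g\<close> was reached move one
  of its ends across the gap, and so on back to \<open>f\<close>. Otherwise the \<open>|S| - 1\<close> ears in \<open>S\<close> all have their ends confined
  to \<open>S\<close>, so \<open>S\<close> is tight and \<open>f\<close> stays rejected. Unions of intersecting tight sets are tight, hence
  the maximal ones form a partition that attains the bound. Each insertion takes
  time \<open>O(|V| + |E|)\<close>, and \<open>|M|\<close> is at most \<open>|V|\<close> and at most \<open>|E|\<close>.\<close>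

section \<open>Forests as families of pairs\<close>

text \<open>A chain of moves has to survive the fact that each move changes the forest under the
  next one. The search therefore stores with every discovered \<open>g\<close> a set
  \<open>K g\<close> of members on which the later move depends: inside \<open>K g\<close>, removing
  \<open>g\<close> cuts \<open>pv g\<close> off from the root, while the kept end of
  \<open>ph g\<close> stays tied to the root by \<open>K g - {g}\<close>. Moves are made from the
  last ear of the chain back to \<open>f\<close>, and \<open>K (ph g)\<close> is contained in
  \<open>K g - {g}\<close>. Hence the ears already moved lie outside every set that is still
  consulted, and what the search recorded about the old forest holds in the current one. Only one
  end moves at a time. This is why the possible ends are kept as two slots, \<open>A g\<close> and
  \<open>B g\<close>, instead of the single set \<open>U g\<close>: a new end in one slot is
  combined with the end kept in the other. The linear cost of one insertion comes from walking up a
  breadth-first tree until \<open>S\<close> is met. Each vertex is absorbed once, and each adjacency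
  list is scanned a bounded number of times.\<close>

definition link :: "('i \<Rightarrow> 'v) \<Rightarrow> ('i \<Rightarrow> 'v) \<Rightarrow> 'i set \<Rightarrow> ('v \<times> 'v) set" where
  "link x y F = (\<Union>g\<in>F. {(x g, y g), (y g, x g)})\<^sup>*"

text \<open>Removal acts on indices and not on pairs, so two parallel members violate the condition,
  as a cycle of length 2 should. A member with equal ends violates it too, by the empty
  walk.\<close>

definition acyc :: "('i \<Rightarrow> 'v) \<Rightarrow> ('i \<Rightarrow> 'v) \<Rightarrow> 'i set \<Rightarrow> bool" where
  "acyc x y F \<longleftrightarrow> (\<forall>g\<in>F. (x g, y g) \<notin> link x y (F - {g}))"

lemma link_refl [simp]: "(a, a) \<in> link x y F"
  by (simp add: link_def)

lemma link_edge: "g \<in> F \<Longrightarrow> (x g, y g) \<in> link x y F"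
  by (auto simp: link_def)

lemma link_sym: "(a, b) \<in> link x y F \<Longrightarrow> (b, a) \<in> link x y F"
proof -
  have "sym (link x y F)"
    unfolding link_def by (rule sym_rtrancl) (auto simp: sym_def)
  then show "(a, b) \<in> link x y F \<Longrightarrow> (b, a) \<in> link x y F"
    by (auto dest: symD)
qed

lemma link_trans: "(a, b) \<in> link x y F \<Longrightarrow> (b, c) \<in> link x y F \<Longrightarrow> (a, c) \<in> link x y F"
  by (simp add: link_def)

lemma link_mono: "F \<subseteq> F' \<Longrightarrow> (a, b) \<in> link x y F \<Longrightarrow> (a, b) \<in> link x y F'"
  unfolding link_def by (rule subsetD[OF rtrancl_mono]) auto

lemma link_cong:
  "(\<And>g. g \<in> F \<Longrightarrow> x g = x' g) \<Longrightarrow> (\<And>g. g \<in> F \<Longrightarrow> y g = y' g) \<Longrightarrow> link x y F = link x' y' F"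
  by (simp add: link_def)

lemma link_induct [consumes 1, case_names refl step]:
  assumes "(a, b) \<in> link x y F" "P a"
    and "\<And>c d g. (a, c) \<in> link x y F \<Longrightarrow> P c \<Longrightarrow> g \<in> F \<Longrightarrow>
      (c = x g \<and> d = y g) \<or> (c = y g \<and> d = x g) \<Longrightarrow> P d"
  shows "P b"
  using assms(1) unfolding link_def
proof (induction rule: rtrancl_induct)
  case base
  show ?case by fact
next
  case (step c d)
  then show ?case using assms(3)[of c _ d] by (auto simp: link_def)
qed

text \<open>Homomorphism principle. With \<open>id\<close> it replaces every member by a walk in
  another family; with a contraction it carries walks to the contracted family.\<close>

lemma link_map:
  assumes "(a, b) \<in> link x y F"
    and "\<And>g. g \<in> F \<Longrightarrow> (\<phi> (x g), \<phi> (y g)) \<in> link x' y' F'"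
  shows "(\<phi> a, \<phi> b) \<in> link x' y' F'"
  using assms(1)
proof (induction rule: link_induct)
  case (step c d g)
  with assms(2)[of g] show ?case by (auto intro: link_trans link_sym)
qed simp

lemma link_closed:
  assumes "(a, b) \<in> link x y F" "a \<in> C" "\<And>g. g \<in> F \<Longrightarrow> x g \<in> C \<longleftrightarrow> y g \<in> C"
  shows "b \<in> C"
  using assms(1,2)
proof (induction rule: link_induct)
  case (step c d g)
  with assms(3)[of g] show ?case by auto
qed

text \<open>A walk that passes \<open>g\<close> repeatedly can be cut short, so one passage in one
  of the two directions suffices.\<close>

lemma link_insert:
  assumes "(a, b) \<in> link x y (insert g F)"
  shows "(a, b) \<in> link x y F \<or> (a, x g) \<in> link x y F \<and> (y g, b) \<in> link x y F \<or>
    (a, y g) \<in> link x y F \<and> (x g, b) \<in> link x y F"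
  using assms
proof (induction rule: link_induct)
  case (step c d h)
  show ?case
  proof (cases "h \<in> F")
    case True
    then have "(c, d) \<in> link x y F"
      using step.hyps by (auto intro: link_edge link_sym)
    then show ?thesis using step.IH by (auto intro: link_trans)
  next
    case False
    then have "h = g" using step.hyps by auto
    with step show ?thesis by (auto intro: link_sym link_trans)
  qed
qed simp

lemma acyc_mono: "acyc x y F' \<Longrightarrow> F \<subseteq> F' \<Longrightarrow> acyc x y F"
  unfolding acyc_def by (meson Diff_mono link_mono subset_iff order_refl)

lemma acyc_cong:
  assumes "\<And>g. g \<in> F \<Longrightarrow> x g = x' g" "\<And>g. g \<in> F \<Longrightarrow> y g = y' g"
  shows "acyc x y F = acyc x' y' F"
proof -
  have "link x y (F - {g}) = link x' y' (F - {g})" for g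
    by (rule link_cong) (auto simp: assms)
  then show ?thesis by (auto simp: acyc_def assms)
qed

text \<open>A cycle through an old member \<open>h\<close> would have to use \<open>g\<close>. Read
  from \<open>g\<close> instead, it joins the ends of \<open>g\<close> within
  \<open>F\<close>.\<close>

lemma acyc_insert:
  assumes "acyc x y F" "g \<notin> F" "(x g, y g) \<notin> link x y F"
  shows "acyc x y (insert g F)"
  unfolding acyc_def
proof
  fix h assume h: "h \<in> insert g F"
  show "(x h, y h) \<notin> link x y (insert g F - {h})"
  proof (cases "h = g")
    case True
    then show ?thesis using assms by simp
  next
    case False
    then have hF: "h \<in> F" using h by simp
    have eq: "insert g F - {h} = insert g (F - {h})" using False by auto
    show ?thesis
    proof
      assume "(x h, y h) \<in> link x y (insert g F - {h})"
      from link_insert[OF this[unfolded eq]] hF assms(1)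
      have "(x h, x g) \<in> link x y (F - {h}) \<and> (y g, y h) \<in> link x y (F - {h}) \<or>
        (x h, y g) \<in> link x y (F - {h}) \<and> (x g, y h) \<in> link x y (F - {h})"
        by (auto simp: acyc_def)
      then have "(x h, x g) \<in> link x y F \<and> (y g, y h) \<in> link x y F \<or>
        (x h, y g) \<in> link x y F \<and> (x g, y h) \<in> link x y F"
        by (meson Diff_subset link_mono)
      then have "(x g, y g) \<in> link x y F"
        using link_edge[OF hF, of x y] by (meson link_sym link_trans)
      with assms(3) show False by simp
    qed
  qed
qed

text \<open>Contracting a member of the family onto its first end lowers both cardinalities by one.\<close>

lemma acyc_card:
  assumes "finite F" "finite W" "W \<noteq> {}" "acyc x y F" "\<And>g. g \<in> F \<Longrightarrow> x g \<in> W \<and> y g \<in> W"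
  shows "card F < card W"
  using assms
proof (induction F arbitrary: x y W rule: finite_induct)
  case empty
  then show ?case by (simp add: card_gt_0_iff)
next
  case (insert f F)
  define \<psi> where "\<psi> v = (if v = y f then x f else v)" for v
  have ne: "x f \<noteq> y f"
    using insert.prems(3) by (auto simp: acyc_def)
  have F: "x f \<in> W" "y f \<in> W" using insert.prems(4) by auto
  have 1: "acyc (\<psi> \<circ> x) (\<psi> \<circ> y) F"
    unfolding acyc_def
  proof
    fix g assume g: "g \<in> F"
    let ?L = "link x y (insert f F - {g})"
    have gf: "g \<noteq> f" using g insert.hyps by auto
    then have *: "(x f, y f) \<in> ?L" by (intro link_edge) auto
    have psi: "(\<psi> v, v) \<in> ?L" for v
      using * by (auto simp: \<psi>_def)
    show "((\<psi> \<circ> x) g, (\<psi> \<circ> y) g) \<notin> link (\<psi> \<circ> x) (\<psi> \<circ> y) (F - {g})"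
    proof
      assume a: "((\<psi> \<circ> x) g, (\<psi> \<circ> y) g) \<in> link (\<psi> \<circ> x) (\<psi> \<circ> y) (F - {g})"
      have "(id ((\<psi> \<circ> x) g), id ((\<psi> \<circ> y) g)) \<in> ?L"
      proof (rule link_map[OF a])
        fix h assume "h \<in> F - {g}"
        then have "(x h, y h) \<in> ?L" by (intro link_edge) auto
        then show "(id ((\<psi> \<circ> x) h), id ((\<psi> \<circ> y) h)) \<in> ?L"
          using psi by (auto intro: link_trans link_sym)
      qed
      then have "(x g, y g) \<in> ?L"
        using psi by (auto intro: link_trans link_sym)
      with insert.prems(3) g show False by (auto simp: acyc_def)
    qed
  qed
  have 2: "(\<psi> \<circ> x) g \<in> W - {y f} \<and> (\<psi> \<circ> y) g \<in> W - {y f}" if "g \<in> F" for g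
    using insert.prems(4)[of g] that F ne by (auto simp: \<psi>_def)
  have "card F < card (W - {y f})"
    by (rule insert.IH[OF _ _ 1 2]) (use insert.prems(1) F ne in auto)
  then show ?case using F insert by simp
qed

section \<open>Searching for an exchange sequence\<close>

text \<open>The search for a new member \<open>f\<close> is rooted at \<open>r\<close>. It discovers a set \<open>D\<close> of members of
  the family that span a tree. Each \<open>g \<in> D\<close> was discovered when an end \<open>pv g\<close>
  of the member \<open>ph g\<close> (on the side given by \<open>ps g\<close>) was linked to the tree by a walk through \<open>g\<close>, and
  \<open>K g\<close> is the part of \<open>D\<close> known at the end of this walk. If \<open>g\<close> leaves the family,
  then \<open>ph g\<close> can move this end to \<open>pv g\<close>.\<close>

definition keep :: "('i \<Rightarrow> 'v) \<Rightarrow> ('i \<Rightarrow> 'v) \<Rightarrow> bool \<Rightarrow> 'i \<Rightarrow> 'v" where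
  "keep x y b g = (if b then y g else x g)"

text \<open>In a forest this says that the walk from \<open>v\<close> to \<open>w\<close> passes
  through \<open>g\<close>.\<close>

definition ends_to :: "('i \<Rightarrow> 'v) \<Rightarrow> ('i \<Rightarrow> 'v) \<Rightarrow> 'i set \<Rightarrow> 'i \<Rightarrow> 'v \<Rightarrow> 'v \<Rightarrow> bool" where
  "ends_to x y F g v w \<longleftrightarrow>
     (v, x g) \<in> link x y (F - {g}) \<and> (y g, w) \<in> link x y (F - {g}) \<or>
     (v, y g) \<in> link x y (F - {g}) \<and> (x g, w) \<in> link x y (F - {g})"

lemma ends_to_mono: "ends_to x y F g v w \<Longrightarrow> F \<subseteq> F' \<Longrightarrow> ends_to x y F' g v w"
  unfolding ends_to_def by (meson Diff_mono link_mono order_refl)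

lemma ends_to_trans:
  "ends_to x y F g v w \<Longrightarrow> (w, w') \<in> link x y (F - {g}) \<Longrightarrow> ends_to x y F g v w'"
  unfolding ends_to_def by (meson link_trans)

text \<open>Removing \<open>g\<close> separates \<open>v\<close> from \<open>r\<close>. The new pair
  joins two different trees of the old forest, so it closes no cycle. It cannot reconnect
  \<open>v\<close> with \<open>r\<close> either, since its ends would then both lie in the old tree
  of \<open>r\<close>.\<close>

lemma exchange:
  assumes ac: "acyc x y F" and g: "g \<in> F" and new: "(a, b) \<notin> link x y F"
    and v: "ends_to x y F g v r"
  shows "acyc (x(g := a)) (y(g := b)) F" "(v, r) \<notin> link (x(g := a)) (y(g := b)) F"
proof -
  let ?x = "x(g := a)" and ?y = "y(g := b)"
  have cong: "link ?x ?y (F - {g}) = link x y (F - {g})"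
    by (rule link_cong) auto
  have F: "insert g (F - {g}) = F" using g by auto
  have "acyc ?x ?y (F - {g})"
    using acyc_mono[OF ac, of "F - {g}"] acyc_cong[of "F - {g}" x ?x y ?y] by auto
  moreover have "(?x g, ?y g) \<notin> link ?x ?y (F - {g})"
    unfolding cong using new link_mono[of "F - {g}" F a b x y] by auto
  ultimately have "acyc ?x ?y (insert g (F - {g}))"
    by (intro acyc_insert) auto
  then show "acyc ?x ?y F" by (simp only: F)
  show "(v, r) \<notin> link ?x ?y F"
  proof
    assume "(v, r) \<in> link ?x ?y F"
    then have "(v, r) \<in> link ?x ?y (insert g (F - {g}))" by (simp only: F)
    from link_insert[OF this]
    have *: "(v, r) \<in> link x y (F - {g}) \<or>
      (v, a) \<in> link x y (F - {g}) \<and> (b, r) \<in> link x y (F - {g}) \<or>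
      (v, b) \<in> link x y (F - {g}) \<and> (a, r) \<in> link x y (F - {g})"
      by (simp add: cong)
    have nl: "(x g, y g) \<notin> link x y (F - {g})" using ac g by (auto simp: acyc_def)
    have "(v, r) \<notin> link x y (F - {g})"
      using v nl unfolding ends_to_def by (meson link_sym link_trans)
    have M: "(c, d) \<in> link x y F" if "(c, d) \<in> link x y (F - {g})" for c d
      using that by (rule link_mono[rotated]) auto
    from * \<open>(v, r) \<notin> link x y (F - {g})\<close>
    have "(v, a) \<in> link x y F \<and> (b, r) \<in> link x y F \<or>
      (v, b) \<in> link x y F \<and> (a, r) \<in> link x y F"
      by (auto intro: M)
    moreover have "(v, r) \<in> link x y F"
      using v link_edge[OF g, of x y] link_mono[of "F - {g}" F]
      unfolding ends_to_def by (meson Diff_subset link_sym link_trans)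
    ultimately have "(a, b) \<in> link x y F" by (meson link_sym link_trans)
    with new show False by simp
  qed
qed

text \<open>The part of the argument that forgets the graph: member \<open>i\<close> has its first
  end in \<open>A i\<close> and its second end in \<open>B i\<close>, chosen independently.\<close>

locale slots =
  fixes A B :: "'i \<Rightarrow> 'v set"
begin

definition U :: "'i \<Rightarrow> 'v set" where "U i = A i \<union> B i"

definition side :: "bool \<Rightarrow> 'i \<Rightarrow> 'v set" where
  "side b i = (if b then A i else B i)"

text \<open>Acyclicity already forces \<open>x g \<noteq> y g\<close>, so the two ends of an ear
  differ even where the slots overlap.\<close>

definition fits :: "('i \<Rightarrow> 'v) \<Rightarrow> ('i \<Rightarrow> 'v) \<Rightarrow> 'i set \<Rightarrow> bool" where
  "fits x y F \<longleftrightarrow> acyc x y F \<and> (\<forall>g\<in>F. x g \<in> A g \<and> y g \<in> B g)"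

text \<open>Once \<open>g\<close> is gone, \<open>v\<close> is cut off from \<open>r\<close> while
  the kept end of \<open>h\<close> still hangs on \<open>r\<close>, so \<open>h\<close> can take the
  end \<open>v\<close> without closing a cycle. The case \<open>h = f\<close> is the end of the
  chain.\<close>

definition pred_ok where
  "pred_ok x y r f D h v b g K \<longleftrightarrow> h \<in> insert f D \<and> v \<in> side b h \<and>
     (r, keep x y b h) \<in> link x y (K - {g}) \<and> ends_to x y K g v r"

text \<open>Connectedness together with the vertex count makes \<open>D\<close> a spanning tree of
  \<open>S\<close>. The count is the form in which tightness of \<open>S\<close> is read off
  later.\<close>

definition tree where
  "tree x y r D S \<longleftrightarrow> finite D \<and> finite S \<and> card S = Suc (card D) \<and> r \<in> S \<and>
     (\<forall>g\<in>D. x g \<in> S \<and> y g \<in> S) \<and> (\<forall>v\<in>S. (v, r) \<in> link x y D)"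

text \<open>\<open>K f = {}\<close> is the bottom of the descent of \<open>K\<close> along
  \<open>ph\<close>.\<close>

definition search where
  "search x y F r f D S ph pv ps K \<longleftrightarrow> D \<subseteq> F \<and> f \<notin> F \<and> K f = {} \<and> tree x y r D S \<and>
     (\<forall>g\<in>D. g \<in> K g \<and> K g \<subseteq> D \<and> K (ph g) \<subseteq> K g - {g} \<and>
        pred_ok x y r f D (ph g) (pv g) (ps g) g (K g))"

text \<open>The state of a walk from \<open>v\<close> that has reached \<open>w\<close>; the search had found \<open>D0\<close> and \<open>S0\<close> before.\<close>

definition walk where
  "walk x y F C dp D0 S0 D S v w \<longleftrightarrow> D0 \<subseteq> D \<and> D \<subseteq> F \<and> S0 \<subseteq> S \<and> finite D \<and> finite S \<and>
     card S = Suc (card D) \<and> (\<forall>g\<in>D. x g \<in> S \<union> {w} \<and> y g \<in> S \<union> {w}) \<and> (v, w) \<in> link x y D \<and>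
     (\<forall>u\<in>S - S0. (u, w) \<in> link x y D) \<and> (\<forall>g\<in>D - D0. ends_to x y D g v w) \<and>
     (\<forall>g\<in>D0. x g \<in> S0 \<and> y g \<in> S0) \<and> (\<forall>g\<in>D - D0. x g \<in> S - S0 \<or> y g \<in> S - S0) \<and>
     w \<in> C \<and> (\<forall>u\<in>S - S0. (dp w :: nat) < dp u)"

lemma walk_init:
  assumes "search x y F r f D S ph pv ps K" "v \<in> C"
  shows "walk x y F C dp D S D S v v"
  using assms unfolding walk_def search_def tree_def by auto

text \<open>A spanning arborescence of the component \<open>C\<close> of \<open>r\<close>, with \<open>dp\<close> bounding the depth.\<close>

definition rooted where
  "rooted x y F r C par pg (dp :: 'v \<Rightarrow> nat) \<longleftrightarrow> r \<in> C \<and> (\<forall>g\<in>F. x g \<in> C \<longleftrightarrow> y g \<in> C) \<and>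
     (\<forall>v\<in>C - {r}. par v \<in> C \<and> pg v \<in> F \<and> {x (pg v), y (pg v)} = {v, par v} \<and> dp (par v) < dp v)"

text \<open>Depth strictly decreases along the walk, so neither \<open>w\<close> nor the member
  leading to its parent can have been used before on this walk. The earlier search is excluded
  because its members have both ends in \<open>S0\<close>, while \<open>w\<close> is not in
  \<open>S0\<close>.\<close>

lemma walk_step:
  assumes rt: "rooted x y F r C par pg dp" and r: "r \<in> S0"
    and walk: "walk x y F C dp D0 S0 D S v w" and wS0: "w \<notin> S0"
  shows "w \<notin> S" "pg w \<in> F - D" "walk x y F C dp D0 S0 (insert (pg w) D) (insert w S) v (par w)"
proof -
  note w = walk[unfolded walk_def]
  define g w' where "g = pg w" and "w' = par w"
  have "w \<in> C - {r}" using w r wS0 by auto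
  then have p: "w' \<in> C" "g \<in> F" "dp w' < dp w" and e: "{x g, y g} = {w, w'}"
    using rt by (auto simp: rooted_def g_def w'_def)
  show wS: "w \<notin> S" using w wS0 by auto
  have gD: "g \<notin> D"
  proof
    assume "g \<in> D"
    moreover have "g \<notin> D0" using w e wS0 by (auto simp: doubleton_eq_iff)
    ultimately have "x g \<in> S - S0 \<or> y g \<in> S - S0" using w by blast
    then have "w' \<in> S - S0" using e wS by (auto simp: doubleton_eq_iff)
    then show False using w p(3) by (meson less_asym)
  qed
  show "pg w \<in> F - D" using gD p by (simp add: g_def)
  have ww: "(w, w') \<in> link x y {g}"
    using e link_edge[of g "{g}" x y] by (auto simp: doubleton_eq_iff intro: link_sym)
  have L: "(w, w') \<in> link x y (insert g D)"
    using ww by (rule link_mono[rotated]) auto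
  have M: "(a, b) \<in> link x y (insert g D)" if "(a, b) \<in> link x y D" for a b
    using that by (rule link_mono[rotated]) auto
  \<comment> \<open>Members passed earlier have the second half of their walk prolonged by
    \<open>g\<close>. For \<open>g\<close> itself the halves are the walk up to \<open>w\<close> and
    the empty walk at the parent.\<close>
  have 1: "ends_to x y (insert g D) h v w'" if h: "h \<in> insert g D - D0" for h
  proof (cases "h = g")
    case True
    have "insert g D - {g} = D" using gD by auto
    then show ?thesis
      using e w True unfolding ends_to_def by (auto simp: doubleton_eq_iff)
  next
    case False
    then have "ends_to x y D h v w" using h w by auto
    then have "ends_to x y (insert g D) h v w" by (rule ends_to_mono) auto
    moreover have "(w, w') \<in> link x y (insert g D - {h})"
      using ww by (rule link_mono[rotated]) (use False in auto)
    ultimately show ?thesis by (rule ends_to_trans)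
  qed
  have 2: "(v, w') \<in> link x y (insert g D)"
    using w L M by (auto intro: link_trans)
  have 3: "(u, w') \<in> link x y (insert g D)" if "u \<in> insert w S - S0" for u
  proof (cases "u = w")
    case False
    then have "(u, w) \<in> link x y D" using w that by blast
    then show ?thesis by (rule link_trans[OF M L])
  qed (simp add: L)
  have 4: "x h \<in> insert w S \<union> {w'} \<and> y h \<in> insert w S \<union> {w'}" if "h \<in> insert g D" for h
    using w e that by (auto simp: doubleton_eq_iff)
  have 5: "x h \<in> insert w S - S0 \<or> y h \<in> insert w S - S0" if "h \<in> insert g D - D0" for h
  proof (cases "h = g")
    case True
    then show ?thesis using e wS0 by (auto simp: doubleton_eq_iff)
  next
    case False
    then show ?thesis using w that by blast
  qed
  have 6: "dp w' < dp u" if "u \<in> insert w S - S0" for u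
    using p(3) w that by (metis Diff_iff insert_iff order_less_trans)
  show "walk x y F C dp D0 S0 (insert (pg w) D) (insert w S) v (par w)"
    unfolding g_def[symmetric] w'_def[symmetric] walk_def
    using w wS p gD 1 2 3 4 5 6 by (intro conjI) auto
qed

text \<open>All members met on one walk receive the same predecessor data and the same
  \<open>K\<close>, namely all of \<open>D\<close>. This is sound because each of them separates
  \<open>v\<close> from the root within \<open>D\<close>, and because \<open>h\<close> was known
  before the walk, so that \<open>K h\<close> lies in \<open>D0\<close> and contains none of
  them.\<close>

lemma walk_finish:
  assumes s: "search x y F r f D0 S0 ph pv ps K" and w: "walk x y F C dp D0 S0 D S v w"
    and wS: "w \<in> S0" and h: "h \<in> insert f D0" "v \<in> side b h" "keep x y b h \<in> S0"
    and pr: "\<And>g. g \<in> D - D0 \<Longrightarrow> ph' g = h \<and> pv' g = v \<and> ps' g = b"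
      "\<And>g. g \<notin> D - D0 \<Longrightarrow> ph' g = ph g \<and> pv' g = pv g \<and> ps' g = ps g"
  shows "search x y F r f D S ph' pv' ps' (\<lambda>g. if g \<in> D - D0 then D else K g)"
proof -
  let ?K = "\<lambda>g. if g \<in> D - D0 then D else K g"
  have D0: "D0 \<subseteq> D" "D \<subseteq> F" and f: "f \<notin> F" using s w by (auto simp: search_def walk_def)
  have r: "(u, r) \<in> link x y D0" if "u \<in> S0" for u
    using s that by (auto simp: search_def tree_def)
  have r': "(u, r) \<in> link x y D" if "u \<in> S0" for u
    using r[OF that] by (rule link_mono[rotated]) (rule D0)
  have "(u, r) \<in> link x y D" if "u \<in> S" for u
  proof (cases "u \<in> S0")
    case False
    then have "(u, w) \<in> link x y D" using w that by (auto simp: walk_def)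
    then show ?thesis using r'[OF wS] by (rule link_trans)
  qed (rule r')
  then have "tree x y r D S"
    using s w wS unfolding walk_def search_def tree_def by (metis Un_iff empty_iff insert_iff subsetD)
  moreover have "g \<in> ?K g \<and> ?K g \<subseteq> D \<and> ?K (ph' g) \<subseteq> ?K g - {g} \<and>
      pred_ok x y r f D (ph' g) (pv' g) (ps' g) g (?K g)" if g: "g \<in> D" for g
  proof (cases "g \<in> D0")
    case True
    then have pr': "ph' g = ph g" "pv' g = pv g" "ps' g = ps g" using pr(2)[of g] by auto
    have old: "g \<in> K g" "K g \<subseteq> D0" "K (ph g) \<subseteq> K g - {g}"
      "pred_ok x y r f D0 (ph g) (pv g) (ps g) g (K g)"
      using s True unfolding search_def by blast+
    have "ph g \<in> insert f D0" using old(4) by (auto simp: pred_ok_def)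
    then have "ph g \<notin> D - D0" using f D0 by auto
    then show ?thesis using old D0 True pr' by (auto simp: pred_ok_def)
  next
    case False
    then have gD: "g \<in> D - D0" using g by simp
    note pr' = pr(1)[OF gD]
    have "K h \<subseteq> D0" using s h(1) unfolding search_def by auto
    moreover have "h \<notin> D - D0" using h(1) f D0 by auto
    moreover have lr: "(u, r) \<in> link x y (D - {g})" if "u \<in> S0" for u
      using r[OF that] by (rule link_mono[rotated]) (use D0 False in auto)
    moreover have "ends_to x y D g v r"
    proof (rule ends_to_trans)
      show "ends_to x y D g v w" using w gD by (auto simp: walk_def)
    qed (rule lr[OF wS])
    ultimately show ?thesis
      using gD D0 h pr' False by (auto simp: pred_ok_def intro: link_sym)
  qed
  moreover have "?K f = {}" using s f D0 by (auto simp: search_def)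
  ultimately show ?thesis
    using D0 f unfolding search_def by blast
qed

text \<open>While an augmentation is under way, \<open>g\<close> still has to receive the end \<open>v\<close>.\<close>

definition pending where
  "pending x y F f D K x' y' g v b \<longleftrightarrow> fits x' y' F \<and> g \<in> insert f D \<and> v \<in> side b g \<and>
     (\<forall>h\<in>insert f (K g). x' h = x h \<and> y' h = y h) \<and> (v, keep x y b g) \<notin> link x' y' F"

lemma pending_init:
  assumes "fits x y F" "search x y F r f D S ph pv ps K" "h \<in> insert f D" "v \<in> side b h"
    "keep x y b h \<in> S" "(v, r) \<notin> link x y F"
  shows "pending x y F f D K x y h v b"
proof -
  have "(keep x y b h, r) \<in> link x y D"
    using assms(2,5) by (auto simp: search_def tree_def)
  then have "(keep x y b h, r) \<in> link x y F"
    by (rule link_mono[rotated]) (use assms(2) in \<open>auto simp: search_def\<close>)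
  then show ?thesis
    using assms unfolding pending_def by (auto intro: link_sym link_trans)
qed

text \<open>Used as \<open>move b\<close> on the first ends and as \<open>move (\<not> b)\<close> on
  the second ends, so exactly one of the two functions is updated.\<close>

definition move :: "bool \<Rightarrow> 'i \<Rightarrow> 'v \<Rightarrow> ('i \<Rightarrow> 'v) \<Rightarrow> ('i \<Rightarrow> 'v)" where
  "move b g v x = (if b then x(g := v) else x)"

lemma pending_step:
  assumes s: "search x y F r f D S ph pv ps K" and p: "pending x y F f D K x' y' g v b"
    and g: "g \<noteq> f"
  shows "pending x y F f D K (move b g v x') (move (\<not> b) g v y') (ph g) (pv g) (ps g)"
    "K (ph g) \<subset> K g"
proof -
  have gD: "g \<in> D" using p g by (auto simp: pending_def)
  have K: "g \<in> K g" "K g \<subseteq> D" "K (ph g) \<subseteq> K g - {g}" "D \<subseteq> F" "f \<notin> F"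
    and po: "pred_ok x y r f D (ph g) (pv g) (ps g) g (K g)"
    using s gD unfolding search_def by blast+
  show "K (ph g) \<subset> K g" using K by auto
  have gF: "g \<in> F" using gD K by auto
  define a c where "a = (if b then v else x' g)" and "c = (if b then y' g else v)"
  have mv: "move b g v x' = x'(g := a)" "move (\<not> b) g v y' = y'(g := c)"
    by (auto simp: move_def a_def c_def)
  \<comment> \<open>The members of \<open>K g\<close>, including \<open>g\<close>, still have their
    original ends, so links inside \<open>K g\<close> recorded by the search are links of the
    current forest.\<close>
  have same: "x' g = x g" "y' g = y g" using p K by (auto simp: pending_def)
  have eqK: "link x' y' (K g - {g}) = link x y (K g - {g})"
    by (rule link_cong) (use p in \<open>auto simp: pending_def\<close>)
  have "ends_to x y (K g) g (pv g) r" using po by (simp add: pred_ok_def)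
  then have "ends_to x' y' (K g) g (pv g) r"
    unfolding ends_to_def eqK same .
  then have et: "ends_to x' y' F g (pv g) r"
    by (rule ends_to_mono) (use K in auto)
  have ac: "acyc x' y' F" and new: "(a, c) \<notin> link x' y' F"
    using p same unfolding pending_def fits_def a_def c_def keep_def by (auto dest: link_sym)
  note ex = exchange[OF ac gF new et]
  have "(r, keep x y (ps g) (ph g)) \<in> link (x'(g := a)) (y'(g := c)) (K g - {g})"
  proof -
    have "link (x'(g := a)) (y'(g := c)) (K g - {g}) = link x' y' (K g - {g})"
      by (rule link_cong) auto
    then show ?thesis using po by (simp add: pred_ok_def eqK)
  qed
  then have "(r, keep x y (ps g) (ph g)) \<in> link (x'(g := a)) (y'(g := c)) F"
    by (rule link_mono[rotated]) (use K in auto)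
  then have "(pv g, keep x y (ps g) (ph g)) \<notin> link (x'(g := a)) (y'(g := c)) F"
    using ex(2) by (meson link_sym link_trans)
  moreover have "fits (x'(g := a)) (y'(g := c)) F"
    using ex(1) p gF unfolding fits_def pending_def a_def c_def by (auto simp: side_def split: if_splits)
  moreover have "\<forall>h\<in>insert f (K (ph g)). (x'(g := a)) h = x h \<and> (y'(g := c)) h = y h"
    using p K g by (auto simp: pending_def)
  ultimately show "pending x y F f D K (move b g v x') (move (\<not> b) g v y') (ph g) (pv g) (ps g)"
    using po unfolding mv pending_def by (simp add: pred_ok_def)
qed

text \<open>\<open>f\<close> is not in the family, so moving its end leaves the forest as it is.
  What is pending for \<open>f\<close> says exactly that its new pair joins two different
  trees.\<close>

lemma pending_finish:
  assumes p: "pending x y F f D K x' y' f v b" and f: "f \<notin> F" "x f \<in> A f" "y f \<in> B f"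
  shows "fits (move b f v x') (move (\<not> b) f v y') (insert f F)"
proof -
  let ?x = "move b f v x'" and ?y = "move (\<not> b) f v y'"
  have eq: "link ?x ?y F = link x' y' F"
    by (rule link_cong) (use f in \<open>auto simp: move_def\<close>)
  have "acyc ?x ?y F = acyc x' y' F"
    by (rule acyc_cong) (use f in \<open>auto simp: move_def\<close>)
  then have "acyc ?x ?y F"
    using p by (simp add: pending_def fits_def)
  moreover have "(?x f, ?y f) \<notin> link ?x ?y F"
    unfolding eq using p by (auto simp: move_def pending_def keep_def dest: link_sym)
  ultimately have "acyc ?x ?y (insert f F)" using f by (intro acyc_insert)
  then show ?thesis
    using p f by (auto simp: fits_def move_def pending_def side_def)
qed

lemma rooted_not_link: "rooted x y F r C par pg dp \<Longrightarrow> v \<notin> C \<Longrightarrow> (v, r) \<notin> link x y F"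
  using link_closed[of r v x y F C] link_sym[of v r x y F] unfolding rooted_def by blast

text \<open>The depth is the distance from \<open>r\<close>, and the parent is the next vertex on a
  shortest walk.\<close>

lemma rooted_exists: "\<exists>par pg dp. rooted x y F r {v. (v, r) \<in> link x y F} par pg dp"
proof -
  define R where "R = (\<Union>g\<in>F. {(x g, y g), (y g, x g)})"
  have L: "link x y F = R\<^sup>*" by (simp add: link_def R_def)
  define dp where "dp v = (LEAST n. (v, r) \<in> R ^^ n)" for v
  have "\<exists>u g. (u, r) \<in> link x y F \<and> g \<in> F \<and> {x g, y g} = {v, u} \<and> dp u < dp v"
    if v: "(v, r) \<in> link x y F" "v \<noteq> r" for v
  proof -
    have dv: "(v, r) \<in> R ^^ dp v"
      unfolding dp_def using v(1) by (auto simp: L rtrancl_power intro: LeastI)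
    then obtain k where k: "dp v = Suc k" using v(2) by (cases "dp v") auto
    with dv obtain u where u: "(v, u) \<in> R" "(u, r) \<in> R ^^ k" by (metis relpow_Suc_E2)
    have "dp u \<le> k" unfolding dp_def using u(2) by (rule Least_le)
    moreover have "(u, r) \<in> link x y F" using u(2) by (auto simp: L rtrancl_power)
    ultimately show ?thesis using u(1) k by (fastforce simp: R_def)
  qed
  then obtain par pg where "\<And>v. (v, r) \<in> link x y F \<Longrightarrow> v \<noteq> r \<Longrightarrow> (par v, r) \<in> link x y F \<and>
      pg v \<in> F \<and> {x (pg v), y (pg v)} = {v, par v} \<and> dp (par v) < dp v"
    by metis
  moreover have "(x g, r) \<in> link x y F \<longleftrightarrow> (y g, r) \<in> link x y F" if "g \<in> F" for g
    using link_edge[OF that, of x y] by (meson link_sym link_trans)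
  ultimately show ?thesis unfolding rooted_def by (intro exI[of _ par] exI[of _ pg] exI[of _ dp]) auto
qed

text \<open>The last conjunct says that a walk starting outside \<open>S0\<close> discovers a new
  member. This is what contradicts the maximality of a search.\<close>

lemma walk_exists:
  assumes rt: "rooted x y F r C par pg dp" and r: "r \<in> S0"
    and w: "walk x y F C dp D0 S0 D S v w"
  shows "\<exists>D' S' w'. walk x y F C dp D0 S0 D' S' v w' \<and> w' \<in> S0 \<and> D \<subseteq> D' \<and> (w \<notin> S0 \<longrightarrow> D' \<noteq> D)"
  using w
proof (induction "dp w" arbitrary: D S w rule: less_induct)
  case less
  show ?case
  proof (cases "w \<in> S0")
    case True
    then show ?thesis using less.prems by blast
  next
    case False
    note st = walk_step[OF rt r less.prems False]
    have "dp (par w) < dp w" using st(3) False by (auto simp: walk_def)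
    from less.hyps[OF this st(3)] st(2) show ?thesis by blast
  qed
qed

text \<open>The extreme case of \<open>fits_card\<close>: the members confined to \<open>W\<close>
  span it by a tree, which leaves no room for another confined member.\<close>

definition tight :: "'i set \<Rightarrow> 'v set \<Rightarrow> bool" where
  "tight F W \<longleftrightarrow> finite W \<and> card W = Suc (card {g\<in>F. U g \<subseteq> W})"

lemma fits_card:
  assumes "fits x y F" "finite F" "finite W" "W \<noteq> {}"
  shows "card {g\<in>F. U g \<subseteq> W} < card W"
  by (rule acyc_card[of _ _ x y])
    (use assms in \<open>auto simp: fits_def U_def intro: acyc_mono\<close>)

lemma search_tight:
  assumes s: "search x y F r f D S ph pv ps K" and F: "fits x y F" "finite F"
    and U: "\<And>h. h \<in> insert f D \<Longrightarrow> U h \<subseteq> S"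
  shows "tight F S"
proof -
  have "tree x y r D S" "D \<subseteq> F" using s by (auto simp: search_def)
  then have S: "finite S" "S \<noteq> {}" "card S = Suc (card D)" by (auto simp: tree_def)
  have "D \<subseteq> {g\<in>F. U g \<subseteq> S}" using U \<open>D \<subseteq> F\<close> by auto
  then have "card D \<le> card {g\<in>F. U g \<subseteq> S}" using F by (intro card_mono) auto
  with fits_card[OF F S(1,2)] S show ?thesis by (auto simp: tight_def)
qed

lemma pending_fits:
  assumes s: "search x y F r f D S ph pv ps K" and "pending x y F f D K x' y' g v b"
    and "x f \<in> A f" "y f \<in> B f"
  shows "\<exists>x' y'. fits x' y' (insert f F)"
  using assms(2)
proof (induction "card (K g)" arbitrary: x' y' g v b rule: less_induct)
  case less
  show ?case
  proof (cases "g = f")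
    case True
    have "f \<notin> F" using s by (simp add: search_def)
    then show ?thesis using less.prems assms(3,4) True pending_finish by blast
  next
    case False
    note st = pending_step[OF s less.prems False]
    have "g \<in> D" using less.prems False by (auto simp: pending_def)
    then have "K g \<subseteq> D" "finite D" using s by (auto simp: search_def tree_def)
    then have "card (K (ph g)) < card (K g)"
      using st(2) by (intro psubset_card_mono) (auto intro: finite_subset)
    from less.hyps[OF this st(1)] show ?thesis .
  qed
qed

lemma search_init: "f \<notin> F \<Longrightarrow> K f = {} \<Longrightarrow> search x y F r f {} {r} ph pv ps K"
  by (simp add: search_def tree_def)

lemma search_ends:
  assumes "search x y F r f D S ph pv ps K" "r = x f" "h \<in> insert f D"
  shows "x h \<in> S" "h \<noteq> f \<Longrightarrow> y h \<in> S"
  using assms by (auto simp: search_def tree_def)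

text \<open>The root is an end of \<open>f\<close> on side \<open>A\<close>, so ends on side \<open>B\<close> are handled before those on side \<open>A\<close>.\<close>

lemma fits_or_tight:
  assumes F: "fits x0 y0 F" "finite F" and f: "f \<notin> F" "A f \<noteq> {}" "B f \<noteq> {}"
  shows "(\<exists>x y. fits x y (insert f F)) \<or> (\<exists>W. tight F W \<and> U f \<subseteq> W)"
proof -
  obtain a b where ab: "a \<in> A f" "b \<in> B f" using f by auto
  \<comment> \<open>Provisional ends for \<open>f\<close>, which lies outside \<open>F\<close> and
    so leaves the forest alone. The first of them becomes the root of the search.\<close>
  define x y where "x = x0(f := a)" and "y = y0(f := b)"
  have ends: "x f \<in> A f" "y f \<in> B f" using ab by (auto simp: x_def y_def)
  have "acyc x y F = acyc x0 y0 F"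
    by (rule acyc_cong) (use f in \<open>auto simp: x_def y_def\<close>)
  then have fit: "fits x y F"
    using F(1) f by (auto simp: fits_def x_def y_def)
  define r where "r = x f"
  let ?s = "\<lambda>D S ph pv ps K. search x y F r f D S ph pv ps K"
  \<comment> \<open>A search with the largest \<open>D\<close> stands for one that has run to
    completion; its size is at most \<open>card F\<close>.\<close>
  obtain D S ph pv ps K where s: "?s D S ph pv ps K"
    and max: "\<And>D' S' ph' pv' ps' K'. ?s D' S' ph' pv' ps' K' \<Longrightarrow> card D' \<le> card D"
  proof -
    define P where "P n \<longleftrightarrow> (\<exists>D S ph pv ps K. ?s D S ph pv ps K \<and> card D = n)" for n
    have "?s {} {r} (\<lambda>_. f) (\<lambda>_. r) (\<lambda>_. True) (\<lambda>_. {})"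
      using f by (intro search_init) auto
    then have "P 0" unfolding P_def by (metis card.empty)
    moreover have "\<forall>n. P n \<longrightarrow> n \<le> card F"
      unfolding P_def search_def using F(2) by (auto intro: card_mono)
    ultimately obtain n where "P n" "\<forall>m. P m \<longrightarrow> m \<le> n"
      using Nat.ex_has_greatest_nat[of P 0 "card F"] by blast
    then show ?thesis using that unfolding P_def by blast
  qed
  define C where C: "C = {v. (v, r) \<in> link x y F}"
  obtain par pg dp where rt: "rooted x y F r C par pg dp"
    unfolding C using rooted_exists[of x y F r] by (elim exE)
  have rS: "r \<in> S" and DF: "D \<subseteq> F" and fin: "finite D" using s by (auto simp: search_def tree_def)
  \<comment> \<open>Inside the tree of the root, a walk from \<open>v\<close> would enlarge the
    maximal search unless \<open>v\<close> is already in \<open>S\<close>. Outside that tree,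
    \<open>v\<close> starts a chain of moves that makes room for \<open>f\<close>.\<close>
  have reach: "v \<in> S \<or> (\<exists>x y. fits x y (insert f F))"
    if h: "h \<in> insert f D" "v \<in> side b h" "keep x y b h \<in> S" for h v b
  proof (cases "v \<in> C")
    case True
    from walk_exists[OF rt rS walk_init[OF s True]] obtain D' S' w
      where w: "walk x y F C dp D S D' S' v w" "w \<in> S" "D \<subseteq> D'" "v \<notin> S \<longrightarrow> D' \<noteq> D" by blast
    have "card D' \<le> card D"
      by (rule max, rule walk_finish[OF s w(1,2) h, of "\<lambda>g. if g \<in> D' - D then h else ph g"
        "\<lambda>g. if g \<in> D' - D then v else pv g" "\<lambda>g. if g \<in> D' - D then b else ps g"]) auto
    moreover have "finite D'" using w(1) by (auto simp: walk_def)
    ultimately have "D' = D" using w(3) by (metis card_seteq)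
    then show ?thesis using w(4) by simp
  next
    case False
    then have "(v, r) \<notin> link x y F" by (simp add: C)
    from pending_fits[OF s pending_init[OF fit s h this] ends] show ?thesis by simp
  qed
  show ?thesis
  proof (cases "\<exists>x y. fits x y (insert f F)")
    case False
    have B: "B h \<subseteq> S" if "h \<in> insert f D" for h
      using reach[of h _ False] that False search_ends[OF s r_def that]
      by (auto simp: side_def keep_def)
    have y: "y h \<in> S" if "h \<in> insert f D" for h
      using B[OF that] that fit DF ends by (auto simp: fits_def)
    have "A h \<subseteq> S" if "h \<in> insert f D" for h
      using reach[of h _ True] that False y[OF that] by (auto simp: side_def keep_def)
    with B have "U h \<subseteq> S" if "h \<in> insert f D" for h
      using that by (auto simp: U_def)
    with search_tight[OF s fit F(2)] show ?thesis by blast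
  qed simp
qed

text \<open>The number of confined members is supermodular in \<open>W\<close> and the cardinality
  is modular. Since union and intersection both obey the strict bound of \<open>fits_card\<close>,
  equality for \<open>W\<close> and \<open>W'\<close> passes to the union. The intersection must be
  nonempty for its bound to hold.\<close>

lemma tight_Un:
  assumes F: "fits x y F" "finite F" and W: "tight F W" "tight F W'" "W \<inter> W' \<noteq> {}"
  shows "tight F (W \<union> W')"
proof -
  let ?i = "\<lambda>W. {g\<in>F. U g \<subseteq> W}"
  have fin: "finite W" "finite W'" using W by (auto simp: tight_def)
  have "card (?i W) + card (?i W') = card (?i W \<union> ?i W') + card (?i W \<inter> ?i W')"
    using F(2) by (intro card_Un_Int) auto
  also have "?i W \<inter> ?i W' = ?i (W \<inter> W')" by auto
  finally have "card (?i W) + card (?i W') = card (?i W \<union> ?i W') + card (?i (W \<inter> W'))" .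
  moreover have "card (?i W \<union> ?i W') \<le> card (?i (W \<union> W'))"
    using F(2) by (intro card_mono) auto
  moreover have "card (?i (W \<inter> W')) < card (W \<inter> W')"
    by (rule fits_card[OF F]) (use fin W in auto)
  moreover have "card (?i (W \<union> W')) < card (W \<union> W')"
    by (rule fits_card[OF F]) (use fin W in auto)
  moreover have "card W + card W' = card (W \<union> W') + card (W \<inter> W')"
    using fin by (rule card_Un_Int)
  ultimately show ?thesis using W fin by (auto simp: tight_def)
qed

text \<open>Tightness does not mention where the ends currently are, so it survives the moves made
  when the family grows. This is why a rejected element never has to be reconsidered.\<close>

lemma tight_mono:
  assumes "tight F W" "fits x y F'" "finite F'" "F \<subseteq> F'"
  shows "tight F' W"
proof -
  have W: "finite W" "W \<noteq> {}" using assms(1) by (auto simp: tight_def)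
  have "card {g\<in>F. U g \<subseteq> W} \<le> card {g\<in>F'. U g \<subseteq> W}"
    using assms by (intro card_mono) auto
  with fits_card[OF assms(2,3) W] assms(1) W show ?thesis by (auto simp: tight_def)
qed

end

section \<open>Eardrums and earmuffs\<close>

lemma seq_link:
  assumes "\<And>i. a \<le> i \<Longrightarrow> i < b \<Longrightarrow> \<exists>e\<in>E. {s e, t e} = {vs ! i, vs ! Suc i}" "a \<le> b"
  shows "(vs ! a, vs ! b) \<in> link s t E"
  using assms(2,1)
proof (induction rule: dec_induct)
  case (step n)
  from step.prems[of n] step.hyps obtain e where e: "e \<in> E" "{s e, t e} = {vs ! n, vs ! Suc n}"
    by auto
  then have "(vs ! n, vs ! Suc n) \<in> link s t E"
    using link_edge[OF e(1), of s t] by (auto simp: doubleton_eq_iff intro: link_sym)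
  with step show ?case by (auto intro: link_trans)
qed simp

text \<open>The path is kept free of repetitions by cutting it back whenever the next vertex already
  lies on it.\<close>

lemma link_path:
  assumes "(a, b) \<in> link s t E"
  shows "\<exists>vs es. length vs = Suc (length es) \<and> distinct vs \<and> set es \<subseteq> E \<and> hd vs = a \<and> last vs = b \<and>
    (\<forall>i<length es. {s (es ! i), t (es ! i)} = {vs ! i, vs ! Suc i}) \<and>
    set vs \<subseteq> insert a (\<Union>e\<in>E. {s e, t e})"
  using assms
proof (induction rule: link_induct)
  case refl
  show ?case by (rule exI[of _ "[a]"], rule exI[of _ "[]"]) auto
next
  case (step c d g)
  then obtain vs es where p: "length vs = Suc (length es)" "distinct vs" "set es \<subseteq> E" "hd vs = a"
    "last vs = c" "\<forall>i<length es. {s (es ! i), t (es ! i)} = {vs ! i, vs ! Suc i}"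
    "set vs \<subseteq> insert a (\<Union>e\<in>E. {s e, t e})" by blast
  show ?case
  proof (cases "d \<in> set vs")
    case True
    then obtain i where i: "i < length vs" "vs ! i = d" by (auto simp: in_set_conv_nth)
    show ?thesis
    proof (intro exI conjI)
      show "length (take (Suc i) vs) = Suc (length (take i es))" using i p(1) by auto
      show "last (take (Suc i) vs) = d" using i by (simp add: take_Suc_conv_app_nth)
      show "hd (take (Suc i) vs) = a" using p(4) by simp
      show "\<forall>j<length (take i es). {s (take i es ! j), t (take i es ! j)} =
          {take (Suc i) vs ! j, take (Suc i) vs ! Suc j}"
        using p(6) by auto
    qed (use p in \<open>auto dest: in_set_takeD\<close>)
  next
    case False
    have vs: "vs \<noteq> []" using p(1) by auto
    show ?thesis
    proof (intro exI conjI)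
      show "length (vs @ [d]) = Suc (length (es @ [g]))" using p(1) by simp
      show "\<forall>i<length (es @ [g]). {s ((es @ [g]) ! i), t ((es @ [g]) ! i)} =
          {(vs @ [d]) ! i, (vs @ [d]) ! Suc i}"
      proof (intro allI impI)
        fix i assume i: "i < length (es @ [g])"
        show "{s ((es @ [g]) ! i), t ((es @ [g]) ! i)} = {(vs @ [d]) ! i, (vs @ [d]) ! Suc i}"
        proof (cases "i < length es")
          case True
          then show ?thesis using p(1,6) by (auto simp: nth_append)
        next
          case False
          then have "i = length es" using i by simp
          moreover have "vs ! length es = c" using p(1,5) vs by (simp add: last_conv_nth)
          ultimately show ?thesis using p(1) step.hyps by (auto simp: nth_append)
        qed
      qed
    qed (use p False vs step.hyps in auto)
  qed
qed

lemma distinct_edges: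
  assumes "distinct vs" "length vs = Suc (length es)"
    "\<forall>i<length es. E (es ! i) = {vs ! i, vs ! Suc i}"
  shows "distinct es"
  unfolding distinct_conv_nth
proof (intro allI impI)
  fix i j assume ij: "i < length es" "j < length es" "i \<noteq> j"
  show "es ! i \<noteq> es ! j"
  proof
    assume "es ! i = es ! j"
    then have "{vs ! i, vs ! Suc i} = {vs ! j, vs ! Suc j}" using assms(3) ij by metis
    then show False
      using assms(1,2) ij by (auto simp: doubleton_eq_iff nth_eq_iff_index_eq)
  qed
qed

text \<open>\<open>s\<close> and \<open>t\<close> orient each edge arbitrarily. An edge whose ends
  are joined by other edges closes a cycle with a path between them, and a cycle without its first
  edge joins the ends of that edge. Parallel edges give the case of a path with one edge.\<close>

lemma forest_iff_acyc:
  assumes E: "\<And>e. e \<in> edges H \<Longrightarrow> ends H e = {s e, t e} \<and> s e \<noteq> t e \<and> s e \<in> verts H \<and> t e \<in> verts H"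
  shows "forest H \<longleftrightarrow> acyc s t (edges H)"
proof
  assume "forest H"
  show "acyc s t (edges H)"
    unfolding acyc_def
  proof (intro ballI notI)
    fix e assume e: "e \<in> edges H" and "(s e, t e) \<in> link s t (edges H - {e})"
    from link_path[OF this(2)] obtain vs es where
      p: "length vs = Suc (length es)" "distinct vs" "set es \<subseteq> edges H - {e}" "hd vs = s e"
        "last vs = t e" "\<forall>i<length es. {s (es ! i), t (es ! i)} = {vs ! i, vs ! Suc i}"
        "set vs \<subseteq> insert (s e) (\<Union>e\<in>edges H - {e}. {s e, t e})"
      by blast
    have vs: "vs \<noteq> []" using p(1) by auto
    have es: "es \<noteq> []"
      using p(1,4,5) E[OF e] by (cases vs) auto
    have "cycle H vs (es @ [e])"
      unfolding cycle_def
    proof (intro conjI allI impI)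
      show "2 \<le> length (es @ [e])" using es by (cases es) auto
      show "distinct (es @ [e])"
        using distinct_edges[of vs es "\<lambda>e. {s e, t e}"] p by auto
      show "set vs \<subseteq> verts H" using p(7) E e by auto
      fix i assume i: "i < length (es @ [e])"
      show "ends H ((es @ [e]) ! i) = {vs ! i, vs ! (Suc i mod length (es @ [e]))}"
      proof (cases "i < length es")
        case True
        then have "es ! i \<in> edges H" using p(3) nth_mem by fastforce
        then show ?thesis using p(6) True E by (simp add: nth_append)
      next
        case False
        then have [simp]: "i = length es" using i by simp
        have "vs ! length es = t e" "vs ! 0 = s e" using p(1,4,5) vs by (simp_all add: last_conv_nth hd_conv_nth)
        then show ?thesis using E[OF e] by auto
      qed
    qed (use p e in auto)
    with \<open>forest H\<close> show False by (auto simp: forest_def)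
  qed
next
  assume ac: "acyc s t (edges H)"
  show "forest H"
    unfolding forest_def
  proof clarify
    fix vs es assume "cycle H vs es"
    then have c: "length es \<ge> 2" "length vs = length es" "distinct es" "set es \<subseteq> edges H"
      "\<And>i. i < length es \<Longrightarrow> ends H (es ! i) = {vs ! i, vs ! (Suc i mod length es)}"
      by (auto simp: cycle_def)
    define l e where "l = length es - 1" and "e = es ! 0"
    have l: "l \<ge> 1" "length es = Suc l" using c(1) by (auto simp: l_def)
    have inE: "es ! i \<in> edges H - {e}" if "0 < i" "i \<le> l" for i
      using that c(3,4) l nth_mem[of i es] by (auto simp: e_def nth_eq_iff_index_eq)
    have e: "e \<in> edges H" using c(4) l by (auto simp: e_def)
    have st: "{s (es ! i), t (es ! i)} = {vs ! i, vs ! (Suc i mod length es)}" if "i \<le> l" for i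
    proof -
      have "es ! i \<in> edges H" using c(4) l that by auto
      then show ?thesis using E c(5)[of i] l that by auto
    qed
    have "(vs ! 1, vs ! l) \<in> link s t (edges H - {e})"
    proof (rule seq_link)
      fix i assume i: "1 \<le> i" "i < l"
      then show "\<exists>e\<in>edges H - {e}. {s e, t e} = {vs ! i, vs ! Suc i}"
        using st[of i] l inE[of i] by (intro bexI[of _ "es ! i"]) auto
    qed (use l in auto)
    moreover have "(vs ! l, vs ! 0) \<in> link s t (edges H - {e})"
      using st[of l] l link_edge[OF inE[of l], of s t]
      by (auto simp: doubleton_eq_iff intro: link_sym)
    ultimately have "(vs ! 1, vs ! 0) \<in> link s t (edges H - {e})" by (rule link_trans)
    then have "(s e, t e) \<in> link s t (edges H - {e})"
      using st[of 0] l by (auto simp: e_def doubleton_eq_iff intro: link_sym)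
    with ac e show False by (auto simp: acyc_def)
  qed
qed

section \<open>From graph and eardrum to slots\<close>

lemma multigraph_ends:
  assumes "multigraph G"
  shows "\<exists>s t. \<forall>e\<in>edges G. ends G e = {s e, t e} \<and> s e \<noteq> t e \<and> s e \<in> verts G \<and> t e \<in> verts G"
proof -
  have "\<forall>e\<in>edges G. \<exists>u v. ends G e = {u, v} \<and> u \<noteq> v \<and> u \<in> verts G \<and> v \<in> verts G"
  proof
    fix e assume "e \<in> edges G"
    then have "ends G e \<subseteq> verts G" "card (ends G e) = 2" using assms by (auto simp: multigraph_def)
    then show "\<exists>u v. ends G e = {u, v} \<and> u \<noteq> v \<and> u \<in> verts G \<and> v \<in> verts G"
      by (auto simp: card_2_iff)
  qed
  then show ?thesis by metis
qed

lemma eardrum_props: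
  assumes G: "multigraph G" and M: "eardrum G M"
  shows "f \<in> M \<Longrightarrow> f \<subseteq> verts G" "f \<in> M \<Longrightarrow> \<exists>u v. f = {u, v}"
    "f \<in> M \<Longrightarrow> g \<in> M \<Longrightarrow> u \<in> f \<Longrightarrow> u \<in> g \<Longrightarrow> f = g"
    "f \<in> M \<Longrightarrow> g \<in> M \<Longrightarrow> e \<in> edges G \<Longrightarrow> ends G e = {u, v} \<Longrightarrow> u \<in> f \<Longrightarrow> v \<in> g \<Longrightarrow> f = g"
proof -
  from M obtain X where X: "X \<subseteq> verts G" "\<forall>v\<in>X. degree (induced G X) v \<le> 1"
    "M = components (induced G X)" by (auto simp: eardrum_def)
  let ?H = "induced G X"
  have H: "verts ?H = X" "edges ?H = {e \<in> edges G. ends G e \<subseteq> X}" "ends ?H = ends G"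
    by (auto simp: induced_def)
  have fin: "finite (edges ?H)" using G H by (auto simp: multigraph_def)
  have uniq: "e = e'" if "v \<in> X" "e \<in> edges ?H" "e' \<in> edges ?H" "v \<in> ends G e" "v \<in> ends G e'" for v e e'
  proof -
    have "finite {e \<in> edges ?H. v \<in> ends ?H e}" using fin by auto
    moreover have "card {e \<in> edges ?H. v \<in> ends ?H e} \<le> Suc 0"
      using X(2) that(1) by (auto simp: degree_def)
    ultimately have "\<forall>a\<in>{e \<in> edges ?H. v \<in> ends ?H e}. \<forall>b\<in>{e \<in> edges ?H. v \<in> ends ?H e}. a = b"
      by (subst (asm) card_le_Suc0_iff_eq)
    then show ?thesis using that H(3) by auto
  qed
  have joined: "joined ?H u v \<longleftrightarrow> u = v \<or> (\<exists>e\<in>edges ?H. ends G e = {u, v})"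
    if u: "u \<in> X" for u v
  proof
    assume "joined ?H u v"
    then obtain vs es where p: "path ?H vs es" "hd vs = u" "last vs = v" by (auto simp: joined_def)
    have len: "length vs = Suc (length es)" "distinct vs" "set vs \<subseteq> X" "set es \<subseteq> edges ?H"
      "\<And>i. i < length es \<Longrightarrow> ends G (es ! i) = {vs ! i, vs ! Suc i}"
      using p(1) H by (auto simp: path_def)
    have "length es < 2"
    proof (rule ccontr)
      assume "\<not> length es < 2"
      then have l: "0 < length es" "1 < length es" by auto
      \<comment> \<open>Both edges contain \<open>vs ! 1\<close>, whose degree in the induced
        subgraph is at most 1.\<close>
      have "es ! 0 = es ! 1"
        by (rule uniq[of "vs ! 1"]) (use l len in auto)
      then have "{vs ! 0, vs ! 1} = {vs ! 1, vs ! 2}"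
        using len(5)[OF l(1)] len(5)[OF l(2)] by (simp add: numeral_2_eq_2)
      then show False using len(1,2) l by (auto simp: doubleton_eq_iff nth_eq_iff_index_eq)
    qed
    then consider "es = []" | e where "es = [e]"
      by (cases es; cases "tl es") auto
    then show "u = v \<or> (\<exists>e\<in>edges ?H. ends G e = {u, v})"
    proof cases
      case 1
      then show ?thesis using len(1) p by (cases vs) auto
    next
      case 2
      then obtain a b where "vs = [a, b]" using len(1) by (auto simp: length_Suc_conv)
      then show ?thesis using p len 2 by auto
    qed
  next
    assume "u = v \<or> (\<exists>e\<in>edges ?H. ends G e = {u, v})"
    then show "joined ?H u v"
    proof
      assume "u = v"
      then show ?thesis using u unfolding joined_def
        by (intro exI[of _ "[u]"] exI[of _ "[]"]) (auto simp: path_def H)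
    next
      assume "\<exists>e\<in>edges ?H. ends G e = {u, v}"
      then obtain e where e: "e \<in> edges ?H" "ends G e = {u, v}" by auto
      moreover have "card (ends G e) = 2" using e H G by (auto simp: multigraph_def)
      ultimately have "u \<noteq> v" by auto
      then show ?thesis using e H(2) unfolding joined_def
        by (intro exI[of _ "[u, v]"] exI[of _ "[e]"]) (auto simp: path_def H)
    qed
  qed
  \<comment> \<open>By the degree bound the component of \<open>u\<close> is its closed
    neighbourhood, which turns all claims about components into claims about single edges.\<close>
  define N where "N u = {v \<in> X. u = v \<or> (\<exists>e\<in>edges ?H. ends G e = {u, v})}" for u
  have MN: "M = N ` X"
  proof -
    have "{v \<in> X. joined ?H u v} = N u" if "u \<in> X" for u
      using joined[OF that] by (simp add: N_def)
    then have "(\<lambda>u. {v \<in> X. joined ?H u v}) ` X = N ` X" by (rule image_cong[OF refl])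
    then show ?thesis unfolding X(3) components_def H(1) by (simp add: Setcompr_eq_image)
  qed
  have Nsym: "v \<in> N u \<Longrightarrow> u \<in> X \<Longrightarrow> u \<in> N v" for u v
    by (auto simp: N_def insert_commute)
  have N2: "\<exists>v. N u = {u, v}" if "u \<in> X" for u
  proof (cases "\<exists>v\<in>X. \<exists>e\<in>edges ?H. ends G e = {u, v}")
    case True
    then obtain v e where v: "v \<in> X" "e \<in> edges ?H" "ends G e = {u, v}" by auto
    have "w = u \<or> w = v" if "w \<in> N u" for w
      using that v uniq[OF \<open>u \<in> X\<close> v(2)] unfolding N_def by (auto simp: doubleton_eq_iff)
    then have "N u = {u, v}" using v that by (auto simp: N_def)
    then show ?thesis by blast
  next
    case False
    then have "N u = {u, u}" using that by (auto simp: N_def)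
    then show ?thesis by blast
  qed
  have Neq: "N u = N v" if "v \<in> N u" "u \<in> X" for u v
  proof (cases "u = v")
    case False
    have "v \<in> X" using that by (auto simp: N_def)
    with that N2[of u] N2[of v] Nsym[of v u] False show ?thesis by auto
  qed simp
  show "f \<in> M \<Longrightarrow> f \<subseteq> verts G" using X(1) by (auto simp: MN N_def)
  show "f \<in> M \<Longrightarrow> \<exists>u v. f = {u, v}" using N2 unfolding MN by (elim imageE) metis
  have dis: "f = g" if "f \<in> M" "g \<in> M" "u \<in> f" "u \<in> g" for f g u
  proof -
    obtain a b where "a \<in> X" "b \<in> X" "f = N a" "g = N b" using \<open>f \<in> M\<close> \<open>g \<in> M\<close> unfolding MN by auto
    then show ?thesis using Neq[of u a] Neq[of u b] that by simp
  qed
  then show "f \<in> M \<Longrightarrow> g \<in> M \<Longrightarrow> u \<in> f \<Longrightarrow> u \<in> g \<Longrightarrow> f = g" .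
  show "f = g" if "f \<in> M" "g \<in> M" "e \<in> edges G" "ends G e = {u, v}" "u \<in> f" "v \<in> g"
  proof -
    have uv: "u \<in> X" "v \<in> X" using that by (auto simp: MN N_def)
    then have "v \<in> N u" using that by (auto simp: N_def H)
    moreover have "u \<in> N u" using uv by (auto simp: N_def)
    moreover have "N u \<in> M" using uv MN by auto
    ultimately show ?thesis using dis[of f "N u" u] dis[of g "N u" v] that by simp
  qed
qed

text \<open>The index set is left open: for the min-max formula it is \<open>M\<close> itself, for
  the program it is the set of array positions. A one-element member of \<open>M\<close> has
  \<open>p i = q i\<close>.\<close>

locale ear_system =
  fixes G :: "('v, 'e) mgraph" and M :: "'v set set" and I :: "'i set" and p q :: "'i \<Rightarrow> 'v"
  assumes multigraph: "multigraph G" and eardrum: "eardrum G M"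
    and nonempty: "f \<in> M \<Longrightarrow> ear_paths G f \<noteq> {}"
    and bij: "bij_betw (\<lambda>i. {p i, q i}) I M"
begin

definition outer :: "'v set" where "outer = verts G - \<Union>M"

definition A where "A i = {v \<in> outer. \<exists>e\<in>edges G. ends G e = {p i, v}}"

definition B where "B i = {v \<in> outer. \<exists>e\<in>edges G. ends G e = {q i, v}}"

sublocale slots A B .

lemma in_M: "i \<in> I \<Longrightarrow> {p i, q i} \<in> M"
  using bij by (auto simp: bij_betw_def)

lemma finite_I: "finite I"
proof -
  have "M \<subseteq> Pow (verts G)" using eardrum_props(1)[OF multigraph eardrum] by auto
  then have "finite M" using multigraph by (meson finite_Pow_iff finite_subset multigraph_def)
  then show ?thesis using bij_betw_finite[OF bij] by simp
qed

lemma finite_outer: "finite outer"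
  using multigraph by (simp add: multigraph_def outer_def)

lemma same_index:
  assumes "i \<in> I" "j \<in> I" "u \<in> {p i, q i}" "u \<in> {p j, q j}"
  shows "i = j"
proof -
  have "{p i, q i} = {p j, q j}"
    by (rule eardrum_props(3)[OF multigraph eardrum in_M in_M]) (use assms in auto)
  then show ?thesis using bij assms by (auto simp: bij_betw_def inj_on_def)
qed

text \<open>Members of \<open>M\<close> are components of an induced subgraph, so no edge of
  \<open>G\<close> joins two of them.\<close>

lemma inner_edge:
  assumes "i \<in> I" "e \<in> edges G" "ends G e = {u, v}" "u \<in> {p i, q i}"
  shows "v \<in> outer \<or> {p i, q i} = {u, v}"
proof (cases "v \<in> \<Union>M")
  case True
  then obtain g where g: "g \<in> M" "v \<in> g" by auto
  have "{p i, q i} = g"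
    by (rule eardrum_props(4)[OF multigraph eardrum in_M g(1) assms(2,3,4) g(2)]) fact
  moreover have "u \<noteq> v" using assms multigraph by (auto simp: multigraph_def)
  ultimately show ?thesis using g assms(4) by auto
next
  case False
  then show ?thesis using multigraph assms by (auto simp: multigraph_def outer_def)
qed

text \<open>\<open>u\<close> and \<open>w\<close> are the first and the last internal vertex; they
  coincide when there is only one.\<close>

lemma ear_path_cases:
  assumes i: "i \<in> I" and P: "(vs, es) \<in> ear_paths G {p i, q i}"
  obtains x y u w where "hd vs = x" "last vs = y" "x \<noteq> y" "x \<in> outer" "y \<in> outer"
      "{u, w} = {p i, q i}" "\<exists>e\<in>edges G. ends G e = {u, x}" "\<exists>e\<in>edges G. ends G e = {w, y}"
      "u \<noteq> w \<Longrightarrow> \<exists>e\<in>edges G. ends G e = {u, w}"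
proof -
  have pth: "length vs = Suc (length es)" "distinct vs" "set vs \<subseteq> verts G" "set es \<subseteq> edges G"
    "\<And>i. i < length es \<Longrightarrow> ends G (es ! i) = {vs ! i, vs ! Suc i}"
    and inner: "set (butlast (tl vs)) = {p i, q i}"
    using P by (auto simp: ear_paths_def path_def)
  obtain x ms y where vs: "vs = x # ms @ [y]" and ms: "set ms = {p i, q i}"
  proof (cases vs rule: list.exhaust)
    case (Cons x ws)
    then have "ws \<noteq> []" using inner by auto
    then show ?thesis using that[of x "butlast ws" "last ws"] Cons inner by auto
  qed (use inner in auto)
  have ms0: "ms \<noteq> []" using ms by auto
  let ?l = "length ms"
  have les: "length es = Suc ?l" using pth(1) vs by simp
  have e0: "es ! 0 \<in> edges G" "es ! ?l \<in> edges G" using pth(4) les by auto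
  have "ends G (es ! 0) = {x, hd ms}"
    using pth(5)[of 0] les vs ms0 by (cases ms) auto
  moreover have "ends G (es ! ?l) = {last ms, y}"
    using pth(5)[of ?l] les vs ms0 by (auto simp: nth_append last_conv_nth nth_Cons')
  ultimately have ex: "\<exists>e\<in>edges G. ends G e = {hd ms, x}" "\<exists>e\<in>edges G. ends G e = {last ms, y}"
    using e0 by (auto simp: insert_commute)
  have hl: "hd ms \<in> {p i, q i}" "last ms \<in> {p i, q i}"
    using hd_in_set[OF ms0] last_in_set[OF ms0] unfolding ms by blast+
  have xy: "x \<noteq> y" "x \<notin> {p i, q i}" "y \<notin> {p i, q i}" using pth(2) vs ms by auto
  then have out: "x \<in> outer" "y \<in> outer" using ex inner_edge[OF i _ _ hl(1), of _ x] inner_edge[OF i _ _ hl(2), of _ y] by auto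
  have "card (set ms) \<le> 2" using ms by (simp add: card_insert_if)
  moreover have "distinct ms" using pth(2) vs by auto
  ultimately have "length ms \<le> 2" by (simp add: distinct_card)
  then consider u where "ms = [u]" | u w where "ms = [u, w]"
    using ms0 by (cases ms; cases "tl ms"; cases "tl (tl ms)") auto
  then show ?thesis
  proof cases
    case 1
    then show ?thesis using that[of x y u u] ex xy out ms vs by auto
  next
    case 2
    have "es ! 1 \<in> edges G" "ends G (es ! 1) = {u, w}"
      using pth(4) pth(5)[of 1] les vs 2 by auto
    then show ?thesis using that[of x y u w] ex xy out ms vs 2 by auto
  qed
qed

lemma ear_pathI:
  assumes i: "i \<in> I" and x: "x \<in> outer" and y: "y \<in> outer" and xy: "x \<noteq> y"
    and e: "ea \<in> edges G" "ends G ea = {p i, x}" "eb \<in> edges G" "ends G eb = {q i, y}"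
    and m: "p i \<noteq> q i \<Longrightarrow> em \<in> edges G \<and> ends G em = {p i, q i}"
  shows "(if p i = q i then ([x, p i, y], [ea, eb]) else ([x, p i, q i, y], [ea, em, eb]))
    \<in> ear_paths G {p i, q i}"
proof -
  have "{p i, q i} \<subseteq> verts G" "x \<notin> {p i, q i}" "y \<notin> {p i, q i}" "outer \<subseteq> verts G"
    using eardrum_props(1)[OF multigraph eardrum in_M[OF i]] x y in_M[OF i] by (auto simp: outer_def)
  then show ?thesis
    using x y xy e m by (auto simp: ear_paths_def path_def less_Suc_eq nth_Cons' insert_commute)
qed

lemma middle_edge:
  assumes "i \<in> I" "p i \<noteq> q i"
  shows "\<exists>e\<in>edges G. ends G e = {p i, q i}"
proof -
  obtain vs es where P: "(vs, es) \<in> ear_paths G {p i, q i}"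
    using nonempty[OF in_M[OF assms(1)]] by auto
  show ?thesis
  proof (cases rule: ear_path_cases[OF assms(1) P])
    case (1 x y u w)
    then show ?thesis using assms(2) by (auto simp: doubleton_eq_iff insert_commute)
  qed
qed

lemma ear_path_of:
  assumes i: "i \<in> I" and "x \<in> A i" "y \<in> B i" "x \<noteq> y"
  shows "\<exists>P\<in>ear_paths G {p i, q i}. hd (fst P) = x \<and> last (fst P) = y"
proof -
  from assms obtain ea eb where e: "ea \<in> edges G" "ends G ea = {p i, x}" "eb \<in> edges G" "ends G eb = {q i, y}"
    and xy: "x \<in> outer" "y \<in> outer" by (auto simp: A_def B_def)
  obtain em where "p i \<noteq> q i \<Longrightarrow> em \<in> edges G \<and> ends G em = {p i, q i}"
    using middle_edge[OF i] by metis
  from ear_pathI[OF i xy assms(4) e this] show ?thesis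
    by (rule bexI[rotated]) auto
qed

text \<open>A path may be given by either of its traversals, hence the disjunction.\<close>

lemma ear_path_ends:
  assumes i: "i \<in> I" and P: "(vs, es) \<in> ear_paths G {p i, q i}"
  shows "hd vs \<in> A i \<and> last vs \<in> B i \<or> hd vs \<in> B i \<and> last vs \<in> A i" "hd vs \<noteq> last vs"
proof (atomize (full), cases rule: ear_path_cases[OF i P])
  case (1 x y u w)
  then show "(hd vs \<in> A i \<and> last vs \<in> B i \<or> hd vs \<in> B i \<and> last vs \<in> A i) \<and> hd vs \<noteq> last vs"
    unfolding A_def B_def by (auto simp: doubleton_eq_iff)
qed

lemma slots_witness:
  assumes "i \<in> I"
  shows "\<exists>x y. x \<in> A i \<and> y \<in> B i \<and> x \<noteq> y"
proof -
  obtain vs es where "(vs, es) \<in> ear_paths G {p i, q i}" using nonempty[OF in_M[OF assms]] by auto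
  from ear_path_ends[OF assms this] show ?thesis by metis
qed

lemma ear_ends_eq:
  assumes i: "i \<in> I"
  shows "ear_ends G {p i, q i} = U i"
proof
  show "ear_ends G {p i, q i} \<subseteq> U i"
    using ear_path_ends(1)[OF i] by (fastforce simp: ear_ends_def U_def)
  show "U i \<subseteq> ear_ends G {p i, q i}"
  proof
    fix v assume v: "v \<in> U i"
    obtain x y where xy: "x \<in> A i" "y \<in> B i" "x \<noteq> y" using slots_witness[OF i] by auto
    \<comment> \<open>If \<open>v\<close> equals the witness in the opposite slot, then the witness
      pair itself already has \<open>v\<close> as an end.\<close>
    obtain x' y' where x'y': "x' \<in> A i" "y' \<in> B i" "x' \<noteq> y'" "v = x' \<or> v = y'"
      using v xy unfolding U_def by (metis UnE)
    then show "v \<in> ear_ends G {p i, q i}"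
      using ear_path_of[OF i x'y'(1-3)] by (force simp: ear_ends_def)
  qed
qed

lemma U_outer: "U i \<subseteq> outer"
  by (auto simp: U_def A_def B_def)

lemma ear_path_nth:
  assumes i: "i \<in> I" and P: "(vs, es) \<in> ear_paths G {p i, q i}"
  shows "length vs = Suc (length es)" "2 \<le> length es" "distinct vs" "set es \<subseteq> edges G"
    "\<And>k. k < length es \<Longrightarrow> ends G (es ! k) = {vs ! k, vs ! Suc k}"
    "\<And>k. 0 < k \<Longrightarrow> k < length es \<Longrightarrow> vs ! k \<in> {p i, q i}"
    "vs ! 0 = hd vs" "vs ! length es = last vs" "hd vs \<in> outer" "last vs \<in> outer"
proof -
  show l: "length vs = Suc (length es)" and d: "distinct vs" and s: "set es \<subseteq> edges G"
    and e: "\<And>k. k < length es \<Longrightarrow> ends G (es ! k) = {vs ! k, vs ! Suc k}"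
    using P by (auto simp: ear_paths_def path_def)
  have inner: "set (butlast (tl vs)) = {p i, q i}" using P by (simp add: ear_paths_def)
  then have "butlast (tl vs) \<noteq> []" by auto
  then have "0 < length (butlast (tl vs))" by blast
  then show "2 \<le> length es" using l by simp
  show "vs ! k \<in> {p i, q i}" if "0 < k" "k < length es" for k
  proof -
    have "butlast (tl vs) ! (k - 1) \<in> set (butlast (tl vs))"
      using that l by (intro nth_mem) auto
    also have "butlast (tl vs) ! (k - 1) = vs ! k"
      using that l by (simp add: nth_butlast nth_tl)
    finally show ?thesis using inner by simp
  qed
  have "vs \<noteq> []" using l by auto
  then show "vs ! 0 = hd vs" "vs ! length es = last vs" using l by (simp_all add: hd_conv_nth last_conv_nth)
  show "hd vs \<in> outer" "last vs \<in> outer"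
    using ear_path_ends(1)[OF i P] by (auto simp: A_def B_def)
qed

lemma inner_not_outer: "i \<in> I \<Longrightarrow> u \<in> {p i, q i} \<Longrightarrow> u \<notin> outer"
  using in_M by (auto simp: outer_def)

text \<open>The union of the paths is a subdivision of the graph formed by the pairs of ends. One
  direction replaces each pair by its path, the other contracts each path back to its pair.\<close>

lemma acyc_ears:
  assumes J: "J \<subseteq> I" and P: "\<And>i. i \<in> J \<Longrightarrow> P i \<in> ear_paths G {p i, q i}"
    and st: "\<And>e. e \<in> edges G \<Longrightarrow> ends G e = {s e, t e}"
  shows "acyc s t (\<Union>i\<in>J. set (snd (P i))) \<longleftrightarrow>
    acyc (\<lambda>i. hd (fst (P i))) (\<lambda>i. last (fst (P i))) J"
proof -
  define vs es L x y E where "vs i = fst (P i)" and "es i = snd (P i)" and "L i = length (es i)"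
    and "x i = hd (vs i)" and "y i = last (vs i)" and "E = (\<Union>i\<in>J. set (es i))" for i
  have path: "i \<in> I" "length (vs i) = Suc (L i)" "2 \<le> L i" "distinct (vs i)" "set (es i) \<subseteq> edges G"
    "\<And>k. k < L i \<Longrightarrow> ends G (es i ! k) = {vs i ! k, vs i ! Suc k}"
    "\<And>k. 0 < k \<Longrightarrow> k < L i \<Longrightarrow> vs i ! k \<in> {p i, q i}"
    "vs i ! 0 = x i" "vs i ! L i = y i" "x i \<in> outer" "y i \<in> outer" if "i \<in> J" for i
  proof -
    have iI: "i \<in> I" using J that by auto
    have "(vs i, es i) \<in> ear_paths G {p i, q i}" using P[OF that] by (simp add: vs_def es_def)
    note * = ear_path_nth[OF iI this, folded L_def, folded x_def y_def]
    show "i \<in> I" by fact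
    show "length (vs i) = Suc (L i)" "2 \<le> L i" "distinct (vs i)" "set (es i) \<subseteq> edges G" by (fact *)+
    show "\<And>k. k < L i \<Longrightarrow> ends G (es i ! k) = {vs i ! k, vs i ! Suc k}" by (fact *)
    show "\<And>k. 0 < k \<Longrightarrow> k < L i \<Longrightarrow> vs i ! k \<in> {p i, q i}" by (fact *)
    show "vs i ! 0 = x i" "vs i ! L i = y i" "x i \<in> outer" "y i \<in> outer" by (fact *)+
  qed
  have vcase: "vs i ! k \<in> outer \<or> vs i ! k \<in> {p i, q i}" if "i \<in> J" "k \<le> L i" for i k
    using path(7)[OF that(1), of k] path(8-11)[OF that(1)] that(2)
    by (cases "k = 0"; cases "k = L i") auto
  have stv: "{s (es i ! k), t (es i ! k)} = {vs i ! k, vs i ! Suc k}" if "i \<in> J" "k < L i" for i k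
    using path(5,6)[OF that(1)] that(2) st nth_mem[of k "es i"] by (metis L_def subsetD)
  \<comment> \<open>A path with at least two edges has an internal vertex on every edge, and
    internal vertices determine their ear. So an edge determines the ear it belongs to.\<close>
  have idx: "i = j" if ij: "i \<in> J" "j \<in> J" "k < L i" "l < L j" "es i ! k = es j ! l" for i j k l
  proof -
    obtain m where m: "m = k \<or> m = Suc k" "0 < m" "m < L i"
      using ij(3) path(3)[OF ij(1)] by (cases "k = 0") force+
    have u: "vs i ! m \<in> {p i, q i}" using path(7)[OF ij(1) m(2,3)] .
    have "vs i ! m \<in> {vs j ! l, vs j ! Suc l}"
      using path(6)[OF ij(1,3)] path(6)[OF ij(2,4)] ij(5) m(1) by auto
    then have "\<exists>l'\<le>L j. vs i ! m = vs j ! l'"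
      using ij(4) by (metis Suc_leI insertE less_imp_le_nat singletonD)
    then obtain l' where l': "l' \<le> L j" "vs i ! m = vs j ! l'" by blast
    have "vs i ! m \<notin> outer" using u path(1)[OF ij(1)] by (rule inner_not_outer[rotated])
    then have "vs i ! m \<in> {p j, q j}" using vcase[OF ij(2) l'(1)] l'(2) by simp
    then show ?thesis using same_index[OF path(1)[OF ij(1)] path(1)[OF ij(2)] u] by simp
  qed
  have idx2: "k = l" if "i \<in> J" "k < L i" "l < L i" "es i ! k = es i ! l" for i k l
  proof -
    have "distinct (es i)"
      by (rule distinct_edges[of "vs i" _ "ends G"])
        (use path(2,4,6)[OF that(1)] in \<open>simp_all add: L_def\<close>)
    then show ?thesis using that by (simp add: nth_eq_iff_index_eq L_def)
  qed
  have mem: "es i ! k \<in> E" if "i \<in> J" "k < L i" for i k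
    using that nth_mem[of k "es i"] unfolding E_def L_def by blast
  have "acyc s t E \<longleftrightarrow> acyc x y J"
  proof
    assume ac: "acyc s t E"
    show "acyc x y J"
      unfolding acyc_def
    proof (intro ballI notI)
      fix i assume i: "i \<in> J" and lk: "(x i, y i) \<in> link x y (J - {i})"
      have Li: "0 < L i" using path(3)[OF i] by linarith
      \<comment> \<open>The first edge of ear \<open>i\<close> will close a cycle: the other ears
        lead from \<open>x i\<close> to \<open>y i\<close>, and the rest of ear \<open>i\<close>
        leads back from \<open>y i\<close> to \<open>vs i ! 1\<close>.\<close>
      let ?e = "es i ! 0"
      have *: "(vs j ! a, vs j ! L j) \<in> link s t (E - {?e})"
        if j: "j \<in> J" "a \<le> L j" "j = i \<Longrightarrow> 0 < a" for j a
      proof (rule seq_link)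
        fix k assume k: "a \<le> k" "k < L j"
        have "es j ! k \<noteq> ?e"
          using idx[OF j(1) i k(2) Li] idx2[OF i _ Li, of k] k j(3) by auto
        then show "\<exists>e\<in>E - {?e}. {s e, t e} = {vs j ! k, vs j ! Suc k}"
          using mem[OF j(1) k(2)] stv[OF j(1) k(2)] by blast
      qed (fact j(2))
      have "(id (x i), id (y i)) \<in> link s t (E - {?e})"
      proof (rule link_map[OF lk])
        fix j assume "j \<in> J - {i}"
        then show "(id (x j), id (y j)) \<in> link s t (E - {?e})"
          using *[of j 0] path(8,9)[of j] by auto
      qed
      moreover have "(vs i ! 1, y i) \<in> link s t (E - {?e})"
        using *[OF i, of 1] Li path(9)[OF i] by auto
      ultimately have "(x i, vs i ! 1) \<in> link s t (E - {?e})" by (auto intro: link_sym link_trans)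
      then have "(s ?e, t ?e) \<in> link s t (E - {?e})"
        using stv[OF i Li] path(8)[OF i] by (auto simp: doubleton_eq_iff intro: link_sym)
      with ac mem[OF i Li] show False by (auto simp: acyc_def)
    qed
  next
    assume ac: "acyc x y J"
    show "acyc s t E"
      unfolding acyc_def
    proof (intro ballI notI)
      fix e assume "e \<in> E" and lk: "(s e, t e) \<in> link s t (E - {e})"
      then obtain i k where ik: "i \<in> J" "k < L i" "e = es i ! k"
        by (auto simp: E_def L_def in_set_conv_nth)
      \<comment> \<open>Cut the ear \<open>i\<close> at \<open>e\<close> and contract all other internal vertices onto the first end of their ear.\<close>
      define \<phi> where "\<phi> v = (if v \<in> {p i, q i} then if \<exists>l\<le>k. vs i ! l = v then x i else y i
        else if \<exists>j\<in>J. v \<in> {p j, q j} then x (THE j. j \<in> J \<and> v \<in> {p j, q j}) else v)" for v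
      have out: "\<phi> v = v" if "v \<in> outer" for v
        using that inner_not_outer path(1) ik(1) unfolding \<phi>_def by meson
      have phi_i: "\<phi> (vs i ! l) = (if l \<le> k then x i else y i)" if "l \<le> L i" for l
      proof (cases "l = 0 \<or> l = L i")
        case True
        then show ?thesis using out path(8-11)[OF ik(1)] ik(2) by auto
      next
        case False
        then have "vs i ! l \<in> {p i, q i}" using path(7)[OF ik(1), of l] that by auto
        moreover have "(\<exists>l'\<le>k. vs i ! l' = vs i ! l) \<longleftrightarrow> l \<le> k"
          using path(2,4)[OF ik(1)] ik(2) that by (auto simp: nth_eq_iff_index_eq)
        ultimately show ?thesis by (simp add: \<phi>_def)
      qed
      have phi_j: "\<phi> (vs j ! l) = (if l < L j then x j else y j)" if "l \<le> L j" "j \<in> J" "j \<noteq> i" for j l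
      proof (cases "l = 0 \<or> l = L j")
        case True
        then show ?thesis using out path(3)[OF that(2)] path(8-11)[OF that(2)] by auto
      next
        case False
        then have v: "vs j ! l \<in> {p j, q j}" using path(7)[OF that(2), of l] that by auto
        have u: "j' = j" if "j' \<in> J" "vs j ! l \<in> {p j', q j'}" for j'
          using same_index[OF path(1)[OF that(1)] path(1)[OF \<open>j \<in> J\<close>] that(2) v] .
        have "(THE j'. j' \<in> J \<and> vs j ! l \<in> {p j', q j'}) = j"
          using u v that(2) by (intro the_equality) auto
        moreover have "vs j ! l \<notin> {p i, q i}" using u[OF ik(1)] that(3) by auto
        ultimately show ?thesis using v that False unfolding \<phi>_def by auto
      qed
      \<comment> \<open>Only \<open>e\<close> crosses the cut of ear \<open>i\<close>. Every other
        edge collapses to a point, except that the last edge of another ear becomes the pair of its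
        ends.\<close>
      have "(\<phi> (s e), \<phi> (t e)) \<in> link x y (J - {i})"
      proof (rule link_map[OF lk])
        fix e' assume "e' \<in> E - {e}"
        then obtain j l where jl: "j \<in> J" "l < L j" "e' = es j ! l" "e' \<noteq> e"
          by (auto simp: E_def L_def in_set_conv_nth)
        have "(\<phi> (vs j ! l), \<phi> (vs j ! Suc l)) \<in> link x y (J - {i})"
        proof (cases "j = i")
          case True
          then have "l \<noteq> k" using jl ik by auto
          then show ?thesis using phi_i[of l] phi_i[of "Suc l"] jl True by auto
        next
          case False
          then have "(x j, y j) \<in> link x y (J - {i})" using jl by (intro link_edge) auto
          then show ?thesis using phi_j[of l j] phi_j[of "Suc l" j] jl False by auto
        qed
        then show "(\<phi> (s e'), \<phi> (t e')) \<in> link x y (J - {i})"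
          using stv[OF jl(1,2)] jl(3) by (auto simp: doubleton_eq_iff intro: link_sym)
      qed
      then have "(x i, y i) \<in> link x y (J - {i})"
        using stv[OF ik(1,2)] ik phi_i[of k] phi_i[of "Suc k"]
        by (auto simp: doubleton_eq_iff intro: link_sym)
      with ac ik(1) show False by (auto simp: acyc_def)
    qed
  qed
  moreover have "x = (\<lambda>i. hd (fst (P i)))" "y = (\<lambda>i. last (fst (P i)))"
    by (simp_all add: fun_eq_iff x_def y_def vs_def)
  ultimately show ?thesis by (simp add: E_def es_def)
qed

section \<open>Weak duality, optimality of tight partitions, and the min-max formula\<close>

abbreviation ear :: "'i \<Rightarrow> 'v set" where "ear i \<equiv> {p i, q i}"

lemma inj_ear: "inj_on ear I"
  using bij by (auto simp: bij_betw_def)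

lemma earmuff_iff:
  assumes J: "J \<subseteq> I"
  shows "earmuff G M (ear ` J) P \<longleftrightarrow> (\<forall>i\<in>J. P (ear i) \<in> ear_paths G (ear i)) \<and>
    acyc (\<lambda>i. hd (fst (P (ear i)))) (\<lambda>i. last (fst (P (ear i)))) J"
proof (cases "\<forall>i\<in>J. P (ear i) \<in> ear_paths G (ear i)")
  case True
  obtain s t where st: "\<forall>e\<in>edges G. ends G e = {s e, t e} \<and> s e \<noteq> t e \<and> s e \<in> verts G \<and> t e \<in> verts G"
    using multigraph_ends[OF multigraph] by auto
  let ?E = "\<Union>i\<in>J. set (snd (P (ear i)))"
  have E: "?E \<subseteq> edges G"
    using True by (fastforce simp: ear_paths_def path_def)
  have "forest (G\<lparr>edges := ?E\<rparr>) \<longleftrightarrow> acyc s t ?E"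
    using forest_iff_acyc[of "G\<lparr>edges := ?E\<rparr>" s t] st E by (auto simp: subset_iff)
  moreover have "acyc s t ?E \<longleftrightarrow>
      acyc (\<lambda>i. hd (fst (P (ear i)))) (\<lambda>i. last (fst (P (ear i)))) J"
    using acyc_ears[OF J, of "\<lambda>i. P (ear i)" s t] True st by blast
  ultimately show ?thesis
    using True J in_M by (auto simp: earmuff_def)
qed (auto simp: earmuff_def)

lemma card_M: "card M = card I"
  using bij_betw_same_card[OF bij] by simp

lemma card_ears: "card {f \<in> M. ear_ends G f \<subseteq> W} = card {i \<in> I. U i \<subseteq> W}"
proof -
  have "{f \<in> M. ear_ends G f \<subseteq> W} = ear ` {i \<in> I. U i \<subseteq> W}"
    using bij ear_ends_eq by (auto simp: bij_betw_def)
  then show ?thesis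
    using inj_ear by (simp add: card_image inj_on_subset)
qed

lemma U_nonempty: "i \<in> I \<Longrightarrow> U i \<noteq> {}"
  using slots_witness by (auto simp: U_def)

text \<open>\<open>U i\<close> is nonempty, so at most one block contains it and nothing is counted
  twice.\<close>

lemma sum_blocks:
  assumes W: "partition_on outer \<W>" and J: "J \<subseteq> I"
  shows "(\<Sum>W\<in>\<W>. card {i \<in> J. U i \<subseteq> W}) = card {i \<in> J. \<exists>W\<in>\<W>. U i \<subseteq> W}"
proof -
  have fin: "finite \<W>" using finite_outer unfolding partition_onD1[OF W] by (rule finite_UnionD)
  have finJ: "finite J" using J finite_I by (rule finite_subset)
  have "{i \<in> J. \<exists>W\<in>\<W>. U i \<subseteq> W} = (\<Union>W\<in>\<W>. {i \<in> J. U i \<subseteq> W})" by auto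
  moreover have "card (\<Union>W\<in>\<W>. {i \<in> J. U i \<subseteq> W}) = (\<Sum>W\<in>\<W>. card {i \<in> J. U i \<subseteq> W})"
  proof (rule card_UN_disjoint[OF fin])
    show "\<forall>W\<in>\<W>. \<forall>W'\<in>\<W>. W \<noteq> W' \<longrightarrow> {i \<in> J. U i \<subseteq> W} \<inter> {i \<in> J. U i \<subseteq> W'} = {}"
    proof (intro ballI impI, rule ccontr)
      fix W W' assume WW: "W \<in> \<W>" "W' \<in> \<W>" "W \<noteq> W'"
        and "{i \<in> J. U i \<subseteq> W} \<inter> {i \<in> J. U i \<subseteq> W'} \<noteq> {}"
      then obtain i where i: "i \<in> J" "U i \<subseteq> W" "U i \<subseteq> W'" by auto
      have "W \<inter> W' = {}" using partition_onD2[OF W] WW by (auto simp: disjoint_def)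
      then show False using i U_nonempty[of i] J by auto
    qed
  qed (use finJ in auto)
  ultimately show ?thesis by simp
qed

text \<open>The dual value as a rank bound: an ear confined to no block counts once, and a block
  counts as many ears as a spanning tree of it has edges.\<close>

lemma value_eq:
  assumes W: "partition_on outer \<W>"
  shows "int (card M) - (\<Sum>W\<in>\<W>. sur G M W) =
    int (card {i \<in> I. \<not> (\<exists>W\<in>\<W>. U i \<subseteq> W)}) + (\<Sum>W\<in>\<W>. int (card W) - 1)"
proof -
  let ?N = "{i \<in> I. \<exists>W\<in>\<W>. U i \<subseteq> W}"
  have "(\<Sum>W\<in>\<W>. sur G M W) = int (\<Sum>W\<in>\<W>. card {i \<in> I. U i \<subseteq> W}) - (\<Sum>W\<in>\<W>. int (card W) - 1)"
    by (simp add: sur_def card_ears sum_subtractf)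
  also have "(\<Sum>W\<in>\<W>. card {i \<in> I. U i \<subseteq> W}) = card ?N"
    by (rule sum_blocks[OF W]) simp
  finally have "(\<Sum>W\<in>\<W>. sur G M W) = int (card ?N) - (\<Sum>W\<in>\<W>. int (card W) - 1)" .
  moreover have "card I = card ?N + card {i \<in> I. \<not> (\<exists>W\<in>\<W>. U i \<subseteq> W)}"
    using finite_I by (subst card_Un_disjoint[symmetric]) (auto intro: arg_cong[of _ _ card])
  ultimately show ?thesis using card_M by simp
qed

lemma card_split:
  assumes "partition_on outer \<W>" "J \<subseteq> I"
  shows "card J = card {i \<in> J. \<not> (\<exists>W\<in>\<W>. U i \<subseteq> W)} + (\<Sum>W\<in>\<W>. card {i \<in> J. U i \<subseteq> W})"
proof -
  have "finite J" using assms(2) finite_I by (rule finite_subset)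
  then show ?thesis unfolding sum_blocks[OF assms]
    by (subst card_Un_disjoint[symmetric]) (auto intro: arg_cong[of _ _ card])
qed

text \<open>The ears confined to a block form a forest on it, and the others are estimated by their
  number. Both estimates add up to the form in \<open>value_eq\<close>.\<close>

lemma weak_duality:
  assumes W: "partition_on outer \<W>" and F: "earmuff G M F P"
  shows "int (card F) \<le> int (card M) - (\<Sum>W\<in>\<W>. sur G M W)"
proof -
  define J where "J = {i \<in> I. ear i \<in> F}"
  have J: "J \<subseteq> I" by (auto simp: J_def)
  have FJ: "F = ear ` J"
    using F bij by (auto simp: J_def earmuff_def bij_betw_def)
  let ?x = "\<lambda>i. hd (fst (P (ear i)))" and ?y = "\<lambda>i. last (fst (P (ear i)))"
  have P: "\<forall>i\<in>J. P (ear i) \<in> ear_paths G (ear i)" and ac: "acyc ?x ?y J"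
    using F unfolding FJ earmuff_iff[OF J] by auto
  have finJ: "finite J" using J finite_I by (rule finite_subset)
  have "card {i \<in> J. U i \<subseteq> W} + 1 \<le> card W" if "W \<in> \<W>" for W
  proof -
    have W': "W \<subseteq> outer" "W \<noteq> {}"
      using that partition_onD1[OF W] partition_onD3[OF W] by auto
    have "card {i \<in> J. U i \<subseteq> W} < card W"
    proof (rule acyc_card)
      show "acyc ?x ?y {i \<in> J. U i \<subseteq> W}" by (rule acyc_mono[OF ac]) auto
      show "finite W" using W' finite_outer by (auto intro: finite_subset)
      fix i assume i: "i \<in> {i \<in> J. U i \<subseteq> W}"
      then have "(fst (P (ear i)), snd (P (ear i))) \<in> ear_paths G (ear i)" using P by auto
      from ear_path_ends(1)[OF _ this] i J show "?x i \<in> W \<and> ?y i \<in> W"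
        by (auto simp: U_def)
    qed (use finJ W' in auto)
    then show ?thesis by simp
  qed
  then have "(\<Sum>W\<in>\<W>. int (card {i \<in> J. U i \<subseteq> W})) \<le> (\<Sum>W\<in>\<W>. int (card W) - 1)"
    by (intro sum_mono) force
  moreover have "card {i \<in> J. \<not> (\<exists>W\<in>\<W>. U i \<subseteq> W)} \<le> card {i \<in> I. \<not> (\<exists>W\<in>\<W>. U i \<subseteq> W)}"
    using finite_I J by (intro card_mono) auto
  moreover have "card F = card J" unfolding FJ using inj_ear J by (simp add: card_image inj_on_subset)
  ultimately show ?thesis
    unfolding value_eq[OF W] using card_split[OF W J] by simp
qed

lemma U_card: "i \<in> I \<Longrightarrow> \<not> U i \<subseteq> {v}"
  using slots_witness[of i] by (auto simp: U_def)

lemma fits_finite: "J \<subseteq> I \<Longrightarrow> finite J"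
  using finite_I by (rule rev_finite_subset)

text \<open>Vertices outside \<open>outer\<close> would add to \<open>card W\<close> without
  admitting a further confined member, while the strict bound already holds for
  \<open>W \<inter> outer\<close>. The set \<open>U i\<close> makes this intersection
  nonempty.\<close>

lemma tight_outer:
  assumes J: "J \<subseteq> I" "fits x y J" and W: "tight J W" "i \<in> I" "U i \<subseteq> W"
  shows "W \<subseteq> outer"
proof -
  have eq: "{g \<in> J. U g \<subseteq> W \<inter> outer} = {g \<in> J. U g \<subseteq> W}" using U_outer by blast
  have ne: "W \<inter> outer \<noteq> {}" using W U_outer[of i] U_nonempty[of i] by auto
  have fin: "finite W" using W by (simp add: tight_def)
  have "card {g \<in> J. U g \<subseteq> W \<inter> outer} < card (W \<inter> outer)"
    by (rule fits_card[OF J(2)]) (use fits_finite[OF J(1)] ne fin in auto)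
  then have "card W \<le> card (W \<inter> outer)" using W(1) unfolding eq by (simp add: tight_def)
  then have "W \<inter> outer = W" using fin by (intro card_seteq) auto
  then show ?thesis by auto
qed

text \<open>Complementary slackness: each block is spanned by accepted ears, and every rejected ear
  is confined to a block, so both estimates of \<open>weak_duality\<close> become
  equalities.\<close>

lemma tight_partition:
  assumes J: "J \<subseteq> I" "fits x y J" and tights: "\<And>i. i \<in> I - J \<Longrightarrow> \<exists>W. tight J W \<and> U i \<subseteq> W"
  shows "\<exists>\<W>. partition_on outer \<W> \<and> int (card J) = int (card M) - (\<Sum>W\<in>\<W>. sur G M W)"
proof -
  define \<T> where "\<T> = {W. W \<subseteq> outer \<and> tight J W}"
  define \<W> where "\<W> = {W \<in> \<T>. \<forall>W'\<in>\<T>. W \<subseteq> W' \<longrightarrow> W = W'}"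
  have fin: "finite \<T>" using finite_outer by (auto simp: \<T>_def)
  have max: "\<exists>W'\<in>\<W>. W \<subseteq> W'" if "W \<in> \<T>" for W
  proof -
    obtain W' where "W' \<in> \<T>" "W \<subseteq> W'" "\<forall>W''\<in>\<T>. W' \<subseteq> W'' \<longrightarrow> W' = W''"
      using finite_has_maximal2[OF fin \<open>W \<in> \<T>\<close>] by auto
    then have "W' \<in> \<W>" unfolding \<W>_def by simp
    then show ?thesis using \<open>W \<subseteq> W'\<close> by auto
  qed
  have Wt: "W \<subseteq> outer" "tight J W" if "W \<in> \<W>" for W using that by (auto simp: \<W>_def \<T>_def)
  \<comment> \<open>No \<open>U i\<close> fits into one point, so singletons are tight. They
    guarantee that the maximal tight sets cover \<open>outer\<close>.\<close>
  have single: "{v} \<in> \<T>" if "v \<in> outer" for v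
  proof -
    have "{g \<in> J. U g \<subseteq> {v}} = {}" using U_card J by auto
    then have "card {g \<in> J. U g \<subseteq> {v}} = 0" by (simp only: card.empty)
    then show ?thesis using that by (simp add: \<T>_def tight_def)
  qed
  have P: "partition_on outer \<W>"
  proof (rule partition_onI)
    show "\<Union>\<W> = outer"
    proof
      show "\<Union>\<W> \<subseteq> outer" using Wt(1) by (rule Union_least)
      show "outer \<subseteq> \<Union>\<W>"
      proof
        fix v assume "v \<in> outer"
        from max[OF single[OF this]] show "v \<in> \<Union>\<W>" by auto
      qed
    qed
    show "disjnt W W'" if "W \<in> \<W>" "W' \<in> \<W>" "W \<noteq> W'" for W W'
    proof (rule ccontr)
      assume "\<not> disjnt W W'"
      then have "W \<inter> W' \<noteq> {}" by (simp add: disjnt_def)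
      then have "tight J (W \<union> W')"
        using tight_Un[OF J(2) fits_finite[OF J(1)] Wt(2)[OF that(1)] Wt(2)[OF that(2)]] by simp
      then have "W \<union> W' \<in> \<T>" using Wt(1)[OF that(1)] Wt(1)[OF that(2)] by (simp add: \<T>_def)
      then have "W = W \<union> W'" "W' = W \<union> W'" using that(1,2) unfolding \<W>_def by auto
      with that(3) show False by simp
    qed
    show "{} \<notin> \<W>" using Wt(2)[of "{}"] by (auto simp: tight_def)
  qed
  have "i \<in> J" if i: "i \<in> I" "\<not> (\<exists>W\<in>\<W>. U i \<subseteq> W)" for i
  proof (rule ccontr)
    assume "i \<notin> J"
    then obtain W where W: "tight J W" "U i \<subseteq> W" using tights i by blast
    then have "W \<in> \<T>" using tight_outer[OF J W(1) i(1) W(2)] by (simp add: \<T>_def)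
    with max W(2) i(2) show False by blast
  qed
  then have "{i \<in> I. \<not> (\<exists>W\<in>\<W>. U i \<subseteq> W)} = {i \<in> J. \<not> (\<exists>W\<in>\<W>. U i \<subseteq> W)}" using J by auto
  moreover have "(\<Sum>W\<in>\<W>. int (card W) - 1) = (\<Sum>W\<in>\<W>. int (card {i \<in> J. U i \<subseteq> W}))"
    by (intro sum.cong) (use Wt(2) in \<open>auto simp: tight_def\<close>)
  ultimately have "int (card J) = int (card M) - (\<Sum>W\<in>\<W>. sur G M W)"
    unfolding value_eq[OF P] using card_split[OF P J(1)] by simp
  with P show ?thesis by blast
qed

lemma earmuff_card_le: "earmuff G M F P \<Longrightarrow> card F \<le> card M"
  using bij_betw_finite[OF bij] finite_I by (auto simp: earmuff_def intro: card_mono)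

text \<open>A tight set for every rejected index certifies optimality, however the family arose, so
  the result serves the abstract construction and the final state of the program alike. The paths
  are indexed by elements of \<open>M\<close> in \<open>earmuff\<close>, hence the inverse of
  \<open>ear\<close>.\<close>

lemma mu_eq:
  assumes J: "J \<subseteq> I" "fits x y J" and tights: "\<And>i. i \<in> I - J \<Longrightarrow> \<exists>W. tight J W \<and> U i \<subseteq> W"
  shows "mu G M = card J"
    "int (card J) = Min {int (card M) - (\<Sum>W\<in>\<W>. sur G M W) | \<W>. partition_on outer \<W>}"
    "\<And>P. (\<And>i. i \<in> J \<Longrightarrow> P i \<in> ear_paths G (ear i) \<and> hd (fst (P i)) = x i \<and> last (fst (P i)) = y i) \<Longrightarrow>
      earmuff G M (ear ` J) (P \<circ> the_inv_into I ear)"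
proof -
  show E: "earmuff G M (ear ` J) (P \<circ> the_inv_into I ear)"
    if "\<And>i. i \<in> J \<Longrightarrow> P i \<in> ear_paths G (ear i) \<and> hd (fst (P i)) = x i \<and> last (fst (P i)) = y i" for P
  proof -
    have inv: "the_inv_into I ear (ear i) = i" if "i \<in> J" for i
      using the_inv_into_f_f[OF inj_ear] J(1) that by auto
    have "acyc (\<lambda>i. hd (fst ((P \<circ> the_inv_into I ear) (ear i))))
        (\<lambda>i. last (fst ((P \<circ> the_inv_into I ear) (ear i)))) J = acyc x y J"
      by (rule acyc_cong) (use that inv in auto)
    then show ?thesis unfolding earmuff_iff[OF J(1)] using J(2) that inv by (auto simp: fits_def)
  qed
  have cardJ: "card (ear ` J) = card J" using inj_ear J by (simp add: card_image inj_on_subset)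
  have "\<exists>P\<in>ear_paths G (ear i). hd (fst P) = x i \<and> last (fst P) = y i" if i: "i \<in> J" for i
  proof (rule ear_path_of)
    show "x i \<noteq> y i" using J(2) i by (auto simp: fits_def acyc_def)
  qed (use J i in \<open>auto simp: fits_def\<close>)
  then obtain P where "\<And>i. i \<in> J \<Longrightarrow>
      P i \<in> ear_paths G (ear i) \<and> hd (fst (P i)) = x i \<and> last (fst (P i)) = y i" by metis
  from E[OF this] have muff: "earmuff G M (ear ` J) (P \<circ> the_inv_into I ear)" .
  obtain \<W> where W: "partition_on outer \<W>" "int (card J) = int (card M) - (\<Sum>W\<in>\<W>. sur G M W)"
    using tight_partition[OF assms] by auto
  show "mu G M = card J"
    unfolding mu_def
  proof (rule Max_eqI)
    show "finite {card F | F P. earmuff G M F P}"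
      using earmuff_card_le by (auto intro: finite_subset[of _ "{..card M}"])
    show "card J \<in> {card F | F P. earmuff G M F P}" using muff cardJ[symmetric] by auto
    show "n \<le> card J" if "n \<in> {card F | F P. earmuff G M F P}" for n
      using that weak_duality[OF W(1)] W(2)[symmetric] by auto
  qed
  show "int (card J) = Min {int (card M) - (\<Sum>W\<in>\<W>. sur G M W) | \<W>. partition_on outer \<W>}"
  proof (rule Min_eqI[symmetric])
    show "finite {int (card M) - (\<Sum>W\<in>\<W>. sur G M W) | \<W>. partition_on outer \<W>}"
      using finitely_many_partition_on[OF finite_outer] by simp
    show "int (card J) \<le> z" if "z \<in> {int (card M) - (\<Sum>W\<in>\<W>. sur G M W) | \<W>. partition_on outer \<W>}" for z
      using that weak_duality[OF _ muff] cardJ by auto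
  qed (use W in auto)
qed

lemma greedy:
  assumes "J0 \<subseteq> I"
  shows "\<exists>J x y. J \<subseteq> J0 \<and> fits x y J \<and> (\<forall>i\<in>J0 - J. \<exists>W. tight J W \<and> U i \<subseteq> W)"
proof -
  have "finite J0" using assms by (rule fits_finite)
  then show ?thesis using assms
  proof (induction J0 rule: finite_induct)
    case empty
    then show ?case by (auto simp: fits_def acyc_def)
  next
    case (insert i J0)
    then obtain J x y where J: "J \<subseteq> J0" "fits x y J" "\<forall>i\<in>J0 - J. \<exists>W. tight J W \<and> U i \<subseteq> W"
      by auto
    have fin: "finite J" using J insert.hyps by (auto intro: finite_subset)
    have "A i \<noteq> {}" "B i \<noteq> {}" "i \<notin> J" using slots_witness[of i] insert J by auto
    from fits_or_tight[OF J(2) fin this(3,1,2)] show ?case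
    proof
      assume "\<exists>x y. fits x y (insert i J)"
      then obtain x' y' where f: "fits x' y' (insert i J)" by auto
      have "\<exists>W. tight (insert i J) W \<and> U j \<subseteq> W" if "j \<in> insert i J0 - insert i J" for j
        using that J(3) tight_mono[OF _ f] fin by blast
      then show ?thesis using f J(1) by (intro exI[of _ "insert i J"]) blast
    next
      assume "\<exists>W. tight J W \<and> U i \<subseteq> W"
      then show ?thesis using J by (intro exI[of _ J]) blast
    qed
  qed
qed

lemma min_max:
  "int (mu G M) = Min {int (card M) - (\<Sum>W\<in>\<W>. sur G M W) | \<W>. partition_on outer \<W>}"
proof -
  obtain J x y where "J \<subseteq> I" "fits x y J" "\<And>i. i \<in> I - J \<Longrightarrow> \<exists>W. tight J W \<and> U i \<subseteq> W"
    using greedy[of I] by blast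
  from mu_eq(1,2)[OF this] show ?thesis by simp
qed

end

theorem mu_min_max:
  assumes "multigraph G" "eardrum G M" "\<forall>f\<in>M. ear_paths G f \<noteq> {}"
  shows "int (mu G M) =
    Min {int (card M) - (\<Sum>W\<in>\<W>. sur G M W) | \<W>. partition_on (verts G - \<Union>M) \<W>}"
proof -
  \<comment> \<open>\<open>M\<close> indexes itself here, so the formula holds for graphs with
    arbitrary vertex and edge types.\<close>
  obtain p q where "\<And>f. f \<in> M \<Longrightarrow> f = {p f, q f}"
    using eardrum_props(2)[OF assms(1,2)] by metis
  then have "bij_betw (\<lambda>f. {p f, q f}) M M"
    using bij_betw_cong[of M id "\<lambda>f. {p f, q f}" M] by auto
  then interpret ear_system G M M p q
    using assms by unfold_locales auto
  show ?thesis using min_max unfolding outer_def .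
qed

section \<open>Weakest preconditions\<close>

text \<open>\<open>wr c\<close> and \<open>wa c\<close> are the registers and the arrays that \<open>c\<close> may write.\<close>

fun wr :: "com \<Rightarrow> string set" where
  "wr Skip = {}"
| "wr (Set_Reg x a) = {x}"
| "wr (Set_Arr x i a) = {}"
| "wr (Seq c d) = wr c \<union> wr d"
| "wr (If b c d) = wr c \<union> wr d"
| "wr (While b c) = wr c"

fun wa :: "com \<Rightarrow> string set" where
  "wa Skip = {}"
| "wa (Set_Reg x a) = {}"
| "wa (Set_Arr x i a) = {x}"
| "wa (Seq c d) = wa c \<union> wa d"
| "wa (If b c d) = wa c \<union> wa d"
| "wa (While b c) = wa c"

text \<open>A frame condition decided by syntax alone. It is supplied by the rules below, so a
  postcondition has to list only what is written.\<close>

definition agree :: "com \<Rightarrow> ram_state \<Rightarrow> ram_state \<Rightarrow> bool" where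
  "agree c s s' \<longleftrightarrow> (\<forall>x. x \<notin> wr c \<longrightarrow> reg s' x = reg s x) \<and> (\<forall>x. x \<notin> wa c \<longrightarrow> arr s' x = arr s x)"

lemma agree_reg: "agree c s s' \<Longrightarrow> x \<notin> wr c \<Longrightarrow> reg s' x = reg s x"
  and agree_arr: "agree c s s' \<Longrightarrow> x \<notin> wa c \<Longrightarrow> arr s' x = arr s x"
  by (auto simp: agree_def)

lemma agree_refl: "agree c s s"
  by (simp add: agree_def)

lemma agree_trans: "agree c s s' \<Longrightarrow> agree c s' s'' \<Longrightarrow> agree c s s''"
  by (simp add: agree_def)

lemma exec_agree: "exec B c s t s' \<Longrightarrow> agree c s s'"
  by (induction rule: exec.induct) (auto simp: agree_def)

text \<open>Asserts that an execution exists and meets \<open>Q\<close>, which is the form of the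
  final claim. Time is an argument of \<open>Q\<close>, so costs are computed along with the
  state.\<close>

definition wp :: "nat \<Rightarrow> com \<Rightarrow> (nat \<Rightarrow> ram_state \<Rightarrow> bool) \<Rightarrow> ram_state \<Rightarrow> bool" where
  "wp B c Q s \<longleftrightarrow> (\<exists>t s'. exec B c s t s' \<and> Q t s')"

lemma wp_Skip [simp]: "wp B Skip Q s \<longleftrightarrow> Q 1 s"
  using exec_Skip[of B s] by (auto simp: wp_def elim: exec.cases)

lemma wp_Set_Reg [simp]:
  "wp B (Set_Reg x a) Q s \<longleftrightarrow>
    aval a s \<le> B \<and> Q (1 + acost a) (s\<lparr>reg := (reg s)(x := aval a s)\<rparr>)"
  using exec_Set_Reg[of a s B x] by (auto simp: wp_def elim: exec.cases)

lemma wp_Set_Arr [simp]: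
  "wp B (Set_Arr x i a) Q s \<longleftrightarrow> aval a s \<le> B \<and>
    Q (1 + acost i + acost a) (s\<lparr>arr := (arr s)(x := (arr s x)(aval i s := aval a s))\<rparr>)"
  using exec_Set_Arr[of a s B x i] by (auto simp: wp_def elim: exec.cases)

lemma wp_Seq [simp]:
  "wp B (Seq c d) Q s \<longleftrightarrow> wp B c (\<lambda>t. wp B d (\<lambda>u. Q (t + u))) s"
proof
  assume "wp B (Seq c d) Q s"
  then obtain t s' where "exec B (Seq c d) s t s'" "Q t s'" by (auto simp: wp_def)
  then show "wp B c (\<lambda>t. wp B d (\<lambda>u. Q (t + u))) s"
    unfolding wp_def by (cases rule: exec.cases) auto
qed (auto simp: wp_def intro: exec.intros)

lemma wp_If [simp]:
  "wp B (If b c d) Q s \<longleftrightarrow>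
    (bval b s \<longrightarrow> wp B c (\<lambda>t. Q (1 + bcost b + t)) s) \<and>
    (\<not> bval b s \<longrightarrow> wp B d (\<lambda>t. Q (1 + bcost b + t)) s)"
proof
  assume "wp B (If b c d) Q s"
  then obtain t s' where "exec B (If b c d) s t s'" "Q t s'" by (auto simp: wp_def)
  then show "(bval b s \<longrightarrow> wp B c (\<lambda>t. Q (1 + bcost b + t)) s) \<and>
    (\<not> bval b s \<longrightarrow> wp B d (\<lambda>t. Q (1 + bcost b + t)) s)"
    unfolding wp_def by (cases rule: exec.cases) auto
next
  assume "(bval b s \<longrightarrow> wp B c (\<lambda>t. Q (1 + bcost b + t)) s) \<and>
    (\<not> bval b s \<longrightarrow> wp B d (\<lambda>t. Q (1 + bcost b + t)) s)"
  then show "wp B (If b c d) Q s"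
    using exec_If_True[of b s B c _ _ d] exec_If_False[of b s B d _ _ c]
    unfolding wp_def by (cases "bval b s") fastforce+
qed

lemma wp_conseq:
  assumes "wp B c P s" "\<And>t s'. agree c s s' \<Longrightarrow> P t s' \<Longrightarrow> Q t s'"
  shows "wp B c Q s"
  using assms exec_agree unfolding wp_def by blast

text \<open>The potential \<open>\<phi>\<close> gives termination and time at once: every iteration
  pays for itself and its test by a drop of \<open>\<phi>\<close>, and the failing test adds
  \<open>bcost b + 1\<close>.\<close>

lemma wp_While:
  assumes init: "Inv s0"
    and step: "\<And>s. Inv s \<Longrightarrow> agree c s0 s \<Longrightarrow> bval b s \<Longrightarrow>
      wp B c (\<lambda>t s'. Inv s' \<and> t + bcost b + 1 + \<phi> s' \<le> \<phi> s) s"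
    and final: "\<And>T s. Inv s \<Longrightarrow> agree c s0 s \<Longrightarrow> \<not> bval b s \<Longrightarrow>
      T + \<phi> s \<le> \<phi> s0 + bcost b + 1 \<Longrightarrow> Q T s"
  shows "wp B (While b c) Q s0"
proof -
  have "\<exists>T s'. exec B (While b c) s T s' \<and> Inv s' \<and> agree c s0 s' \<and> \<not> bval b s' \<and>
      T + \<phi> s' \<le> \<phi> s + bcost b + 1" if "Inv s" "agree c s0 s" for s
    using that
  proof (induction "\<phi> s" arbitrary: s rule: less_induct)
    case less
    show ?case
    proof (cases "bval b s")
      case True
      from step[OF less.prems True] obtain t s' where e: "exec B c s t s'" "Inv s'"
        "t + bcost b + 1 + \<phi> s' \<le> \<phi> s" by (auto simp: wp_def)
      have "agree c s0 s'" using less.prems(2) exec_agree[OF e(1)] by (rule agree_trans)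
      then obtain T s'' where "exec B (While b c) s' T s''" "Inv s''" "agree c s0 s''" "\<not> bval b s''"
        "T + \<phi> s'' \<le> \<phi> s' + bcost b + 1"
        using less.hyps[of s'] e by auto
      then show ?thesis
        using exec_While_True[OF True e(1)] e(3)
        by (intro exI[of _ "1 + bcost b + t + T"] exI[of _ s'']) auto
    next
      case False
      then show ?thesis
        using less.prems exec_While_False[OF False]
        by (intro exI[of _ "1 + bcost b"] exI[of _ s]) auto
    qed
  qed
  from this[OF init agree_refl] final show ?thesis by (auto simp: wp_def)
qed

declare agree_reg [simp] agree_arr [simp]

notation Seq (infixr ";;" 60)

abbreviation Eq where "Eq x y \<equiv> And (Not (Less x y)) (Not (Less y x))"
abbreviation Or where "Or x y \<equiv> Not (And (Not x) (Not y))"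
abbreviation incr where "incr x \<equiv> Set_Reg x (Plus (Reg x) (N 1))"

lemma bval_Eq: "bval (Eq x y) s \<longleftrightarrow> aval x s = aval y s"
  by auto

section \<open>Adjacency lists\<close>

text \<open>Edge \<open>e\<close> yields the darts \<open>2 * e + 1\<close> and \<open>2 * e + 2\<close>, since \<open>0\<close> ends a linked list; \<open>own\<close> stores \<open>i + 1\<close> at the vertices
  of the \<open>i\<close>-th element of \<open>M\<close>, and \<open>0\<close> elsewhere.\<close>

definition own_prog :: com where
  "own_prog = While (Less (Reg ''i'') (Reg ''k''))
     (Set_Arr ''own'' (Arr ''p'' (Reg ''i'')) (Plus (Reg ''i'') (N 1));;
      Set_Arr ''own'' (Arr ''q'' (Reg ''i'')) (Plus (Reg ''i'') (N 1));;
      incr ''i'')"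

definition adj_prog :: com where
  "adj_prog = Set_Reg ''d'' (N 1);;
   While (Less (Reg ''e'') (Reg ''m''))
     (Set_Arr ''de'' (Reg ''d'') (Reg ''e'');;
      Set_Arr ''do'' (Reg ''d'') (Arr ''b'' (Reg ''e''));;
      Set_Arr ''nx'' (Reg ''d'') (Arr ''hd'' (Arr ''a'' (Reg ''e'')));;
      Set_Arr ''hd'' (Arr ''a'' (Reg ''e'')) (Reg ''d'');;
      incr ''d'';;
      Set_Arr ''de'' (Reg ''d'') (Reg ''e'');;
      Set_Arr ''do'' (Reg ''d'') (Arr ''a'' (Reg ''e''));;
      Set_Arr ''nx'' (Reg ''d'') (Arr ''hd'' (Arr ''b'' (Reg ''e'')));;
      Set_Arr ''hd'' (Arr ''b'' (Reg ''e'')) (Reg ''d'');;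
      incr ''d'';;
      incr ''e'')"

definition clear_prog :: com where
  "clear_prog = Set_Reg ''i'' (N 0);;
   While (Less (Reg ''i'') (Reg ''n''))
     (Set_Arr ''vis'' (Reg ''i'') (N 0);; Set_Arr ''ins'' (Reg ''i'') (N 0);; incr ''i'')"

fun chain :: "(nat \<Rightarrow> nat) \<Rightarrow> nat \<Rightarrow> nat list \<Rightarrow> bool" where
  "chain nx d [] \<longleftrightarrow> d = 0"
| "chain nx d (d' # ds) \<longleftrightarrow> d = d' \<and> d \<noteq> 0 \<and> chain nx (nx d) ds"

lemma chain_cong: "(\<And>d. d \<in> set ds \<Longrightarrow> nx d = nx' d) \<Longrightarrow> chain nx d ds = chain nx' d ds"
  by (induction ds arbitrary: d) auto

lemma chain_cases: "chain nx d ds \<Longrightarrow> 0 < d \<Longrightarrow> \<exists>ds'. ds = d # ds' \<and> chain nx (nx d) ds'"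
  by (cases ds) auto

text \<open>\<open>Bd\<close> has to cover vertices, edges, queue positions and darts; the dart
  counter ends at \<open>2 * m + 1\<close>.\<close>

locale ear_ram = ear_system G M "{..<k}" p q
  for G :: "(nat, nat) mgraph" and M and k :: nat and p q :: "nat \<Rightarrow> nat" +
  fixes n m :: nat and a b :: "nat \<Rightarrow> nat" and Bd :: nat
  assumes verts: "verts G = {..<n}" and edges: "edges G = {..<m}"
    and ends: "e < m \<Longrightarrow> ends G e = {a e, b e}"
    and Bd: "n + 2 * m + 2 \<le> Bd"
begin

lemma ends_less: "e < m \<Longrightarrow> a e < n \<and> b e < n \<and> a e \<noteq> b e"
  using multigraph ends[of e] verts edges by (auto simp: multigraph_def dest!: bspec[of _ _ e])

lemma pq_less: "i < k \<Longrightarrow> p i < n \<and> q i < n"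
  using eardrum_props(1)[OF multigraph eardrum in_M, of i] verts by auto

lemma outer_less: "v \<in> outer \<Longrightarrow> v < n"
  by (auto simp: outer_def verts)

lemma k_le_n: "k \<le> n"
proof -
  have "inj_on p {..<k}" using same_index by (auto simp: inj_on_def)
  moreover have "p ` {..<k} \<subseteq> {..<n}" using pq_less by auto
  ultimately show ?thesis using card_inj_on_le[of p "{..<k}" "{..<n}"] by simp
qed

text \<open>Choose for each element of \<open>M\<close> an edge that leaves it. An edge chosen twice
  would join two elements of \<open>M\<close>, and there is no such edge.\<close>

lemma k_le_m: "k \<le> m"
proof -
  have "\<exists>e<m. ends G e \<inter> {p i, q i} \<noteq> {} \<and> \<not> ends G e \<subseteq> {p i, q i}" if i: "i < k" for i
  proof -
    obtain v where "v \<in> A i" using slots_witness[of i] i by auto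
    moreover from this have "v \<notin> {p i, q i}"
      using inner_not_outer[of i v] i by (auto simp: A_def)
    ultimately show ?thesis using edges by (auto simp: A_def)
  qed
  then obtain f where f: "\<And>i. i < k \<Longrightarrow> f i < m \<and> ends G (f i) \<inter> {p i, q i} \<noteq> {} \<and> \<not> ends G (f i) \<subseteq> {p i, q i}"
    by metis
  have "inj_on f {..<k}"
  proof (rule inj_onI)
    fix i j assume ij: "i \<in> {..<k}" "j \<in> {..<k}" "f i = f j"
    from f[of i] ij obtain u where u: "u \<in> ends G (f i)" "u \<in> {p i, q i}" by auto
    from f[of j] ij obtain w where w: "w \<in> ends G (f j)" "w \<in> {p j, q j}" by auto
    have fm: "f i < m" using f ij by auto
    show "i = j"
    proof (cases "u = w")
      case True
      then show ?thesis using same_index[OF ij(1,2) u(2)] w(2) by simp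
    next
      case False
      then have "ends G (f i) = {u, w}" using u w ij(3) ends[OF fm] by auto
      from inner_edge[OF ij(1) _ this u(2)] fm edges inner_not_outer[OF ij(2) w(2)]
      have "{p i, q i} = {u, w}" by auto
      then show ?thesis using f[of i] ij(1) \<open>ends G (f i) = {u, w}\<close> by auto
    qed
  qed
  then show ?thesis using f card_inj_on_le[of f "{..<k}" "{..<m}"] by auto
qed

lemma outer_cases: "v < n \<Longrightarrow> v \<in> outer \<or> (\<exists>i<k. v = p i \<or> v = q i)"
  using bij by (auto simp: outer_def verts bij_betw_def)

definition edge_of :: "nat \<Rightarrow> nat" where "edge_of d = (d - 1) div 2"

definition src :: "nat \<Rightarrow> nat" where
  "src d = (if odd d then a (edge_of d) else b (edge_of d))"

definition dst :: "nat \<Rightarrow> nat" where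
  "dst d = (if odd d then b (edge_of d) else a (edge_of d))"

text \<open>The list of \<open>v\<close> after the darts below \<open>l\<close> have been entered.
  Insertion at the head reverses their order.\<close>

definition darts :: "nat \<Rightarrow> nat \<Rightarrow> nat list" where
  "darts l v = rev (filter (\<lambda>d. src d = v) [1..<l])"

definition adj :: "nat \<Rightarrow> nat list" where "adj = darts (2 * m + 1)"

definition params :: "ram_state \<Rightarrow> bool" where
  "params s \<longleftrightarrow> reg s ''n'' = n \<and> reg s ''m'' = m \<and> reg s ''k'' = k \<and>
     arr s ''a'' = a \<and> arr s ''b'' = b \<and> arr s ''p'' = p \<and> arr s ''q'' = q"

definition own_ok :: "ram_state \<Rightarrow> bool" where
  "own_ok s \<longleftrightarrow> (\<forall>i<k. arr s ''own'' (p i) = Suc i \<and> arr s ''own'' (q i) = Suc i) \<and>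
     (\<forall>v\<in>outer. arr s ''own'' v = 0)"

definition adj_ok :: "ram_state \<Rightarrow> bool" where
  "adj_ok s \<longleftrightarrow> (\<forall>v. chain (arr s ''nx'') (arr s ''hd'' v) (adj v)) \<and>
     (\<forall>d\<in>{1..2 * m}. arr s ''de'' d = edge_of d \<and> arr s ''do'' d = dst d)"

definition env :: "ram_state \<Rightarrow> bool" where
  "env s \<longleftrightarrow> params s \<and> own_ok s \<and> adj_ok s"

lemma params_agree:
  "agree c s s' \<Longrightarrow> {''n'', ''m'', ''k''} \<inter> wr c = {} \<Longrightarrow> {''a'', ''b'', ''p'', ''q''} \<inter> wa c = {} \<Longrightarrow>
    params s \<Longrightarrow> params s'"
  by (simp add: params_def)

lemma env_agree:
  "agree c s s' \<Longrightarrow> {''n'', ''m'', ''k''} \<inter> wr c = {} \<Longrightarrow>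
    {''a'', ''b'', ''p'', ''q'', ''own'', ''hd'', ''nx'', ''de'', ''do''} \<inter> wa c = {} \<Longrightarrow> env s \<Longrightarrow> env s'"
  by (simp add: env_def params_def own_ok_def adj_ok_def)

lemma own_correct:
  assumes "params s" "reg s ''i'' = 0" "\<forall>v. arr s ''own'' v = 0"
  shows "wp Bd own_prog (\<lambda>t s'. t \<le> 30 * k + 10 \<and> own_ok s') s"
proof -
  let ?I = "\<lambda>s. reg s ''i'' \<le> k \<and>
    (\<forall>i<reg s ''i''. arr s ''own'' (p i) = Suc i \<and> arr s ''own'' (q i) = Suc i) \<and>
    (\<forall>v\<in>outer. arr s ''own'' v = 0)"
  show ?thesis
    unfolding own_prog_def
  proof (rule wp_While[where Inv = ?I and \<phi> = "\<lambda>s. 30 * (k - reg s ''i'')"], goal_cases)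
    case 1
    show ?case using assms by simp
  next
    case (2 s')
    then have ps: "params s'" using assms(1) by (auto intro: params_agree)
    define i where "i = reg s' ''i''"
    have i: "i < k" using 2 ps by (simp add: i_def params_def)
    \<comment> \<open>Elements of \<open>M\<close> are disjoint, so no later round overwrites an
      earlier mark.\<close>
    have ne: "p l \<noteq> p i \<and> p l \<noteq> q i \<and> q l \<noteq> p i \<and> q l \<noteq> q i" if "l < i" for l
      using same_index[of l i "p l"] same_index[of l i "q l"] that i by auto
    have no: "p i \<notin> outer" "q i \<notin> outer" using inner_not_outer[of i] i by auto
    show ?case
      using 2 ps i ne no k_le_n Bd by (auto simp: params_def i_def[symmetric] less_Suc_eq)
  next
    case (3 T s')
    then show ?case using assms by (auto simp: params_def own_ok_def)
  qed
qed

lemma clear_correct: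
  assumes "params s"
  shows "wp Bd clear_prog (\<lambda>t s'. t \<le> 30 * n + 10 \<and> (\<forall>v<n. arr s' ''vis'' v = 0 \<and> arr s' ''ins'' v = 0)) s"
  unfolding clear_prog_def
  apply simp
  apply (rule wp_While[where Inv = "\<lambda>s. reg s ''i'' \<le> n \<and> (\<forall>v<reg s ''i''. arr s ''vis'' v = 0 \<and> arr s ''ins'' v = 0)"
      and \<phi> = "\<lambda>s. 20 * (n - reg s ''i'')"])
  using assms Bd by (auto simp: params_def less_Suc_eq)

end

text \<open>The remaining length of a linked list as a function of the state, made to serve as a
  potential. The choice is unambiguous wherever a list exists.\<close>

definition clen :: "(nat \<Rightarrow> nat) \<Rightarrow> nat \<Rightarrow> nat" where
  "clen nx d = length (SOME ds. chain nx d ds)"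

lemma chain_unique: "chain nx d ds \<Longrightarrow> chain nx d ds' \<Longrightarrow> ds = ds'"
proof (induction ds arbitrary: d ds')
  case Nil
  then show ?case by (cases ds') auto
next
  case (Cons a ds)
  then show ?case by (cases ds') auto
qed

lemma clen_eq: "chain nx d ds \<Longrightarrow> clen nx d = length ds"
  unfolding clen_def using chain_unique by (metis someI)

lemma chain_zero: "chain nx 0 ds \<longleftrightarrow> ds = []"
  by (cases ds) auto

lemma chain_bound: "chain nx d ds \<Longrightarrow> set ds \<subseteq> {..l} \<Longrightarrow> d \<le> l"
  by (cases ds) auto

text \<open>The last outer neighbour in the list wins. A neighbour with an owner can only be
  \<open>q j\<close>, so its edge is the middle edge of the ear.\<close>

definition first_prog :: com where
  "first_prog = Set_Reg ''d'' (Arr ''hd'' (Arr ''p'' (Reg ''j'')));;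
   While (Less (N 0) (Reg ''d''))
     (If (Less (Arr ''own'' (Arr ''do'' (Reg ''d''))) (N 1))
        (Set_Arr ''x'' (Reg ''j'') (Arr ''do'' (Reg ''d''));;
         Set_Arr ''ea'' (Reg ''j'') (Arr ''de'' (Reg ''d'')))
        (Set_Arr ''em'' (Reg ''j'') (Arr ''de'' (Reg ''d'')));;
      Set_Reg ''d'' (Arr ''nx'' (Reg ''d'')))"

definition second_prog :: com where
  "second_prog = Set_Reg ''d'' (Arr ''hd'' (Arr ''q'' (Reg ''j'')));;
   While (Less (N 0) (Reg ''d''))
     (If (Less (Arr ''own'' (Arr ''do'' (Reg ''d''))) (N 1))
        (Set_Arr ''y'' (Reg ''j'') (Arr ''do'' (Reg ''d''));;
         Set_Arr ''eb'' (Reg ''j'') (Arr ''de'' (Reg ''d'')))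
        Skip;;
      Set_Reg ''d'' (Arr ''nx'' (Reg ''d'')))"

text \<open>At a dart \<open>d\<close> from \<open>cur\<close> into the element \<open>g\<close> of \<open>M\<close>, \<open>sel_prog\<close> sets \<open>w\<close> to the other end of the ear \<open>g\<close> if \<open>cur\<close>
  is an end of it, and to \<open>cur\<close> otherwise.\<close>

definition sel_prog :: com where
  "sel_prog = Set_Reg ''w'' (Reg ''cur'');;
   Set_Reg ''g'' (Arr ''own'' (Arr ''do'' (Reg ''d'')));;
   If (And (Less (N 0) (Reg ''g'')) (Less (N 0) (Arr ''inn'' (Minus (Reg ''g'') (N 1)))))
     (Set_Reg ''g'' (Minus (Reg ''g'') (N 1));;
      If (Eq (Arr ''x'' (Reg ''g'')) (Reg ''cur''))
        (Set_Reg ''w'' (Arr ''y'' (Reg ''g'')))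
        (If (Eq (Arr ''y'' (Reg ''g'')) (Reg ''cur''))
          (Set_Reg ''w'' (Arr ''x'' (Reg ''g''))) Skip))
     Skip"

text \<open>When there is nothing to follow, \<open>w\<close> equals \<open>cur\<close>, which is
  visited already, so this case costs no separate test.\<close>

definition visit_prog :: com where
  "visit_prog = If (Less (Arr ''vis'' (Reg ''w'')) (N 1))
     (Set_Arr ''vis'' (Reg ''w'') (N 1);;
      Set_Arr ''par'' (Reg ''w'') (Reg ''cur'');;
      Set_Arr ''pg'' (Reg ''w'') (Reg ''g'');;
      Set_Arr ''bq'' (Reg ''bt'') (Reg ''w'');;
      incr ''bt'')
     Skip;;
   Set_Reg ''d'' (Arr ''nx'' (Reg ''d''))"

text \<open>The loops over the queue and over an adjacency list are merged into one:
  \<open>d = 0\<close> means that a list is exhausted and the next vertex is due. One loop needs one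
  invariant and one potential.\<close>

definition bfs_step :: com where
  "bfs_step = If (Less (N 0) (Reg ''d'')) (sel_prog;; visit_prog)
     (Set_Reg ''cur'' (Arr ''bq'' (Reg ''bh''));; incr ''bh'';;
      Set_Reg ''d'' (Arr ''hd'' (Reg ''cur'')))"

definition bfs_prog :: com where
  "bfs_prog = Set_Arr ''vis'' (Arr ''x'' (Reg ''j'')) (N 1);;
   Set_Arr ''bq'' (N 0) (Arr ''x'' (Reg ''j''));;
   Set_Reg ''bh'' (N 0);; Set_Reg ''bt'' (N 1);; Set_Reg ''d'' (N 0);;
   While (Or (Less (N 0) (Reg ''d'')) (Less (Reg ''bh'') (Reg ''bt''))) bfs_step"

context ear_ram
begin

lemma darts_Suc: "0 < d \<Longrightarrow> darts (Suc d) v = (if src d = v then d # darts d v else darts d v)"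
  by (simp add: darts_def)

lemma darts_less: "d' \<in> set (darts d v) \<Longrightarrow> d' < d"
  by (auto simp: darts_def)

text \<open>The cell \<open>d\<close> occurs in none of the older lists, so overwriting its link
  does not disturb them.\<close>

lemma chain_push:
  assumes "\<forall>v. chain nx (h v) (darts d v)" "0 < d" "src d = u"
  shows "\<forall>v. chain (nx(d := h u)) ((h(u := d)) v) (darts (Suc d) v)"
proof
  fix v
  have "chain (nx(d := h u)) (h v) (darts d v) = chain nx (h v) (darts d v)" for v
    by (rule chain_cong) (use darts_less in fastforce)
  then show "chain (nx(d := h u)) ((h(u := d)) v) (darts (Suc d) v)"
    using assms by (auto simp: darts_Suc)
qed

lemma dart_props:
  "edge_of (Suc (2 * e)) = e" "src (Suc (2 * e)) = a e" "dst (Suc (2 * e)) = b e"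
  "edge_of (Suc (Suc (2 * e))) = e" "src (Suc (Suc (2 * e))) = b e" "dst (Suc (Suc (2 * e))) = a e"
  by (simp_all add: edge_of_def src_def dst_def)

lemma adj_correct:
  assumes "params s" "reg s ''e'' = 0" "\<forall>v. arr s ''hd'' v = 0"
  shows "wp Bd adj_prog (\<lambda>t s'. t \<le> 60 * m + 20 \<and> adj_ok s') s"
proof -
  let ?I = "\<lambda>s. reg s ''e'' \<le> m \<and> reg s ''d'' = Suc (2 * reg s ''e'') \<and>
    (\<forall>v. chain (arr s ''nx'') (arr s ''hd'' v) (darts (reg s ''d'') v)) \<and>
    (\<forall>d\<in>{1..<reg s ''d''}. arr s ''de'' d = edge_of d \<and> arr s ''do'' d = dst d)"
  have le: "Suc 0 \<le> Bd" using Bd by simp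
  show ?thesis
    unfolding adj_prog_def
  proof (simp add: le, rule wp_While[where Inv = ?I and \<phi> = "\<lambda>s. 60 * (m - reg s ''e'')"], goal_cases)
    case 1
    show ?case using assms by (simp add: darts_def)
  next
    case (2 s')
    then have ps: "params s'" using assms(1) by (auto simp: params_def)
    define e where "e = reg s' ''e''"
    have e: "e < m" using 2 ps by (simp add: e_def params_def)
    have d: "reg s' ''d'' = Suc (2 * e)" using 2 by (simp add: e_def)
    let ?nx = "arr s' ''nx''" and ?hd = "arr s' ''hd''"
    have C0: "\<forall>v. chain ?nx (?hd v) (darts (Suc (2 * e)) v)"
      using 2(1) unfolding d by (elim conjE)
    have ne: "b e \<noteq> a e" using ends_less[OF e] by auto
    from chain_push[OF chain_push[OF C0 zero_less_Suc dart_props(2)] zero_less_Suc dart_props(5)]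
    have C: "\<forall>v. chain (?nx(Suc (2 * e) := ?hd (a e), Suc (Suc (2 * e)) := ?hd (b e)))
        ((?hd(a e := Suc (2 * e), b e := Suc (Suc (2 * e)))) v) (darts (Suc (Suc (Suc (2 * e)))) v)"
      by (simp only: fun_upd_other[OF ne] simp_thms)
    have hd: "?hd v \<le> 2 * m" for v
      using 2 d e by (intro chain_bound[of ?nx _ "darts (Suc (2 * e)) v"]) (auto dest: darts_less)
    have ab: "a e < n" "b e < n" "a e \<noteq> b e" using ends_less[OF e] by auto
    show ?case
      using 2 ps e Bd d C hd[of "a e"] hd[of "b e"] ab
      by (simp add: params_def e_def[symmetric] dart_props less_Suc_eq)
        (auto simp: dart_props less_Suc_eq)
  next
    case (3 T s')
    then have "reg s' ''e'' = m" using assms by (auto simp: params_def)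
    then show ?case using 3 assms by (auto simp: params_def adj_ok_def adj_def)
  qed
qed

lemma adj_mem: "d \<in> set (adj u) \<longleftrightarrow> 1 \<le> d \<and> d \<le> 2 * m \<and> src d = u"
  by (auto simp: adj_def darts_def)

lemma adj_dart:
  assumes "d \<in> set (adj u)"
  shows "edge_of d < m" "ends G (edge_of d) = {u, dst d}" "u < n" "dst d < n"
proof -
  show e: "edge_of d < m" using assms by (auto simp: adj_mem edge_of_def)
  show "ends G (edge_of d) = {u, dst d}" "u < n" "dst d < n"
    using assms ends[OF e] ends_less[OF e] by (auto simp: adj_mem src_def dst_def split: if_splits)
qed

lemma adj_edge:
  assumes "e < m" "ends G e = {u, v}"
  shows "\<exists>d\<in>set (adj u). edge_of d = e \<and> dst d = v"
proof (cases "u = a e \<and> v = b e")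
  case True
  then show ?thesis using assms(1) by (intro bexI[of _ "Suc (2 * e)"]) (auto simp: adj_mem dart_props)
next
  case False
  then have "u = b e \<and> v = a e" using assms ends[of e] by (auto simp: doubleton_eq_iff)
  then show ?thesis using assms(1)
    by (intro bexI[of _ "Suc (Suc (2 * e))"]) (auto simp: adj_mem dart_props)
qed

abbreviation dg :: "nat \<Rightarrow> nat" where "dg u \<equiv> length (adj u)"

lemma sum_dg: "(\<Sum>u<n. dg u) \<le> 2 * m"
proof -
  have "dg u = card {d \<in> {1..2 * m}. src d = u}" for u
  proof -
    have "distinct (adj u)" by (simp add: adj_def darts_def)
    moreover have "set (adj u) = {d \<in> {1..2 * m}. src d = u}" by (auto simp: adj_mem)
    ultimately show ?thesis using distinct_card by fastforce
  qed
  then have "(\<Sum>u<n. dg u) = card (\<Union>u<n. {d \<in> {1..2 * m}. src d = u})"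
    by (subst card_UN_disjoint) auto
  also have "\<dots> \<le> card {1..2 * m}" by (intro card_mono) auto
  finally show ?thesis by simp
qed

lemma dg_le: "dg u \<le> 2 * m"
proof (cases "u < n")
  case True
  then have "dg u \<le> (\<Sum>u<n. dg u)" by (intro member_le_sum) auto
  then show ?thesis using sum_dg by simp
next
  case False
  then have "adj u = []" using adj_dart(3)[of _ u] by (cases "adj u") auto
  then show ?thesis by simp
qed

lemma sum_dg_slots: "(\<Sum>i<k. dg (p i)) \<le> 2 * m" "(\<Sum>i<k. dg (q i)) \<le> 2 * m"
proof -
  have *: "(\<Sum>i<k. dg (r i)) \<le> 2 * m" if r: "\<And>i. i < k \<Longrightarrow> r i = p i \<or> r i = q i" for r
  proof -
    have "r i \<in> {p i, q i}" if "i < k" for i using r[OF that] by auto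
    then have "inj_on r {..<k}" by (intro inj_onI) (metis lessThan_iff same_index)
    then have "(\<Sum>i<k. dg (r i)) = (\<Sum>u\<in>r ` {..<k}. dg u)" by (simp add: sum.reindex)
    also have "\<dots> \<le> (\<Sum>u<n. dg u)" using r pq_less by (intro sum_mono2) fastforce+
    finally show ?thesis using sum_dg by simp
  qed
  show "(\<Sum>i<k. dg (p i)) \<le> 2 * m" "(\<Sum>i<k. dg (q i)) \<le> 2 * m" by (rule *; simp)+
qed

lemma env_hd:
  assumes "env s"
  shows "chain (arr s ''nx'') (arr s ''hd'' v) (adj v)" "clen (arr s ''nx'') (arr s ''hd'' v) = dg v"
    "arr s ''hd'' v \<le> 2 * m"
proof -
  show c: "chain (arr s ''nx'') (arr s ''hd'' v) (adj v)"
    using assms by (simp add: env_def adj_ok_def)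
  then show "clen (arr s ''nx'') (arr s ''hd'' v) = dg v" by (rule clen_eq)
  show "arr s ''hd'' v \<le> 2 * m" using c by (rule chain_bound) (auto simp: adj_mem)
qed

text \<open>In \<open>scan nx d u R\<close>, the traversal of the list of \<open>u\<close> has arrived at \<open>d\<close>, and \<open>R\<close> holds for the part
  before \<open>d\<close>.\<close>

definition scan :: "(nat \<Rightarrow> nat) \<Rightarrow> nat \<Rightarrow> nat \<Rightarrow> (nat list \<Rightarrow> bool) \<Rightarrow> bool" where
  "scan nx d u R \<longleftrightarrow> (\<exists>pre ds. adj u = pre @ ds \<and> chain nx d ds \<and> R pre)"

lemma scan_init: "env s \<Longrightarrow> R [] \<Longrightarrow> scan (arr s ''nx'') (arr s ''hd'' u) u R"
  unfolding scan_def using env_hd(1)[of s u] by (intro exI[of _ "[]"] exI[of _ "adj u"]) simp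

lemma scan_end: "scan nx 0 u R \<Longrightarrow> R (adj u)"
  by (auto simp: scan_def chain_zero)

lemma clen_zero [simp]: "clen nx 0 = 0"
  using clen_eq[of nx 0 "[]"] by simp

lemma scan_step:
  assumes s: "env s" and sc: "scan (arr s ''nx'') d u R" and d: "0 < d"
  obtains pre where "R pre" "\<And>R'. R' (pre @ [d]) \<Longrightarrow> scan (arr s ''nx'') (arr s ''nx'' d) u R'"
    "clen (arr s ''nx'') d = Suc (clen (arr s ''nx'') (arr s ''nx'' d))"
    "arr s ''nx'' d \<le> 2 * m" "arr s ''de'' d = edge_of d" "arr s ''do'' d = dst d"
    "edge_of d < m" "ends G (edge_of d) = {u, dst d}" "dst d < n"
proof -
  obtain pre ds where adj: "adj u = pre @ ds" and ch: "chain (arr s ''nx'') d ds" and R: "R pre"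
    using sc by (auto simp: scan_def)
  obtain ds' where ds: "ds = d # ds'" "chain (arr s ''nx'') (arr s ''nx'' d) ds'"
    using chain_cases[OF ch d] by auto
  have "d \<in> set (adj u)" using adj ds by simp
  note dd = adj_dart[OF this] this
  have "scan (arr s ''nx'') (arr s ''nx'' d) u R'" if "R' (pre @ [d])" for R'
    unfolding scan_def using adj ds that by (intro exI[of _ "pre @ [d]"] exI[of _ ds']) simp
  moreover have "arr s ''nx'' d \<le> 2 * m"
    using ds(2) by (rule chain_bound) (use adj ds adj_mem[of _ u] in auto)
  moreover have "arr s ''de'' d = edge_of d" "arr s ''do'' d = dst d"
    using s dd(5) by (auto simp: env_def adj_ok_def adj_mem)
  moreover have "clen (arr s ''nx'') d = Suc (clen (arr s ''nx'') (arr s ''nx'' d))"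
    using clen_eq[OF ch] clen_eq[OF ds(2)] ds(1) by simp
  ultimately show ?thesis using that[of pre] dd R by blast
qed

text \<open>An end of an ear together with an edge that certifies it. The edge is kept because the
  output names edges and the end alone does not determine one.\<close>

definition leg :: "bool \<Rightarrow> nat \<Rightarrow> nat \<Rightarrow> nat \<Rightarrow> bool" where
  "leg c i e v \<longleftrightarrow> e < m \<and> v \<in> outer \<and> ends G e = {if c then p i else q i, v}"

lemma leg_side: "leg c i e v \<Longrightarrow> v \<in> side c i"
  using edges by (auto simp: leg_def side_def A_def B_def)

definition mid :: "nat \<Rightarrow> nat \<Rightarrow> bool" where
  "mid i e \<longleftrightarrow> e < m \<and> ends G e = {p i, q i}"

lemma own_zero: "env s \<Longrightarrow> v < n \<Longrightarrow> arr s ''own'' v = 0 \<longleftrightarrow> v \<in> outer"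
  using outer_cases[of v] by (auto simp: env_def own_ok_def)

lemma own_Suc: "env s \<Longrightarrow> v < n \<Longrightarrow> arr s ''own'' v = Suc i \<Longrightarrow> i < k \<and> (v = p i \<or> v = q i)"
  using outer_cases[of v] by (auto simp: env_def own_ok_def)

lemma own_pq: "env s \<Longrightarrow> i < k \<Longrightarrow> v = p i \<or> v = q i \<Longrightarrow> arr s ''own'' v = Suc i"
  by (auto simp: env_def own_ok_def)

lemma first_correct:
  assumes s0: "env s0" and j: "reg s0 ''j'' = j" "j < k"
  shows "wp Bd first_prog (\<lambda>t s'. t \<le> 60 * dg (p j) + 40 \<and> leg True j (arr s' ''ea'' j) (arr s' ''x'' j) \<and>
    (p j \<noteq> q j \<longrightarrow> mid j (arr s' ''em'' j)) \<and>
    (\<forall>i. i \<noteq> j \<longrightarrow> arr s' ''x'' i = arr s0 ''x'' i \<and> arr s' ''ea'' i = arr s0 ''ea'' i \<and>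
      arr s' ''em'' i = arr s0 ''em'' i)) s0"
proof -
  \<comment> \<open>The claims are conditional on a suitable dart having been passed. That the
    complete list contains one follows from the existence of an ear path.\<close>
  define P where "P e v e' pre \<longleftrightarrow> ((\<exists>d\<in>set pre. dst d \<in> outer) \<longrightarrow> leg True j e v) \<and>
    ((\<exists>d\<in>set pre. dst d \<notin> outer) \<longrightarrow> mid j e')" for e v e' pre
  define same where "same s \<longleftrightarrow> (\<forall>i. i \<noteq> j \<longrightarrow> arr s ''x'' i = arr s0 ''x'' i \<and> arr s ''ea'' i = arr s0 ''ea'' i \<and>
      arr s ''em'' i = arr s0 ''em'' i)" for s :: ram_state
  let ?I = "\<lambda>s. same s \<and>
    scan (arr s ''nx'') (reg s ''d'') (p j) (P (arr s ''ea'' j) (arr s ''x'' j) (arr s ''em'' j))"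
  let ?\<phi> = "\<lambda>s. 50 * clen (arr s ''nx'') (reg s ''d'')"
  have pj: "arr s0 ''p'' = p" using s0 by (auto simp: env_def params_def)
  have le: "arr s0 ''hd'' v \<le> Bd" for v using env_hd(3)[OF s0, of v] Bd by simp
  show ?thesis
    unfolding first_prog_def
  proof (simp add: le pj j(1), rule wp_While[where Inv = ?I and \<phi> = ?\<phi>], goal_cases)
    case 1
    show ?case using scan_init[OF s0] by (simp add: P_def same_def)
  next
    case (2 s)
    have env: "env s" by (rule env_agree[OF 2(2)]) (use s0 in \<open>simp_all add: env_def params_def own_ok_def adj_ok_def\<close>)
    have rj: "reg s ''j'' = j" using 2(2) j by simp
    define d where "d = reg s ''d''"
    have d: "0 < d" using 2(3) by (simp add: d_def)
    have same: "same s" and sc: "scan (arr s ''nx'') d (p j) (P (arr s ''ea'' j) (arr s ''x'' j) (arr s ''em'' j))"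
      using 2(1) by (simp_all add: d_def)
    from scan_step[OF env sc d] obtain pre where P: "P (arr s ''ea'' j) (arr s ''x'' j) (arr s ''em'' j) pre"
      and nxt: "\<And>R'. R' (pre @ [d]) \<Longrightarrow> scan (arr s ''nx'') (arr s ''nx'' d) (p j) R'"
      and st: "clen (arr s ''nx'') d = Suc (clen (arr s ''nx'') (arr s ''nx'' d))"
      "arr s ''nx'' d \<le> 2 * m" "arr s ''de'' d = edge_of d" "arr s ''do'' d = dst d"
      "edge_of d < m" "ends G (edge_of d) = {p j, dst d}" "dst d < n"
      by blast
    have ow: "arr s ''own'' (dst d) = 0 \<longleftrightarrow> dst d \<in> outer" by (rule own_zero[OF env st(7)])
    show ?case
    proof (cases "dst d \<in> outer")
      case True
      then have "leg True j (edge_of d) (dst d)" using st by (simp add: leg_def)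
      then have "scan (arr s ''nx'') (arr s ''nx'' d) (p j) (P (edge_of d) (dst d) (arr s ''em'' j))"
        using P True by (intro nxt) (auto simp: P_def)
      then show ?thesis
        using same rj st Bd ow True by (simp add: d_def[symmetric] same_def)
    next
      case False
      then have "mid j (edge_of d)"
        using inner_edge[of j "edge_of d" "p j" "dst d"] st j edges by (auto simp: mid_def)
      then have "scan (arr s ''nx'') (arr s ''nx'' d) (p j) (P (arr s ''ea'' j) (arr s ''x'' j) (edge_of d))"
        using P False by (intro nxt) (auto simp: P_def)
      then show ?thesis
        using same rj st Bd ow False by (simp add: d_def[symmetric] same_def)
    qed
  next
    case (3 T s)
    then have P: "P (arr s ''ea'' j) (arr s ''x'' j) (arr s ''em'' j) (adj (p j))" and d: "reg s ''d'' = 0"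
      by (auto dest: scan_end)
    have "\<exists>d\<in>set (adj (p j)). dst d \<in> outer"
    proof -
      obtain e v where "e < m" "ends G e = {p j, v}" "v \<in> outer"
        using slots_witness[of j] j edges by (auto simp: A_def)
      then show ?thesis using adj_edge by metis
    qed
    moreover have "\<exists>d\<in>set (adj (p j)). dst d \<notin> outer" if ne: "p j \<noteq> q j"
    proof -
      obtain e where "e < m" "ends G e = {p j, q j}" using middle_edge[OF _ ne] j edges by auto
      moreover have "q j \<notin> outer" using inner_not_outer[of j] j by auto
      ultimately show ?thesis using adj_edge by metis
    qed
    ultimately show ?case
      using 3 P d env_hd(2)[OF s0, of "p j"] by (auto simp: P_def same_def)
  qed
qed

lemma second_correct:
  assumes s0: "env s0" and j: "reg s0 ''j'' = j" "j < k"
  shows "wp Bd second_prog (\<lambda>t s'. t \<le> 60 * dg (q j) + 40 \<and> leg False j (arr s' ''eb'' j) (arr s' ''y'' j) \<and>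
    (\<forall>i. i \<noteq> j \<longrightarrow> arr s' ''y'' i = arr s0 ''y'' i \<and> arr s' ''eb'' i = arr s0 ''eb'' i)) s0"
proof -
  define P where "P e v pre \<longleftrightarrow> ((\<exists>d\<in>set pre. dst d \<in> outer) \<longrightarrow> leg False j e v)" for e v pre
  define same where "same s \<longleftrightarrow> (\<forall>i. i \<noteq> j \<longrightarrow> arr s ''y'' i = arr s0 ''y'' i \<and> arr s ''eb'' i = arr s0 ''eb'' i)"
    for s :: ram_state
  let ?I = "\<lambda>s. same s \<and> scan (arr s ''nx'') (reg s ''d'') (q j) (P (arr s ''eb'' j) (arr s ''y'' j))"
  let ?\<phi> = "\<lambda>s. 50 * clen (arr s ''nx'') (reg s ''d'')"
  have pj: "arr s0 ''q'' = q" using s0 by (auto simp: env_def params_def)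
  have le: "arr s0 ''hd'' v \<le> Bd" for v using env_hd(3)[OF s0, of v] Bd by simp
  show ?thesis
    unfolding second_prog_def
  proof (simp add: le pj j(1), rule wp_While[where Inv = ?I and \<phi> = ?\<phi>], goal_cases)
    case 1
    show ?case using scan_init[OF s0] by (simp add: P_def same_def)
  next
    case (2 s)
    have env: "env s" by (rule env_agree[OF 2(2)]) (use s0 in \<open>simp_all add: env_def params_def own_ok_def adj_ok_def\<close>)
    have rj: "reg s ''j'' = j" using 2(2) j by simp
    define d where "d = reg s ''d''"
    have d: "0 < d" using 2(3) by (simp add: d_def)
    have same: "same s" and sc: "scan (arr s ''nx'') d (q j) (P (arr s ''eb'' j) (arr s ''y'' j))"
      using 2(1) by (simp_all add: d_def)
    from scan_step[OF env sc d] obtain pre where P: "P (arr s ''eb'' j) (arr s ''y'' j) pre"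
      and nxt: "\<And>R'. R' (pre @ [d]) \<Longrightarrow> scan (arr s ''nx'') (arr s ''nx'' d) (q j) R'"
      and st: "clen (arr s ''nx'') d = Suc (clen (arr s ''nx'') (arr s ''nx'' d))"
      "arr s ''nx'' d \<le> 2 * m" "arr s ''de'' d = edge_of d" "arr s ''do'' d = dst d"
      "edge_of d < m" "ends G (edge_of d) = {q j, dst d}" "dst d < n"
      by blast
    have ow: "arr s ''own'' (dst d) = 0 \<longleftrightarrow> dst d \<in> outer" by (rule own_zero[OF env st(7)])
    show ?case
    proof (cases "dst d \<in> outer")
      case True
      then have "leg False j (edge_of d) (dst d)" using st by (simp add: leg_def)
      then have "scan (arr s ''nx'') (arr s ''nx'' d) (q j) (P (edge_of d) (dst d))"
        using P True by (intro nxt) (auto simp: P_def)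
      then show ?thesis
        using same rj st Bd ow True by (simp add: d_def[symmetric] same_def)
    next
      case False
      then have "scan (arr s ''nx'') (arr s ''nx'' d) (q j) (P (arr s ''eb'' j) (arr s ''y'' j))"
        using P by (intro nxt) (auto simp: P_def)
      then show ?thesis
        using same rj st Bd ow False by (simp add: d_def[symmetric] same_def)
    qed
  next
    case (3 T s)
    then have P: "P (arr s ''eb'' j) (arr s ''y'' j) (adj (q j))" and d: "reg s ''d'' = 0"
      by (auto dest: scan_end)
    have "\<exists>d\<in>set (adj (q j)). dst d \<in> outer"
    proof -
      obtain e v where "e < m" "ends G e = {q j, v}" "v \<in> outer"
        using slots_witness[of j] j edges by (auto simp: B_def)
      then show ?thesis using adj_edge by metis
    qed
    then show ?case
      using 3 P d env_hd(2)[OF s0, of "q j"] by (auto simp: P_def same_def)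
  qed
qed

section \<open>A breadth-first tree of the current forest\<close>

definition marked :: "(nat \<Rightarrow> nat) \<Rightarrow> nat set" where
  "marked f = {v. v < n \<and> f v \<noteq> 0}"

lemma marked_upd: "w < n \<Longrightarrow> c \<noteq> 0 \<Longrightarrow> marked (f(w := c)) = insert w (marked f)"
  by (auto simp: marked_def)

lemma finite_marked: "finite (marked f)" "card (marked f) \<le> n"
proof -
  have "marked f \<subseteq> {..<n}" by (auto simp: marked_def)
  then show "finite (marked f)" "card (marked f) \<le> n"
    using card_mono[of "{..<n}" "marked f"] by (auto intro: finite_subset)
qed

text \<open>The queue is never emptied: it lists the tree in order of discovery, so each parent has
  a smaller position than its children.\<close>

definition bfs_tree where
  "bfs_tree x y F r C bq bt par pg \<longleftrightarrow> 0 < (bt :: nat) \<and> bij_betw bq {..<bt} C \<and> C \<subseteq> outer \<and> bq 0 = r \<and>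
     (\<forall>l. 0 < l \<and> l < bt \<longrightarrow> (\<exists>l'<l. par (bq l) = bq l') \<and> pg (bq l) \<in> F \<and>
        {x (pg (bq l)), y (pg (bq l))} = {bq l, par (bq l)})"

lemma bfs_push:
  assumes t: "bfs_tree x y F r C bq bt par pg" and h: "h < bt"
    and w: "w \<notin> C" "w \<in> outer" "g \<in> F" "{x g, y g} = {bq h, w}"
  shows "bfs_tree x y F r (insert w C) (bq(bt := w)) (Suc bt) (par(w := bq h)) (pg(w := g))"
proof -
  have bij: "bij_betw bq {..<bt} C" using t by (simp add: bfs_tree_def)
  have inC: "bq l \<in> C" if "l < bt" for l using bij that by (auto simp: bij_betw_def)
  have "bij_betw (bq(bt := w)) (insert bt {..<bt}) (insert w C)"
  proof -
    have "bij_betw (bq(bt := w)) {..<bt} C"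
      using bij by (rule iffD1[OF bij_betw_cong, rotated]) auto
    moreover have "bij_betw (bq(bt := w)) {bt} {w}" by (simp add: bij_betw_def)
    ultimately have "bij_betw (bq(bt := w)) ({..<bt} \<union> {bt}) (C \<union> {w})"
      using w(1) by (intro bij_betw_combine) auto
    then show ?thesis by simp
  qed
  then have "bij_betw (bq(bt := w)) {..<Suc bt} (insert w C)"
    by (simp add: lessThan_Suc)
  moreover have "(\<exists>l'<l. (par(w := bq h)) ((bq(bt := w)) l) = (bq(bt := w)) l') \<and> (pg(w := g)) ((bq(bt := w)) l) \<in> F \<and>
        {x ((pg(w := g)) ((bq(bt := w)) l)), y ((pg(w := g)) ((bq(bt := w)) l))} =
        {(bq(bt := w)) l, (par(w := bq h)) ((bq(bt := w)) l)}" if l: "0 < l" "l < Suc bt" for l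
  proof (cases "l = bt")
    case True
    then show ?thesis using h w by (auto simp: insert_commute)
  next
    case False
    then have lt: "l < bt" using l by simp
    then obtain l' where "l' < l" "par (bq l) = bq l'" "pg (bq l) \<in> F"
      "{x (pg (bq l)), y (pg (bq l))} = {bq l, par (bq l)}"
      using t l(1) by (auto simp: bfs_tree_def)
    moreover have "bq l \<noteq> w" using inC[OF lt] w(1) by auto
    ultimately show ?thesis using lt by (auto intro!: exI[of _ l'])
  qed
  ultimately show ?thesis
    using t w(2) unfolding bfs_tree_def by (auto simp del: fun_upd_apply) auto
qed

text \<open>The position in the queue serves as depth bound, because all that matters is that it
  decreases towards the root.\<close>

lemma bfs_rooted:
  assumes t: "bfs_tree x y F r C bq bt par pg"
    and cl: "\<And>g. g \<in> F \<Longrightarrow> x g \<in> C \<longleftrightarrow> y g \<in> C"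
  shows "\<exists>dp. rooted x y F r C par pg dp"
proof -
  have bij: "bij_betw bq {..<bt} C" using t by (simp add: bfs_tree_def)
  define dp where "dp = the_inv_into {..<bt} bq"
  have dp: "dp (bq l) = l" if "l < bt" for l
    unfolding dp_def using bij that by (intro the_inv_into_f_f) (auto simp: bij_betw_def)
  have "par v \<in> C \<and> pg v \<in> F \<and> {x (pg v), y (pg v)} = {v, par v} \<and> dp (par v) < dp v"
    if v: "v \<in> C - {r}" for v
  proof -
    obtain l where l: "l < bt" "v = bq l" using bij v by (auto simp: bij_betw_def)
    have "0 < l" using v t l by (cases l) (auto simp: bfs_tree_def)
    then obtain l' where l': "l' < l" "par v = bq l'" "pg v \<in> F" "{x (pg v), y (pg v)} = {v, par v}"
      using t l by (auto simp: bfs_tree_def)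
    moreover have "bq l' \<in> C" using bij l l' by (auto simp: bij_betw_def)
    ultimately show ?thesis using dp[of l] dp[of l'] l by simp
  qed
  moreover have "r \<in> C" using t bij by (auto simp: bfs_tree_def bij_betw_def)
  ultimately show ?thesis using cl unfolding rooted_def by blast
qed

text \<open>The forest has no adjacency lists of its own, which would have to follow every move. An
  ear \<open>g\<close> with end \<open>v\<close> is met instead through an edge of \<open>G\<close>
  from \<open>v\<close> to \<open>p g\<close> or \<open>q g\<close>, while the list of
  \<open>v\<close> in \<open>G\<close> is scanned.\<close>

definition handled where
  "handled x y F C v d \<longleftrightarrow> (\<forall>g\<in>F. dst d \<in> {p g, q g} \<longrightarrow> (x g = v \<longrightarrow> y g \<in> C) \<and> (y g = v \<longrightarrow> x g \<in> C))"

definition closed_at where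
  "closed_at x y F C v \<longleftrightarrow> (\<forall>g\<in>F. (x g = v \<longrightarrow> y g \<in> C) \<and> (y g = v \<longrightarrow> x g \<in> C))"

lemma handled_closed:
  assumes f: "fits x y F" and h: "\<And>d. d \<in> set (adj v) \<Longrightarrow> handled x y F C v d"
  shows "closed_at x y F C v"
  unfolding closed_at_def
proof (intro ballI conjI impI)
  fix g assume g: "g \<in> F"
  show "y g \<in> C" if "x g = v"
  proof -
    obtain e where "e < m" "ends G e = {v, p g}"
    proof -
      have "x g \<in> A g" using f g by (simp add: fits_def)
      then obtain e where "e < m" "ends G e = {p g, x g}" using edges by (auto simp: A_def)
      then show ?thesis using \<open>x g = v\<close> by (intro that[of e]) (auto simp: insert_commute)
    qed
    from adj_edge[OF this] obtain d where "d \<in> set (adj v)" "dst d = p g" by auto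
    then show ?thesis using h[of d] g that by (auto simp: handled_def)
  qed
  show "x g \<in> C" if "y g = v"
  proof -
    obtain e where "e < m" "ends G e = {v, q g}"
    proof -
      have "y g \<in> B g" using f g by (simp add: fits_def)
      then obtain e where "e < m" "ends G e = {q g, y g}" using edges by (auto simp: B_def)
      then show ?thesis using \<open>y g = v\<close> by (intro that[of e]) (auto simp: insert_commute)
    qed
    from adj_edge[OF this] obtain d where "d \<in> set (adj v)" "dst d = q g" by auto
    then show ?thesis using h[of d] g that by (auto simp: handled_def)
  qed
qed

definition accepted :: "ram_state \<Rightarrow> nat set" where
  "accepted s = {i. i < k \<and> arr s ''inn'' i \<noteq> 0}"

lemma sel_correct:
  assumes s: "env s" and x: "x = arr s ''x''" and y: "y = arr s ''y''" and F: "F = accepted s"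
    and f: "fits x y F" and d: "arr s ''do'' (reg s ''d'') = dst d" "dst d < n"
    and cur: "reg s ''cur'' = c" "c < n"
  shows "wp Bd sel_prog (\<lambda>t s'. t \<le> 60 \<and>
    (reg s' ''w'' = c \<or> reg s' ''g'' \<in> F \<and> {x (reg s' ''g''), y (reg s' ''g'')} = {c, reg s' ''w''}) \<and>
    handled x y F {reg s' ''w''} c d) s"
proof -
  define ow where "ow = arr s ''own'' (dst d)"
  have xy: "g \<in> F \<Longrightarrow> x g < n \<and> y g < n \<and> x g \<noteq> y g" for g
    using f outer_less by (auto simp: fits_def A_def B_def acyc_def)
  have own: "ow = Suc g" if "g \<in> F" "dst d \<in> {p g, q g}" for g
    using own_pq[OF s, of g "dst d"] that by (auto simp: F accepted_def ow_def)
  have uniq: "g = ow - 1" "0 < ow" "0 < arr s ''inn'' (ow - 1)" if "g \<in> F" "dst d \<in> {p g, q g}" for g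
    using own[OF that] that by (auto simp: F accepted_def)
  have ok: "ow - 1 \<in> F" "ow - 1 < k" if "0 < ow" "0 < arr s ''inn'' (ow - 1)"
    using own_Suc[OF s d(2), of "ow - 1"] that by (auto simp: F accepted_def ow_def)
  have oB: "ow \<le> Bd"
  proof (cases "ow = 0")
    case False
    then have "ow - 1 < k" using own_Suc[OF s d(2), of "ow - 1"] by (simp add: ow_def)
    then show ?thesis using k_le_n Bd by simp
  qed simp
  have B: "c \<le> Bd" using cur(2) Bd by simp
  show ?thesis
  proof (cases "0 < ow \<and> 0 < arr s ''inn'' (ow - 1)")
    case False
    then have N: "handled x y F {c} c d"
      using uniq unfolding handled_def by blast
    have "\<not> (0 < ow \<and> 0 < arr s ''inn'' (ow - Suc 0))" using False by simp
    then show ?thesis using N unfolding sel_prog_def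
      by (simp add: ow_def[symmetric] oB B d cur) (elim disjE; simp)
  next
    case True
    define g where "g = ow - 1"
    have ow: "ow = Suc g" and g: "g \<in> F" "g < k" "arr s ''inn'' g \<noteq> 0" using True ok by (auto simp: g_def)
    have u: "g' = g" if "g' \<in> F" "dst d \<in> {p g', q g'}" for g' using own[OF that] ow by simp
    have xg: "arr s ''x'' g = x g" "arr s ''y'' g = y g" by (simp_all add: x y)
    have b: "x g \<le> Bd" "y g \<le> Bd" "g \<le> Bd" "Suc g \<le> Bd" using xy[OF g(1)] Bd k_le_n g(2) by auto
    have N: "handled x y F {w} c d" if "(x g = c \<longrightarrow> y g = w) \<and> (y g = c \<longrightarrow> x g = w)" for w
      using u that unfolding handled_def by blast
    have owd: "arr s ''own'' (dst d) = Suc g" using ow by (simp add: ow_def)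
    consider "x g = c" "y g \<noteq> c" | "x g \<noteq> c" "y g = c" | "x g \<noteq> c" "y g \<noteq> c"
      using xy[OF g(1)] by auto
    then show ?thesis
    proof cases
      case 1
      then show ?thesis using N[of "y g"] unfolding sel_prog_def
        by (simp add: owd b d cur xg g B bval_Eq)
    next
      case 2
      then show ?thesis using N[of "x g"] unfolding sel_prog_def
        by (simp add: owd b d cur xg g B bval_Eq insert_commute) auto
    next
      case 3
      then show ?thesis using N[of c] unfolding sel_prog_def
        by (simp add: owd b d cur xg g B) auto
    qed
  qed
qed

lemma visit_correct:
  assumes x: "x = arr s ''x''" and y: "y = arr s ''y''" and F: "F = accepted s" and f: "fits x y F"
    and t: "bfs_tree x y F r C (arr s ''bq'') (reg s ''bt'') (arr s ''par'') (arr s ''pg'')"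
    and C: "C = marked (arr s ''vis'')" and c: "c = arr s ''bq'' h" "h < reg s ''bt''" "reg s ''cur'' = c"
    and w: "w = reg s ''w''" "g = reg s ''g''" "w = c \<or> g \<in> F \<and> {x g, y g} = {c, w}"
    and d: "arr s ''nx'' (reg s ''d'') \<le> 2 * m"
  shows "wp Bd visit_prog (\<lambda>t s'. t \<le> 30 \<and> marked (arr s' ''vis'') = insert w C \<and>
    bfs_tree x y F r (insert w C) (arr s' ''bq'') (reg s' ''bt'') (arr s' ''par'') (arr s' ''pg'') \<and>
    reg s' ''d'' = arr s ''nx'' (reg s ''d'') \<and> reg s ''bt'' \<le> reg s' ''bt'' \<and>
    (\<forall>l<reg s ''bt''. arr s' ''bq'' l = arr s ''bq'' l)) s"
proof -
  have bij: "bij_betw (arr s ''bq'') {..<reg s ''bt''} C" and Co: "C \<subseteq> outer"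
    using t by (auto simp: bfs_tree_def)
  have cC: "c \<in> C" using bij c(1,2) by (auto simp: bij_betw_def)
  have wo: "w \<in> outer" using w(3) cC Co f by (auto simp: fits_def A_def B_def doubleton_eq_iff)
  have B: "w < n" "w \<le> Bd" "c \<le> Bd" "1 \<le> Bd" "arr s ''nx'' (reg s ''d'') \<le> Bd"
    using outer_less[OF wo] outer_less[of c] cC Co Bd d by auto
  show ?thesis
  proof (cases "arr s ''vis'' w = 0")
    case False
    then have "w \<in> C" using B(1) by (auto simp: C marked_def)
    then have "insert w C = C" by auto
    then show ?thesis using False t C B by (simp add: visit_prog_def w(1)[symmetric])
  next
    case True
    then have wC: "w \<notin> C" by (auto simp: C marked_def)
    then have g: "g \<in> F" "{x g, y g} = {arr s ''bq'' h, w}" using w(3) cC c by auto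
    have "g < k" using g(1) by (simp add: F accepted_def)
    then have gB: "g \<le> Bd" using k_le_n Bd by simp
    have "reg s ''bt'' = card C" using bij_betw_same_card[OF bij] by simp
    then have bt: "Suc (reg s ''bt'') \<le> Bd" using finite_marked(2)[of "arr s ''vis''"] Bd C by simp
    note p = bfs_push[OF t c(2) wC wo g]
    have m: "marked ((arr s ''vis'')(w := Suc 0)) = insert w C" using marked_upd[OF B(1), of "Suc 0"] C by simp
    show ?thesis
      using True p m B gB bt c
      by (simp add: visit_prog_def w(1,2)[symmetric] del: fun_upd_apply) (simp add: w(1,2)[symmetric])
  qed
qed

lemma closed_at_mono: "closed_at x y F C v \<Longrightarrow> C \<subseteq> C' \<Longrightarrow> closed_at x y F C' v"
  unfolding closed_at_def by blast

lemma handled_mono: "handled x y F C v d \<Longrightarrow> C \<subseteq> C' \<Longrightarrow> handled x y F C' v d"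
  unfolding handled_def by blast

lemma bfs_correct:
  assumes s0: "env s0" and j: "reg s0 ''j'' = j" and x: "x = arr s0 ''x''" and y: "y = arr s0 ''y''"
    and F: "F = accepted s0" and f: "fits x y F" and r: "x j \<in> outer" and vis: "\<forall>v<n. arr s0 ''vis'' v = 0"
  shows "wp Bd bfs_prog (\<lambda>t s'. t \<le> 300 * (n + m) + 100 \<and> marked (arr s' ''vis'') \<subseteq> outer \<and>
    (\<exists>dp. rooted x y F (x j) (marked (arr s' ''vis'')) (arr s' ''par'') (arr s' ''pg'') dp)) s0"
proof -
  define s1 where "s1 = s0\<lparr>
    arr := (arr s0)(''vis'' := (arr s0 ''vis'')(x j := Suc 0), ''bq'' := (arr s0 ''bq'')(0 := x j)),
    reg := (reg s0)(''bh'' := 0, ''bt'' := Suc 0, ''d'' := 0)\<rparr>"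
  let ?C = "\<lambda>s. marked (arr s ''vis'')"
  define tree where "tree s \<longleftrightarrow> bfs_tree x y F (x j) (?C s) (arr s ''bq'') (reg s ''bt'') (arr s ''par'') (arr s ''pg'')"
    for s :: ram_state
  \<comment> \<open>Position \<open>bh - 1\<close> holds the vertex being scanned; only those before
    it are finished.\<close>
  define old where "old s \<longleftrightarrow> (\<forall>l. Suc l < reg s ''bh'' \<longrightarrow> closed_at x y F (?C s) (arr s ''bq'' l))"
    for s :: ram_state
  define cur where "cur s \<longleftrightarrow> (reg s ''bh'' = 0 \<longrightarrow> reg s ''d'' = 0) \<and>
    (0 < reg s ''bh'' \<longrightarrow> reg s ''cur'' = arr s ''bq'' (reg s ''bh'' - 1) \<and>
      scan (arr s ''nx'') (reg s ''d'') (reg s ''cur'')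
        (\<lambda>pre. \<forall>d\<in>set pre. handled x y F (?C s) (reg s ''cur'') d))" for s :: ram_state
  \<comment> \<open>Each vertex not yet taken from the queue holds credit for its turn: 150 for
    every dart of its list and 50 for taking it out.\<close>
  define rest where "rest s = (\<Sum>v\<in>{..<n} - arr s ''bq'' ` {..<reg s ''bh''}. 150 * dg v + 50)"
    for s :: ram_state
  let ?I = "\<lambda>s. tree s \<and> reg s ''bh'' \<le> reg s ''bt'' \<and> old s \<and> cur s"
  let ?\<phi> = "\<lambda>s. 150 * clen (arr s ''nx'') (reg s ''d'') + rest s"
  let ?G = "Or (Less (N 0) (Reg ''d'')) (Less (Reg ''bh'') (Reg ''bt''))"
  have rn: "x j < n" "x j \<le> Bd" "Suc 0 \<le> Bd" using outer_less[OF r] Bd by auto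
  have main: "wp Bd (While ?G bfs_step) (\<lambda>t s'. t \<le> 300 * (n + m) + 50 \<and> marked (arr s' ''vis'') \<subseteq> outer \<and>
    (\<exists>dp. rooted x y F (x j) (marked (arr s' ''vis'')) (arr s' ''par'') (arr s' ''pg'') dp)) s1"
  proof (rule wp_While[where Inv = ?I and \<phi> = ?\<phi>], goal_cases)
    case 1
    have "marked (arr s0 ''vis'') = {}" using vis by (auto simp: marked_def)
    then have "?C s1 = {x j}" using marked_upd[OF rn(1), of "Suc 0" "arr s0 ''vis''"] by (simp add: s1_def)
    then show ?case using r
      by (auto simp: tree_def old_def cur_def s1_def bfs_tree_def bij_betw_def lessThan_Suc)
  next
    case (2 s)
    have ag: "agree bfs_step s1 s" by fact
    have agE: "arr s ''x'' = x" "arr s ''y'' = y" "arr s ''inn'' = arr s0 ''inn''" "reg s ''j'' = j"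
      using ag j x y by (simp_all add: bfs_step_def sel_prog_def visit_prog_def s1_def)
    have env: "env s"
    proof (rule env_agree[OF ag])
      show "env s1" using s0 by (simp add: s1_def env_def params_def own_ok_def adj_ok_def)
    qed (simp_all add: bfs_step_def sel_prog_def visit_prog_def)
    have Fs: "F = accepted s" using F agE by (simp add: accepted_def)
    have I: "tree s" "reg s ''bh'' \<le> reg s ''bt''" "old s" "cur s" using 2(1) by blast+
    have bij: "bij_betw (arr s ''bq'') {..<reg s ''bt''} (?C s)" and Co: "?C s \<subseteq> outer"
      using I(1) by (auto simp: tree_def bfs_tree_def)
    show ?case
    proof (cases "0 < reg s ''d''")
      case True
      define d c h where "d = reg s ''d''" and "c = reg s ''cur''" and "h = reg s ''bh'' - 1"
      define H where "H = (\<lambda>pre. \<forall>d\<in>set pre. handled x y F (?C s) c d)"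
      have bh: "0 < reg s ''bh''" and ch: "c = arr s ''bq'' h" "h < reg s ''bt''"
        and sc: "scan (arr s ''nx'') d c H"
        using I(2,4) True by (auto simp: cur_def c_def d_def h_def H_def)
      have cC: "c \<in> ?C s" using ch bij by (auto simp: bij_betw_def)
      then have cn: "c < n" using Co outer_less by auto
      have d0: "0 < d" using True by (simp add: d_def)
      obtain pre where
        R: "H pre"
        and nxt: "\<And>R'. R' (pre @ [d]) \<Longrightarrow> scan (arr s ''nx'') (arr s ''nx'' d) c R'"
        and st: "clen (arr s ''nx'') d = Suc (clen (arr s ''nx'') (arr s ''nx'' d))"
          "arr s ''nx'' d \<le> 2 * m" "arr s ''do'' d = dst d" "dst d < n"
        by (rule scan_step[OF env sc d0]) (rule that; assumption)
      let ?Q = "\<lambda>t s'. ?I s' \<and> t + bcost ?G + 1 + ?\<phi> s' \<le> ?\<phi> s"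
      have "wp Bd (sel_prog;; visit_prog) (\<lambda>t. ?Q (1 + bcost (Less (N 0) (Reg ''d'')) + t)) s"
        unfolding wp_Seq
      proof (rule wp_conseq[OF sel_correct[where d = d and c = c, OF env agE(1,2)[symmetric] Fs f]], goal_cases)
        case 1
        show ?case using st d_def by simp
      next
        case 2
        show ?case by fact
      next
        case 3
        show ?case by (simp add: c_def)
      next
        case 4
        show ?case by fact
      next
        case (5 t s')
        have ag': "agree sel_prog s s'" by fact
        have arr: "arr s' = arr s" by (rule ext, rule agree_arr[OF ag']) (simp add: sel_prog_def)
        have keep: "arr s' = arr s" "reg s' ''d'' = d" "reg s' ''bh'' = reg s ''bh''" "reg s' ''bt'' = reg s ''bt''"
          "reg s' ''cur'' = c"
          using ag' by (simp_all add: arr sel_prog_def d_def c_def)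
        define w g where "w = reg s' ''w''" and "g = reg s' ''g''"
        have sel: "t \<le> 60" "w = c \<or> g \<in> F \<and> {x g, y g} = {c, w}" "handled x y F {w} c d"
          using 5(2) by (simp_all add: w_def g_def)
        have Fs': "F = accepted s'" using Fs keep by (simp add: accepted_def)
        show ?case
        proof (rule wp_conseq[OF visit_correct[of x s' y F "x j" "?C s" c h w g]], goal_cases)
          case 1
          show ?case using agE keep by simp
        next
          case 2
          show ?case using agE keep by simp
        next
          case 5
          show ?case using I(1) keep by (simp add: tree_def)
        next
          case (14 u s'')
          have ag'': "agree visit_prog s' s''" by fact
          have k2: "arr s'' ''nx'' = arr s ''nx''" "reg s'' ''bh'' = reg s ''bh''" "reg s'' ''cur'' = c"
            using ag'' keep by (simp_all add: visit_prog_def)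
          have v: "u \<le> 30" "?C s'' = insert w (?C s)"
            "bfs_tree x y F (x j) (insert w (?C s)) (arr s'' ''bq'') (reg s'' ''bt'') (arr s'' ''par'') (arr s'' ''pg'')"
            "reg s'' ''d'' = arr s ''nx'' d" "reg s ''bt'' \<le> reg s'' ''bt''"
            "\<forall>l<reg s ''bt''. arr s'' ''bq'' l = arr s ''bq'' l"
            using 14(2) keep by simp_all
          have sub: "?C s \<subseteq> ?C s''" using v(2) by auto
          have bq: "arr s'' ''bq'' l = arr s ''bq'' l" if "l < reg s ''bh''" for l
            using v(6) I(2) that by auto
          have "tree s''" using v(2,3) by (simp add: tree_def)
          moreover have "old s''" using I(3) bq sub by (auto simp: old_def k2 intro: closed_at_mono)
          moreover have "scan (arr s ''nx'') (arr s ''nx'' d) c (\<lambda>pre. \<forall>d\<in>set pre. handled x y F (?C s'') c d)"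
            using R[unfolded H_def] sel(3) handled_mono[OF _ sub] handled_mono[of x y F "{w}" c d "?C s''"] v(2)
            by (intro nxt) auto
          then have "cur s''" using bh ch bq[of h] by (simp add: cur_def k2 v(4) h_def)
          moreover have "rest s'' = rest s"
          proof -
            have "arr s'' ''bq'' ` {..<reg s ''bh''} = arr s ''bq'' ` {..<reg s ''bh''}"
              using bq by (intro image_cong) auto
            then show ?thesis by (simp add: rest_def k2)
          qed
          ultimately show ?case
            using v(1,4,5) sel(1) I(2) st(1) by (simp add: k2 d_def[symmetric])
        qed (use keep Fs' f sel ch w_def g_def st in auto)
      qed
      then show ?thesis using True by (simp add: bfs_step_def)
    next
      case False
      then have d: "reg s ''d'' = 0" by simp
      have lt: "reg s ''bh'' < reg s ''bt''" using 2(3) d by simp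
      define v where "v = arr s ''bq'' (reg s ''bh'')"
      have vC: "v \<in> ?C s" using lt bij by (auto simp: bij_betw_def v_def)
      then have vn: "v < n" using Co outer_less by auto
      have vnew: "v \<notin> arr s ''bq'' ` {..<reg s ''bh''}"
      proof
        assume "v \<in> arr s ''bq'' ` {..<reg s ''bh''}"
        then obtain l where l: "l < reg s ''bh''" "arr s ''bq'' (reg s ''bh'') = arr s ''bq'' l"
          by (auto simp: v_def)
        have "inj_on (arr s ''bq'') {..<reg s ''bt''}" using bij by (simp add: bij_betw_def)
        from inj_onD[OF this l(2)] l(1) lt show False by simp
      qed
      have bt: "Suc (reg s ''bh'') \<le> Bd"
        using bij_betw_same_card[OF bij] finite_marked(2)[of "arr s ''vis''"] lt Bd by simp
      have "closed_at x y F (?C s) (arr s ''bq'' l)" if "l < reg s ''bh''" for l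
      proof (cases "Suc l < reg s ''bh''")
        case True
        then show ?thesis using I(3) by (simp add: old_def)
      next
        case False
        then have l: "l = reg s ''bh'' - 1" using that by simp
        have "scan (arr s ''nx'') 0 (reg s ''cur'') (\<lambda>pre. \<forall>d\<in>set pre. handled x y F (?C s) (reg s ''cur'') d)"
          and c: "reg s ''cur'' = arr s ''bq'' l" using I(4) d l that by (auto simp: cur_def)
        from scan_end[OF this(1)] show ?thesis unfolding c by (intro handled_closed[OF f]) auto
      qed
      then have "old (s\<lparr>reg := (reg s)(''cur'' := v, ''bh'' := Suc (reg s ''bh''), ''d'' := arr s ''hd'' v)\<rparr>)"
        by (simp add: old_def)
      moreover have "tree (s\<lparr>reg := (reg s)(''cur'' := v, ''bh'' := Suc (reg s ''bh''), ''d'' := arr s ''hd'' v)\<rparr>)"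
        using I(1) by (simp add: tree_def)
      moreover have "cur (s\<lparr>reg := (reg s)(''cur'' := v, ''bh'' := Suc (reg s ''bh''), ''d'' := arr s ''hd'' v)\<rparr>)"
        using scan_init[OF env] by (simp add: cur_def v_def)
      moreover have "rest s = 150 * dg v + 50 +
        rest (s\<lparr>reg := (reg s)(''cur'' := v, ''bh'' := Suc (reg s ''bh''), ''d'' := arr s ''hd'' v)\<rparr>)"
      proof -
        define X where "X = {..<n} - arr s ''bq'' ` {..<Suc (reg s ''bh'')}"
        have "{..<n} - arr s ''bq'' ` {..<reg s ''bh''} = insert v X"
          using vn vnew by (auto simp: lessThan_Suc v_def X_def)
        moreover have "v \<notin> X" by (simp add: X_def v_def)
        ultimately have "rest s = 150 * dg v + 50 + (\<Sum>v\<in>X. 150 * dg v + 50)"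
          by (simp add: rest_def X_def)
        then show ?thesis by (simp add: rest_def X_def)
      qed
      ultimately show ?thesis
        using d lt vn bt Bd env_hd(2,3)[OF env, of v] by (simp add: bfs_step_def v_def[symmetric])
    qed
  next
    case (3 T s)
    have I: "tree s" "reg s ''bh'' \<le> reg s ''bt''" "old s" "cur s" using 3(1) by blast+
    have d: "reg s ''d'' = 0" and bh: "reg s ''bh'' = reg s ''bt''" using 3(3) I(2) by auto
    have bij: "bij_betw (arr s ''bq'') {..<reg s ''bt''} (?C s)" and Co: "?C s \<subseteq> outer"
      and bt: "0 < reg s ''bt''"
      using I(1) by (auto simp: tree_def bfs_tree_def)
    have "closed_at x y F (?C s) (arr s ''bq'' l)" if "l < reg s ''bt''" for l
    proof (cases "Suc l < reg s ''bh''")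
      case True
      then show ?thesis using I(3) by (simp add: old_def)
    next
      case False
      then have l: "l = reg s ''bh'' - 1" using that bh by simp
      have "scan (arr s ''nx'') 0 (reg s ''cur'') (\<lambda>pre. \<forall>d\<in>set pre. handled x y F (?C s) (reg s ''cur'') d)"
        and c: "reg s ''cur'' = arr s ''bq'' l" using I(4) d l bt bh by (auto simp: cur_def)
      from scan_end[OF this(1)] show ?thesis unfolding c by (intro handled_closed[OF f]) auto
    qed
    then have closed: "closed_at x y F (?C s) v" if v: "v \<in> ?C s" for v
    proof -
      have "v \<in> arr s ''bq'' ` {..<reg s ''bt''}" using v bij by (simp add: bij_betw_def)
      then obtain l where "l < reg s ''bt''" "v = arr s ''bq'' l" by auto
      with \<open>\<And>l. l < reg s ''bt'' \<Longrightarrow> _\<close> show ?thesis by simp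
    qed
    have cl: "x g \<in> ?C s \<longleftrightarrow> y g \<in> ?C s" if "g \<in> F" for g
      using closed[of "x g"] closed[of "y g"] that unfolding closed_at_def by blast
    have "rest s1 \<le> (\<Sum>v<n. 150 * dg v + 50)"
      unfolding rest_def by (intro sum_mono2) auto
    also have "\<dots> = 150 * (\<Sum>v<n. dg v) + 50 * n" by (simp add: sum.distrib sum_distrib_left)
    also have "\<dots> \<le> 300 * m + 50 * n" using sum_dg by simp
    finally have "T \<le> 300 * (n + m) + 50" using 3(4) by (simp add: s1_def)
    then show ?case using bfs_rooted[OF I(1)[unfolded tree_def] cl] Co by blast
  qed
  have ag: "arr s0 ''x'' j = x j" using x by simp
  show ?thesis
    unfolding bfs_prog_def
    using rn j by (simp add: ag) (rule wp_conseq[OF main[unfolded s1_def]], auto)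
qed

end

section \<open>The search as a program\<close>

text \<open>Register \<open>sd\<close> is nonzero iff side \<open>A\<close> is being scanned.\<close>

definition walk_prog :: com where
  "walk_prog = Set_Reg ''w'' (Reg ''v'');;
   While (Less (Arr ''ins'' (Reg ''w'')) (N 1))
     (Set_Arr ''ins'' (Reg ''w'') (N 1);;
      Set_Reg ''g'' (Arr ''pg'' (Reg ''w''));;
      Set_Arr ''ph'' (Reg ''g'') (Reg ''h'');;
      Set_Arr ''ps'' (Reg ''g'') (Reg ''sd'');;
      Set_Arr ''pv'' (Reg ''g'') (Reg ''v'');;
      Set_Arr ''pe'' (Reg ''g'') (Reg ''ee'');;
      Set_Arr ''fq'' (Reg ''ft'') (Reg ''g'');;
      incr ''ft'';;
      Set_Reg ''w'' (Arr ''par'' (Reg ''w'')))"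

text \<open>One flattened loop again: for each \<open>h\<close> the list of \<open>q h\<close> is
  scanned with \<open>sd = 0\<close>, then that of \<open>p h\<close> with \<open>sd = 1\<close>,
  then the next \<open>h\<close> is taken from the queue. A hit leaves \<open>h\<close>,
  \<open>sd\<close>, \<open>v\<close> and \<open>ee\<close> standing as input of the
  augmentation.\<close>

definition search_step :: com where
  "search_step = If (Less (N 0) (Reg ''d''))
     (Set_Reg ''v'' (Arr ''do'' (Reg ''d''));;
      Set_Reg ''ee'' (Arr ''de'' (Reg ''d''));;
      If (Less (Arr ''own'' (Reg ''v'')) (N 1))
        (If (Less (Arr ''vis'' (Reg ''v'')) (N 1))
          (Set_Reg ''fnd'' (N 1))
          (walk_prog;; Set_Reg ''d'' (Arr ''nx'' (Reg ''d''))))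
        (Set_Reg ''d'' (Arr ''nx'' (Reg ''d''))))
     (If (Less (Reg ''sd'') (N 1))
       (Set_Reg ''sd'' (N 1);; Set_Reg ''d'' (Arr ''hd'' (Arr ''p'' (Reg ''h''))))
       (Set_Reg ''h'' (Arr ''fq'' (Reg ''fh''));; incr ''fh'';; Set_Reg ''sd'' (N 0);;
        Set_Reg ''d'' (Arr ''hd'' (Arr ''q'' (Reg ''h'')))))"

text \<open>\<open>j\<close> occupies position 0 of the queue and counts as taken out, so the
  discovered ears start at position 1.\<close>

definition search_prog :: com where
  "search_prog = Set_Arr ''ins'' (Arr ''x'' (Reg ''j'')) (N 1);;
   Set_Arr ''fq'' (N 0) (Reg ''j'');; Set_Reg ''fh'' (N 1);; Set_Reg ''ft'' (N 1);;
   Set_Reg ''h'' (Reg ''j'');; Set_Reg ''sd'' (N 0);;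
   Set_Reg ''d'' (Arr ''hd'' (Arr ''q'' (Reg ''j'')));; Set_Reg ''fnd'' (N 0);;
   While (And (Less (Reg ''fnd'') (N 1))
       (Or (Or (Less (N 0) (Reg ''d'')) (Less (Reg ''sd'') (N 1))) (Less (Reg ''fh'') (Reg ''ft''))))
     search_step"

locale ear_search = ear_ram G M k p q n m a b Bd
  for G :: "(nat, nat) mgraph" and M k p q n m a b Bd +
  fixes x y :: "nat \<Rightarrow> nat" and F :: "nat set" and j :: nat and C :: "nat set"
    and par pg dp :: "nat \<Rightarrow> nat"
  assumes rooted: "rooted x y F (x j) C par pg dp" and fits: "fits x y F"
    and F: "F \<subseteq> {..<k}" and j: "j < k" "j \<notin> F" "x j \<in> A j" "y j \<in> B j" and C: "C \<subseteq> outer"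
begin

definition fixed :: "ram_state \<Rightarrow> bool" where
  "fixed s \<longleftrightarrow> env s \<and> arr s ''x'' = x \<and> arr s ''y'' = y \<and> arr s ''par'' = par \<and> arr s ''pg'' = pg \<and>
     marked (arr s ''vis'') = C \<and> reg s ''j'' = j"

lemma fixed_agree:
  "agree c s s' \<Longrightarrow> {''n'', ''m'', ''k'', ''j''} \<inter> wr c = {} \<Longrightarrow>
    {''a'', ''b'', ''p'', ''q'', ''own'', ''hd'', ''nx'', ''de'', ''do'', ''x'', ''y'', ''par'', ''pg'', ''vis''} \<inter> wa c = {} \<Longrightarrow>
    fixed s \<Longrightarrow> fixed s'"
  by (simp add: fixed_def env_def params_def own_ok_def adj_ok_def)

definition found :: "ram_state \<Rightarrow> nat set" where
  "found s = arr s ''fq'' ` {1..<reg s ''ft''}"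

definition seen :: "ram_state \<Rightarrow> nat set" where
  "seen s = marked (arr s ''ins'')"

text \<open>Stated for arrays instead of a state, so that updates of unrelated cells simplify
  away.\<close>

definition searching where
  "searching fq ft S ph pv ps pe K \<longleftrightarrow>
     search x y F (x j) j (fq ` {1..<ft}) S ph pv (\<lambda>g. ps g \<noteq> (0 :: nat)) K \<and>
     inj_on fq {..<ft} \<and> 0 < ft \<and> fq (0 :: nat) = j \<and>
     (\<forall>g\<in>fq ` {1..<ft}. leg (ps g \<noteq> 0) (ph g) (pe g) (pv g))"

definition searched :: "ram_state \<Rightarrow> (nat \<Rightarrow> nat set) \<Rightarrow> bool" where
  "searched s = searching (arr s ''fq'') (reg s ''ft'') (seen s)
     (arr s ''ph'') (arr s ''pv'') (arr s ''ps'') (arr s ''pe'')"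

lemma searched_iff:
  "searched s K \<longleftrightarrow> search x y F (x j) j (found s) (seen s)
       (arr s ''ph'') (arr s ''pv'') (\<lambda>g. arr s ''ps'' g \<noteq> 0) K \<and>
     inj_on (arr s ''fq'') {..<reg s ''ft''} \<and> 0 < reg s ''ft'' \<and> arr s ''fq'' 0 = j \<and>
     (\<forall>g\<in>found s. leg (arr s ''ps'' g \<noteq> 0) (arr s ''ph'' g) (arr s ''pe'' g) (arr s ''pv'' g))"
  by (simp add: searched_def searching_def found_def)

lemma queue_image: "0 < ft \<Longrightarrow> fq ` {..<ft} = insert (fq 0) (fq ` {1..<ft})" for fq :: "nat \<Rightarrow> nat"
proof -
  assume "0 < ft"
  then have "{..<ft} = insert 0 {1..<ft}" by auto
  then show ?thesis by simp
qed

lemma queue_push: "0 < t \<Longrightarrow> (fq(t := g)) ` {1..<Suc t} = insert g (fq ` {1..<t})" for fq :: "nat \<Rightarrow> nat"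
proof -
  assume "0 < t"
  then have "{1..<Suc t} = insert t {1..<t}" by auto
  moreover have "(fq(t := g)) ` {1..<t} = fq ` {1..<t}" by (intro image_cong) auto
  ultimately show ?thesis by (simp only: image_insert fun_upd_same)
qed

lemma queue_bound:
  assumes "fq ` {1..<ft} \<subseteq> F" "inj_on fq {..<ft}" "0 < ft" "fq 0 = j"
  shows "ft \<le> k" "insert j (fq ` {1..<ft}) \<subseteq> {..<k}"
proof -
  show 1: "insert j (fq ` {1..<ft}) \<subseteq> {..<k}" using assms F j by auto
  then have "fq ` {..<ft} \<subseteq> {..<k}" using queue_image[OF assms(3)] assms(4) by simp
  then show "ft \<le> k" using card_inj_on_le[OF assms(2), of "{..<k}"] by simp
qed

text \<open>The clause on \<open>v\<close> turns the exit condition into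
  \<open>v \<in> seen s\<close>: the walk either has marked its start or is still standing on
  it.\<close>

definition walking where
  "walking s0 h v s \<longleftrightarrow> walk x y F C dp (found s0) (seen s0) (found s) (seen s) v (reg s ''w'') \<and>
     inj_on (arr s ''fq'') {..<reg s ''ft''} \<and> reg s0 ''ft'' \<le> reg s ''ft'' \<and>
     (\<forall>l<reg s0 ''ft''. arr s ''fq'' l = arr s0 ''fq'' l) \<and> (v \<in> seen s \<or> reg s ''w'' = v) \<and>
     (\<forall>g\<in>found s - found s0. arr s ''ph'' g = h \<and> arr s ''pv'' g = v \<and>
        arr s ''ps'' g = reg s0 ''sd'' \<and> arr s ''pe'' g = reg s0 ''ee'') \<and>
     (\<forall>g. g \<notin> found s - found s0 \<longrightarrow> arr s ''ph'' g = arr s0 ''ph'' g \<and> arr s ''pv'' g = arr s0 ''pv'' g \<and>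
        arr s ''ps'' g = arr s0 ''ps'' g \<and> arr s ''pe'' g = arr s0 ''pe'' g)"

text \<open>Apart from a constant, time is charged to newly marked vertices. Each vertex is marked
  once, so the climbing done by all walks of one search is linear in \<open>n\<close>.\<close>

lemma walk_correct:
  assumes s0: "fixed s0" "searched s0 K" and v: "reg s0 ''v'' = v" "v \<in> C"
    and h: "reg s0 ''h'' = h" "h \<in> insert j (found s0)" and sd: "reg s0 ''sd'' \<le> 1"
    and leg: "leg (reg s0 ''sd'' \<noteq> 0) h (reg s0 ''ee'') v"
    and keep: "keep x y (reg s0 ''sd'' \<noteq> 0) h \<in> seen s0"
  shows "wp Bd walk_prog (\<lambda>t s'. t + 100 * (n - card (seen s')) \<le> 100 * (n - card (seen s0)) + 20 \<and>
    (\<exists>K'. searched s' K') \<and> v \<in> seen s' \<and> seen s0 \<subseteq> seen s' \<and> reg s0 ''ft'' \<le> reg s' ''ft'' \<and>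
    (\<forall>l<reg s0 ''ft''. arr s' ''fq'' l = arr s0 ''fq'' l)) s0"
proof -
  let ?I = "walking s0 h v"
  let ?\<phi> = "\<lambda>s. 100 * (n - card (seen s))"
  have se: "search x y F (x j) j (found s0) (seen s0) (arr s0 ''ph'') (arr s0 ''pv'') (\<lambda>g. arr s0 ''ps'' g \<noteq> 0) K"
    and inj0: "inj_on (arr s0 ''fq'') {..<reg s0 ''ft''}" and ft0: "0 < reg s0 ''ft''" "arr s0 ''fq'' 0 = j"
    and legs: "\<forall>g\<in>found s0. leg (arr s0 ''ps'' g \<noteq> 0) (arr s0 ''ph'' g) (arr s0 ''pe'' g) (arr s0 ''pv'' g)"
    using s0(2) by (auto simp: searched_iff)
  have vB: "v \<le> Bd" using v(2) C outer_less[of v] Bd by auto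
  have r: "x j \<in> seen s0" and D0F: "found s0 \<subseteq> F" using se by (auto simp: search_def tree_def)
  have hk: "h < k" using queue_bound[OF _ inj0 ft0] D0F h(2) by (auto simp: found_def)
  show ?thesis
    unfolding walk_prog_def
  proof (simp add: v(1) vB, rule wp_While[where Inv = ?I and \<phi> = ?\<phi>], goal_cases)
    case 1
    show ?case using walk_init[OF se v(2)] inj0 by (simp add: walking_def found_def seen_def)
  next
    case (2 s)
    have W: "walking s0 h v s" by fact
    have fx: "fixed s"
      by (rule fixed_agree[OF 2(2)]) (use s0(1) in \<open>simp_all add: fixed_def env_def params_def own_ok_def adj_ok_def\<close>)
    have rg: "reg s ''h'' = h" "reg s ''v'' = v" "reg s ''sd'' = reg s0 ''sd''" "reg s ''ee'' = reg s0 ''ee''"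
      using 2(2) v(1) h(1) by simp_all
    define w where "w = reg s ''w''"
    have wk: "walk x y F C dp (found s0) (seen s0) (found s) (seen s) v w"
      and inj: "inj_on (arr s ''fq'') {..<reg s ''ft''}" and ft: "reg s0 ''ft'' \<le> reg s ''ft''"
      and same: "\<forall>l<reg s0 ''ft''. arr s ''fq'' l = arr s0 ''fq'' l"
      using W by (simp_all add: walking_def w_def)
    have wC: "w \<in> C" "found s \<subseteq> F" "seen s0 \<subseteq> seen s" using wk by (auto simp: walk_def)
    have wn: "w < n" "w \<le> Bd" using wC C outer_less[of w] Bd by auto
    have "arr s ''ins'' w = 0" using 2(3) by (simp add: w_def)
    then have wS: "w \<notin> seen s" "w \<notin> seen s0" using wC by (auto simp: seen_def marked_def)
    note st = walk_step[OF rooted r wk wS(2)]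
    define g where "g = pg w"
    have g: "g \<in> F" "g \<notin> found s" using st(2) by (auto simp: g_def)
    then have gk: "g < k" using F by auto
    have pgw: "arr s ''pg'' w = g" "arr s ''par'' w = par w" using fx by (simp_all add: fixed_def g_def)
    have ft': "0 < reg s ''ft''" "arr s ''fq'' 0 = j" using ft ft0 same by auto
    have ftk: "reg s ''ft'' \<le> k" using queue_bound[OF _ inj ft'] wC(2) by (simp add: found_def)
    have parC: "par w \<in> C" using st(3) by (auto simp: walk_def)
    then have parB: "par w \<le> Bd" using C outer_less[of "par w"] Bd by auto
    have eB: "reg s0 ''ee'' \<le> Bd" "reg s0 ''sd'' \<le> Bd" "h \<le> Bd" "g \<le> Bd" "Suc (reg s ''ft'') \<le> Bd"
      using leg sd hk gk ftk k_le_n Bd by (auto simp: leg_def)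
    have new: "arr s ''fq'' l \<noteq> g" if "l < reg s ''ft''" for l
      using that g(2) ft'(2) j(2) g(1) by (cases "l = 0") (auto simp: found_def)
    define s' where "s' = s\<lparr>arr := (arr s)(''ins'' := (arr s ''ins'')(w := Suc 0), ''ph'' := (arr s ''ph'')(g := h),
      ''ps'' := (arr s ''ps'')(g := reg s0 ''sd''), ''pv'' := (arr s ''pv'')(g := v),
      ''pe'' := (arr s ''pe'')(g := reg s0 ''ee''), ''fq'' := (arr s ''fq'')(reg s ''ft'' := g)),
      reg := (reg s)(''g'' := g, ''ft'' := Suc (reg s ''ft''), ''w'' := par w)\<rparr>"
    have fd: "found s' = insert g (found s)"
      using queue_push[OF ft'(1), of "arr s ''fq''" g] by (simp add: found_def s'_def)
    have sn: "seen s' = insert w (seen s)"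
      using marked_upd[OF wn(1), of "Suc 0"] by (simp add: seen_def s'_def)
    have "inj_on ((arr s ''fq'')(reg s ''ft'' := g)) (insert (reg s ''ft'') {..<reg s ''ft''})"
      using inj new by (auto simp: inj_on_def)
    then have inj': "inj_on (arr s' ''fq'') {..<reg s' ''ft''}"
      by (simp add: s'_def lessThan_Suc)
    have "g \<notin> found s0" using g(2) wk by (auto simp: walk_def)
    then have "walking s0 h v s'"
      using W st(3) inj' ft g same unfolding walking_def fd sn g_def[symmetric]
      by (auto simp: s'_def w_def)
    moreover have "card (seen s') = Suc (card (seen s))"
      using wS(1) finite_marked(1)[of "arr s ''ins''"] by (simp add: sn) (simp add: seen_def)
    moreover have "card (seen s') \<le> n"
      using finite_marked(2)[of "arr s' ''ins''"] by (simp only: seen_def)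
    ultimately show ?case
      using rg wn eB pgw parB vB
      by (simp add: w_def[symmetric] s'_def)
  next
    case (3 T s)
    have W: "walking s0 h v s" by fact
    define w where "w = reg s ''w''"
    have wk: "walk x y F C dp (found s0) (seen s0) (found s) (seen s) v w"
      and inj: "inj_on (arr s ''fq'') {..<reg s ''ft''}" and ft: "reg s0 ''ft'' \<le> reg s ''ft''"
      and same: "\<forall>l<reg s0 ''ft''. arr s ''fq'' l = arr s0 ''fq'' l"
      using W by (simp_all add: walking_def w_def)
    have wC: "w \<in> C" "seen s0 \<subseteq> seen s" "found s0 \<subseteq> found s" using wk by (auto simp: walk_def)
    have wn: "w < n" using wC C outer_less[of w] by auto
    have wS: "w \<in> seen s" using 3(3) wn by (simp add: seen_def marked_def w_def)
    then have wS0: "w \<in> seen s0" using wk by (auto simp: walk_def)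
    have vS: "v \<in> seen s" using W wS by (auto simp: walking_def w_def)
    define K' where "K' = (\<lambda>g. if g \<in> found s - found s0 then found s else K g)"
    have "search x y F (x j) j (found s) (seen s) (arr s ''ph'') (arr s ''pv'') (\<lambda>g. arr s ''ps'' g \<noteq> 0) K'"
      unfolding K'_def
    proof (rule walk_finish[OF se wk wS0 h(2) _ keep])
      show "v \<in> side (reg s0 ''sd'' \<noteq> 0) h" using leg by (rule leg_side)
    qed (use W in \<open>auto simp: walking_def\<close>)
    moreover have "leg (arr s ''ps'' g \<noteq> 0) (arr s ''ph'' g) (arr s ''pe'' g) (arr s ''pv'' g)" if "g \<in> found s" for g
    proof (cases "g \<in> found s0")
      case True
      then show ?thesis using legs W by (auto simp: walking_def)
    next
      case False
      then show ?thesis using that leg W by (auto simp: walking_def)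
    qed
    ultimately have "searched s K'"
      using inj ft ft0 same by (auto simp: searched_iff)
    moreover have "seen (s0\<lparr>reg := (reg s0)(''w'' := v)\<rparr>) = seen s0" by (simp add: seen_def)
    ultimately show ?case
      using 3(4) vS wC(2) ft same by auto
  qed
qed

definition tip :: "bool \<Rightarrow> nat \<Rightarrow> nat" where "tip c i = (if c then p i else q i)"

definition passed :: "nat set \<Rightarrow> nat list \<Rightarrow> bool" where
  "passed S pre \<longleftrightarrow> (\<forall>d\<in>set pre. dst d \<in> outer \<longrightarrow> dst d \<in> S)"

lemma passed_side:
  assumes "passed S (adj (tip c i))"
  shows "side c i \<subseteq> S"
proof
  fix v assume v: "v \<in> side c i"
  then obtain e where "e < m" "ends G e = {tip c i, v}"
    using edges by (auto simp: side_def tip_def A_def B_def split: if_splits)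
  from adj_edge[OF this] obtain d where "d \<in> set (adj (tip c i))" "dst d = v" by auto
  moreover have "v \<in> outer" using v by (auto simp: side_def A_def B_def split: if_splits)
  ultimately show "v \<in> S" using assms by (auto simp: passed_def)
qed

definition hit :: "ram_state \<Rightarrow> bool" where
  "hit s \<longleftrightarrow> reg s ''v'' \<notin> C \<and> leg (reg s ''sd'' \<noteq> 0) (reg s ''h'') (reg s ''ee'') (reg s ''v'') \<and>
     keep x y (reg s ''sd'' \<noteq> 0) (reg s ''h'') \<in> seen s \<and> reg s ''h'' \<in> insert j (found s) \<and> reg s ''sd'' \<le> 1"

definition scanning where
  "scanning S fq fh ft h sd d nx \<longleftrightarrow> 0 < fh \<and> fh \<le> ft \<and> h = fq (fh - 1) \<and> sd \<le> (1 :: nat) \<and>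
     (\<forall>l. Suc l < fh \<longrightarrow> U (fq l) \<subseteq> S) \<and> (sd \<noteq> 0 \<longrightarrow> B h \<subseteq> S) \<and>
     scan nx d (tip (sd \<noteq> 0) h) (passed S)"

definition scanned :: "ram_state \<Rightarrow> bool" where
  "scanned s \<longleftrightarrow> scanning (seen s) (arr s ''fq'') (reg s ''fh'') (reg s ''ft'') (reg s ''h'') (reg s ''sd'')
     (reg s ''d'') (arr s ''nx'')"

text \<open>While side \<open>B\<close> is scanned the kept end is \<open>x h\<close>, which is
  always in the tree. While side \<open>A\<close> is scanned it is \<open>y h\<close>, an element of
  \<open>B h\<close>, and \<open>B h\<close> has been absorbed by then.\<close>

lemma scanned_keep:
  assumes "scanned s" "searched s K"
  shows "reg s ''h'' \<in> insert j (found s)" "keep x y (reg s ''sd'' \<noteq> 0) (reg s ''h'') \<in> seen s"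
proof -
  let ?h = "reg s ''h''"
  have "reg s ''fh'' - 1 < reg s ''ft''" using assms(1) by (auto simp: scanned_def scanning_def)
  then have "?h \<in> arr s ''fq'' ` {..<reg s ''ft''}" using assms(1) by (auto simp: scanned_def scanning_def)
  then show h: "?h \<in> insert j (found s)"
    using queue_image[of "reg s ''ft''" "arr s ''fq''"] assms(2) by (simp add: searched_iff found_def)
  have se: "search x y F (x j) j (found s) (seen s) (arr s ''ph'') (arr s ''pv'') (\<lambda>g. arr s ''ps'' g \<noteq> 0) K"
    using assms(2) by (simp add: searched_iff)
  have "y ?h \<in> B ?h" using h j(4) fits se by (auto simp: fits_def search_def)
  then show "keep x y (reg s ''sd'' \<noteq> 0) ?h \<in> seen s"
    using search_ends(1)[OF se refl h] assms(1) by (auto simp: keep_def scanned_def scanning_def)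
qed

definition rest :: "(nat \<Rightarrow> nat) \<Rightarrow> nat \<Rightarrow> nat" where
  "rest fq fh = (\<Sum>i\<in>{..<k} - fq ` {..<fh}. 100 * dg (p i) + 100 * dg (q i) + 160)"

lemma rest_step:
  assumes inj: "inj_on fq {..<ft}" and fh: "fh < ft" "fq fh < k"
  shows "rest fq fh = 100 * dg (p (fq fh)) + 100 * dg (q (fq fh)) + 160 + rest fq (Suc fh)"
proof -
  define X where "X = {..<k} - fq ` {..<Suc fh}"
  have "fq fh \<notin> fq ` {..<fh}"
  proof
    assume "fq fh \<in> fq ` {..<fh}"
    then obtain l where l: "l < fh" "fq fh = fq l" by auto
    from inj_onD[OF inj l(2)] l(1) fh show False by simp
  qed
  then have "{..<k} - fq ` {..<fh} = insert (fq fh) X"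
    using fh by (auto simp: lessThan_Suc X_def)
  moreover have "fq fh \<notin> X" by (simp add: X_def)
  ultimately show ?thesis by (simp add: rest_def X_def)
qed

lemma rest_bound: "rest fq fh \<le> 400 * m + 160 * k"
proof -
  have "rest fq fh \<le> (\<Sum>i<k. 100 * dg (p i) + 100 * dg (q i) + 160)"
    unfolding rest_def by (intro sum_mono2) auto
  also have "\<dots> = 100 * (\<Sum>i<k. dg (p i)) + 100 * (\<Sum>i<k. dg (q i)) + 160 * k"
    by (simp add: sum.distrib sum_distrib_left)
  finally show ?thesis using sum_dg_slots by simp
qed

lemma scanning_next:
  assumes sc: "scanning S fq fh ft h sd d nx" and S: "S \<subseteq> S'" and ft: "ft \<le> ft'" "\<forall>l<ft. fq' l = fq l"
    and d: "scan nx d' (tip (sd \<noteq> 0) h) (passed S')"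
  shows "scanning S' fq' fh ft' h sd d' nx"
proof -
  have "U (fq' l) \<subseteq> S'" if "Suc l < fh" for l
  proof -
    have "fq' l = fq l" using ft(2) sc that by (simp add: scanning_def)
    then show ?thesis using sc that S by (auto simp: scanning_def)
  qed
  then show ?thesis using assms by (auto simp: scanning_def)
qed

lemma search_correct:
  assumes s0: "fixed s0" and ins: "\<forall>v<n. arr s0 ''ins'' v = 0"
  shows "wp Bd search_prog (\<lambda>t s'. t \<le> 1000 * (n + m) + 300 \<and>
    (reg s' ''fnd'' = 0 \<longrightarrow> (\<exists>W. tight F W \<and> U j \<subseteq> W)) \<and>
    (reg s' ''fnd'' \<noteq> 0 \<longrightarrow> hit s' \<and> (\<exists>K. searched s' K))) s0"
proof -
  have xj: "x j \<in> outer" "x j < n" using j(3) outer_less by (auto simp: A_def)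
  define s1 where "s1 = s0\<lparr>
    arr := (arr s0)(''ins'' := (arr s0 ''ins'')(x j := Suc 0), ''fq'' := (arr s0 ''fq'')(0 := j)),
    reg := (reg s0)(''fh'' := Suc 0, ''ft'' := Suc 0, ''h'' := j, ''sd'' := 0,
      ''d'' := arr s0 ''hd'' (q j), ''fnd'' := 0)\<rparr>"
  let ?I = "\<lambda>s. scanned s \<and> (\<exists>K. searched s K) \<and> (reg s ''fnd'' \<noteq> 0 \<longrightarrow> hit s)"
  \<comment> \<open>The credits pay, in this order, for marking vertices on walks, for the rest of
    the current list, for side \<open>A\<close> of the current element if still to come, and for
    elements not yet taken out. The last 60 pay for the step that sets \<open>fnd\<close>, which
    does not advance \<open>d\<close>.\<close>
  let ?\<phi> = "\<lambda>s. 100 * (n - card (seen s)) + 100 * clen (arr s ''nx'') (reg s ''d'') +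
    (if reg s ''sd'' = 0 then 100 * dg (p (reg s ''h'')) + 60 else 0) + rest (arr s ''fq'') (reg s ''fh'') +
    (if reg s ''fnd'' = 0 then 60 else 0)"
  let ?G = "And (Less (Reg ''fnd'') (N 1))
       (Or (Or (Less (N 0) (Reg ''d'')) (Less (Reg ''sd'') (N 1))) (Less (Reg ''fh'') (Reg ''ft'')))"
  have env0: "env s0" and fx0: "arr s0 ''x'' = x" "reg s0 ''j'' = j" "arr s0 ''q'' = q" "arr s0 ''p'' = p"
    using s0 by (auto simp: fixed_def env_def params_def)
  have fx1: "fixed s1" using s0 by (simp add: s1_def fixed_def env_def params_def own_ok_def adj_ok_def)
  have main: "wp Bd (While ?G search_step) (\<lambda>t s'. t \<le> 1000 * (n + m) + 200 \<and>
    (reg s' ''fnd'' = 0 \<longrightarrow> (\<exists>W. tight F W \<and> U j \<subseteq> W)) \<and>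
    (reg s' ''fnd'' \<noteq> 0 \<longrightarrow> hit s' \<and> (\<exists>K. searched s' K))) s1"
  proof (rule wp_While[where Inv = ?I and \<phi> = ?\<phi>], goal_cases)
    case 1
    have "marked (arr s0 ''ins'') = {}" using ins by (auto simp: marked_def)
    then have "seen s1 = {x j}"
      using marked_upd[OF xj(2), of "Suc 0" "arr s0 ''ins''"] by (simp add: seen_def s1_def)
    moreover have "found s1 = {}" by (simp add: found_def s1_def)
    ultimately have "searched s1 (\<lambda>_. {})"
      using search_init[of j F "\<lambda>_. {}"] j(2) by (simp add: searched_iff) (simp add: s1_def lessThan_Suc)
    moreover have "scanned s1"
      using scan_init[OF env0, of _ "q j"] by (simp add: scanned_def scanning_def s1_def tip_def passed_def)
    ultimately show ?case by (auto simp: s1_def)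
  next
    case (2 s)
    have ag: "agree search_step s1 s" by fact
    have fx: "fixed s"
      by (rule fixed_agree[OF ag _ _ fx1]) (simp_all add: search_step_def walk_prog_def)
    then have env: "env s" and fxs: "arr s ''p'' = p" "arr s ''q'' = q"
      by (simp_all add: fixed_def env_def params_def)
    obtain K where sk: "searched s K" and sc: "scanned s" using 2(1) by blast
    have fnd: "reg s ''fnd'' = 0" using 2(3) by simp
    note hk = scanned_keep[OF sc sk]
    define S fq fh ft h sd d nx where "S = seen s" and "fq = arr s ''fq''" and "fh = reg s ''fh''"
      and "ft = reg s ''ft''" and "h = reg s ''h''" and "sd = reg s ''sd''" and "d = reg s ''d''"
      and "nx = arr s ''nx''"
    note defs = S_def fq_def fh_def ft_def h_def sd_def d_def nx_def
    note folds = defs[symmetric]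
    have SC: "scanning S fq fh ft h sd d nx" using sc by (simp add: scanned_def defs)
    have fh: "0 < fh" "fh \<le> ft" "sd \<le> 1" "h = fq (fh - 1)" and scn: "scan nx d (tip (sd \<noteq> 0) h) (passed S)"
      using SC by (auto simp: scanning_def)
    have se: "search x y F (x j) j (found s) (seen s) (arr s ''ph'') (arr s ''pv'') (\<lambda>g. arr s ''ps'' g \<noteq> 0) K"
      and inj: "inj_on fq {..<ft}" and ft: "0 < ft" "fq 0 = j"
      using sk by (auto simp: searched_iff defs)
    have DF: "found s \<subseteq> F" using se by (simp add: search_def)
    have fnds: "found s = fq ` {1..<ft}" by (simp add: found_def defs)
    have qb: "ft \<le> k" "insert j (found s) \<subseteq> {..<k}"
      using queue_bound[OF _ inj ft] DF by (auto simp: fnds)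
    have qk: "fq l < k" if "l < ft" for l
    proof -
      have "fq l \<in> fq ` {..<ft}" using that by simp
      then show ?thesis using qb(2) unfolding queue_image[OF ft(1), of fq] ft(2) fnds by auto
    qed
    have searched: "\<exists>K. searching fq ft S (arr s ''ph'') (arr s ''pv'') (arr s ''ps'') (arr s ''pe'') K"
      using sk by (auto simp: searched_def defs)
    have seen: "marked (arr s ''ins'') = S" by (simp add: defs seen_def)
    let ?Q = "\<lambda>t s'. ?I s' \<and> t + bcost ?G + 1 + ?\<phi> s' \<le> ?\<phi> s"
    show ?case
    proof (cases "0 < d")
      case True
      obtain pre where R: "passed S pre"
        and nxt: "\<And>R'. R' (pre @ [d]) \<Longrightarrow> scan nx (nx d) (tip (sd \<noteq> 0) h) R'"
        and st: "clen nx d = Suc (clen nx (nx d))"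
          "nx d \<le> 2 * m" "arr s ''de'' d = edge_of d" "arr s ''do'' d = dst d"
          "edge_of d < m" "ends G (edge_of d) = {tip (sd \<noteq> 0) h, dst d}" "dst d < n"
        by (rule scan_step[OF env scn[unfolded nx_def] True, folded nx_def]) (rule that; assumption)
      have B: "dst d \<le> Bd" "edge_of d \<le> Bd" "nx d \<le> Bd" "Suc 0 \<le> Bd" using st Bd by auto
      have ow: "arr s ''own'' (dst d) = 0 \<longleftrightarrow> dst d \<in> outer" by (rule own_zero[OF env st(7)])
      have vis: "arr s ''vis'' (dst d) = 0 \<longleftrightarrow> dst d \<notin> C"
      proof -
        have "C = marked (arr s ''vis'')" using fx by (simp add: fixed_def)
        then show ?thesis using st(7) by (simp only: marked_def mem_Collect_eq) simp
      qed
      have leg: "leg (sd \<noteq> 0) h (edge_of d) (dst d)" if "dst d \<in> outer"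
        using that st by (simp add: leg_def tip_def)
      \<comment> \<open>An inner neighbour is the other vertex of the element and is skipped. An
        outer one outside \<open>C\<close> ends the search; one inside \<open>C\<close> starts a
        walk, which is empty if that vertex is marked.\<close>
      consider (inner) "dst d \<notin> outer" | (fresh) "dst d \<in> outer" "dst d \<notin> C" | (walk) "dst d \<in> outer" "dst d \<in> C"
        by blast
      then show ?thesis
      proof cases
        case inner
        have sc2: "scan nx (nx d) (tip (sd \<noteq> 0) h) (passed S)"
          using R inner by (intro nxt) (auto simp: passed_def)
        have SC': "scanning S fq fh ft h sd (nx d) nx"
          by (rule scanning_next[OF SC order_refl order_refl _ sc2]) simp
        show ?thesis
          using SC' searched True inner ow st fnd B
          by (simp add: search_step_def scanned_def searched_def seen_def seen folds)
      next
        case fresh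
        have "hit (s\<lparr>reg := (reg s)(''v'' := dst d, ''ee'' := edge_of d, ''fnd'' := Suc 0)\<rparr>)"
          using fresh leg hk fh(3) by (simp add: hit_def found_def seen_def defs)
        then show ?thesis
          using SC searched True fresh ow vis st fnd B
          by (simp add: search_step_def scanned_def searched_def seen_def seen folds)
      next
        case walk
        define s2 where "s2 = s\<lparr>reg := (reg s)(''v'' := dst d, ''ee'' := edge_of d)\<rparr>"
        have eqs: "found s2 = found s" "seen s2 = S" "reg s2 ''sd'' = sd" "reg s2 ''ee'' = edge_of d"
          "reg s2 ''v'' = dst d" "reg s2 ''h'' = h" "reg s2 ''ft'' = ft" "arr s2 = arr s"
          "reg s2 ''fh'' = fh" "reg s2 ''d'' = d" "reg s2 ''fnd'' = 0"
          using fnd by (simp_all add: s2_def found_def seen_def defs)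
        define Q where "Q = ?Q"
        define P where "P t s' \<longleftrightarrow> t + 100 * (n - card (seen s')) \<le> 100 * (n - card S) + 20 \<and>
          (\<exists>K'. searched s' K') \<and> dst d \<in> seen s' \<and> S \<subseteq> seen s' \<and> ft \<le> reg s' ''ft'' \<and>
          (\<forall>l<ft. arr s' ''fq'' l = fq l)" for t s'
        have wlk: "wp Bd walk_prog P s2"
        proof (rule wp_conseq[OF walk_correct[where ?s0.0 = s2 and K = K and v = "dst d" and h = h]], goal_cases)
          case 1
          show ?case using fx by (simp add: s2_def fixed_def env_def params_def own_ok_def adj_ok_def)
        next
          case 2
          show ?case using sk by (simp add: searched_def eqs) (simp add: defs)
        next
          case (10 t s')
          then show ?case unfolding P_def eqs fq_def[symmetric] by blast
        qed (use walk leg hk fh(3) eqs in \<open>simp_all add: defs\<close>)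
        have QM: "Q t' (s'\<lparr>reg := (reg s')(''d'' := nx d)\<rparr>)"
          if ag': "agree walk_prog s2 s'" and P: "P t s'" and t': "t' \<le> t + 40" for t t' s'
        proof -
          have k: "reg s' ''d'' = d" "reg s' ''h'' = h" "reg s' ''sd'' = sd" "reg s' ''fh'' = fh"
            "reg s' ''fnd'' = 0" "arr s' ''nx'' = nx"
            using ag' eqs by (simp_all add: walk_prog_def defs)
          have w: "t + 100 * (n - card (seen s')) \<le> 100 * (n - card S) + 20"
            "\<exists>K'. searched s' K'" "dst d \<in> seen s'" "S \<subseteq> seen s'" "ft \<le> reg s' ''ft''"
            "\<forall>l<ft. arr s' ''fq'' l = fq l"
            using P unfolding P_def by blast+
          have sc2: "scan nx (nx d) (tip (sd \<noteq> 0) h) (passed (seen s'))"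
            using R w(3,4) by (intro nxt) (auto simp: passed_def)
          have SC': "scanning (seen s') (arr s' ''fq'') fh (reg s' ''ft'') h sd (nx d) nx"
            by (rule scanning_next[OF SC w(4-6) sc2])
          have "arr s' ''fq'' ` {..<fh} = fq ` {..<fh}" using w(6) fh(2) by (intro image_cong) auto
          then have "rest (arr s' ''fq'') fh = rest fq fh" by (simp add: rest_def)
          then show ?thesis
            using SC' w(1,2) st(1) B fnd t'
            by (simp add: Q_def k scanned_def searched_def seen_def folds seen)
        qed
        \<comment> \<open>3 is the cost of the assignment to \<open>d\<close> that follows the
          walk.\<close>
        have fin: "wp Bd (Set_Reg ''d'' (Arr ''nx'' (Reg ''d''))) (\<lambda>u. Q (f u)) s'"
          if ag': "agree walk_prog s2 s'" and P: "P t s'" and f: "f 3 \<le> t + 40" for t f s'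
        proof -
          have "reg s' ''d'' = d" "arr s' ''nx'' = nx" using ag' eqs by (simp_all add: walk_prog_def defs)
          moreover have "Q (f (Suc (Suc (Suc 0)))) (s'\<lparr>reg := (reg s')(''d'' := nx d)\<rparr>)"
            using QM[OF ag' P f] by (simp add: numeral_3_eq_3)
          ultimately show ?thesis using B by simp
        qed
        have "wp Bd search_step Q s"
          using True walk ow vis st B
          by (simp add: search_step_def folds s2_def[symmetric] eqs) (rule wp_conseq[OF wlk], rule fin, assumption, assumption, simp)
        then show ?thesis by (simp only: Q_def)
      qed
    next
      case False
      then have d: "d = 0" by simp
      then have ps: "passed S (adj (tip (sd \<noteq> 0) h))"
        using scn scan_end by auto
      note side = passed_side[OF ps]
      show ?thesis
      proof (cases "sd = 0")
        case True
        have "scan nx (arr s ''hd'' (p h)) (p h) (passed S)"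
          using scan_init[OF env] by (simp add: passed_def defs)
        then have SC': "scanning S fq fh ft h (Suc 0) (arr s ''hd'' (p h)) nx"
          using SC side True by (simp add: scanning_def tip_def side_def)
        show ?thesis
          using SC' searched d True fnd Bd env_hd(2,3)[OF env, of "p h"] fxs
          by (simp add: search_step_def scanned_def searched_def seen_def folds seen)
      next
        case sd: False
        then have lt: "fh < ft" using 2(3) d by (simp add: folds)
        define h' where "h' = fq fh"
        have U: "U (fq l) \<subseteq> S" if "l < fh" for l
        proof (cases "Suc l < fh")
          case True
          then show ?thesis using SC by (simp add: scanning_def)
        next
          case False
          then have "l = fh - 1" using that by simp
          then have "fq l = h" using fh(4) by simp
          then show ?thesis using side sd SC by (auto simp: U_def side_def scanning_def)
        qed
        have "scan nx (arr s ''hd'' (q h')) (q h') (passed S)"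
          using scan_init[OF env] by (simp add: passed_def defs)
        then have SC': "scanning S fq (Suc fh) ft h' 0 (arr s ''hd'' (q h')) nx"
          using U lt by (simp add: scanning_def tip_def h'_def)
        have h': "h' < k" using qk[OF lt] by (simp add: h'_def)
        have "Suc fh \<le> Bd" "h' \<le> Bd" using lt qb(1) h' k_le_n Bd by auto
        then show ?thesis
          using SC' searched d sd fnd Bd env_hd(2,3)[OF env, of "q h'"] fxs lt
            rest_step[OF inj lt] h'
          by (simp add: search_step_def scanned_def searched_def seen_def folds seen h'_def[symmetric])
      qed
    qed
  next
    case (3 T s)
    obtain K where sk: "searched s K" and sc: "scanned s" using 3(1) by blast
    have "(if reg s1 ''sd'' = 0 then 100 * dg (p (reg s1 ''h'')) + 60 else 0) = 100 * dg (p j) + 60"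
      "clen (arr s1 ''nx'') (reg s1 ''d'') = dg (q j)" "reg s1 ''fnd'' = 0"
      using env_hd(2)[OF env0, of "q j"] by (simp_all add: s1_def)
    then have "T \<le> 1000 * (n + m) + 200"
      using 3(4) rest_bound[of "arr s1 ''fq''" "reg s1 ''fh''"] dg_le[of "p j"] dg_le[of "q j"] k_le_n
      by (simp split: if_splits)
    moreover have "\<exists>W. tight F W \<and> U j \<subseteq> W" if fnd: "reg s ''fnd'' = 0"
    proof -
      let ?S = "seen s" and ?fq = "arr s ''fq''"
      have ex: "reg s ''d'' = 0" "reg s ''sd'' \<noteq> 0" "reg s ''ft'' \<le> reg s ''fh''" using 3(3) fnd by auto
      have fh: "0 < reg s ''fh''" "reg s ''fh'' \<le> reg s ''ft''" "reg s ''h'' = ?fq (reg s ''fh'' - 1)"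
        "\<forall>l. Suc l < reg s ''fh'' \<longrightarrow> U (?fq l) \<subseteq> ?S" "B (reg s ''h'') \<subseteq> ?S"
        and ps: "passed ?S (adj (tip True (reg s ''h'')))"
        using sc ex scan_end by (auto simp: scanned_def scanning_def)
      have side: "A (reg s ''h'') \<subseteq> ?S" using passed_side[OF ps] by (simp add: side_def)
      have U: "U (?fq l) \<subseteq> ?S" if "l < reg s ''ft''" for l
      proof (cases "Suc l < reg s ''fh''")
        case True
        then show ?thesis using fh(4) by simp
      next
        case False
        then have "l = reg s ''fh'' - 1" using that ex fh by simp
        then have "?fq l = reg s ''h''" using fh(3) by simp
        then show ?thesis using side fh(5) by (auto simp: U_def)
      qed
      have se: "search x y F (x j) j (found s) ?S (arr s ''ph'') (arr s ''pv'') (\<lambda>g. arr s ''ps'' g \<noteq> 0) K"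
        and ft: "0 < reg s ''ft''" "?fq 0 = j"
        using sk by (auto simp: searched_iff)
      have "U h \<subseteq> ?S" if h: "h \<in> insert j (found s)" for h
      proof -
        have "h \<in> ?fq ` {..<reg s ''ft''}"
          using h queue_image[OF ft(1), of ?fq] ft(2) by (simp add: found_def)
        then obtain l where "l < reg s ''ft''" "h = ?fq l" by auto
        then show ?thesis using U by simp
      qed
      moreover have "finite F" using F by (rule finite_subset) simp
      ultimately show ?thesis using search_tight[OF se fits] by blast
    qed
    ultimately show ?case using 3(1) by simp
  qed
  have "x j \<le> Bd" "j \<le> Bd" "Suc 0 \<le> Bd" "arr s0 ''hd'' (q j) \<le> Bd"
    using xj(2) j(1) k_le_n Bd env_hd(3)[OF env0, of "q j"] by auto
  then show ?thesis
    unfolding search_prog_def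
    by (simp add: fx0) (rule wp_conseq[OF main[unfolded s1_def One_nat_def]], auto)
qed

end

section \<open>The complete program\<close>

definition half_prog :: com where
  "half_prog = If (Less (N 0) (Reg ''sd''))
     (Set_Arr ''x'' (Reg ''h'') (Reg ''v'');; Set_Arr ''ea'' (Reg ''h'') (Reg ''ee''))
     (Set_Arr ''y'' (Reg ''h'') (Reg ''v'');; Set_Arr ''eb'' (Reg ''h'') (Reg ''ee''))"

text \<open>\<open>sd\<close> is recovered by a test and not by copying, so no bound on the stored
  value has to be carried along.\<close>

definition back_prog :: com where
  "back_prog = Set_Reg ''g'' (Reg ''h'');;
   Set_Reg ''h'' (Arr ''ph'' (Reg ''g''));;
   If (Less (N 0) (Arr ''ps'' (Reg ''g''))) (Set_Reg ''sd'' (N 1)) (Set_Reg ''sd'' (N 0));;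
   Set_Reg ''v'' (Arr ''pv'' (Reg ''g''));;
   Set_Reg ''ee'' (Arr ''pe'' (Reg ''g''))"

definition aug_prog :: com where
  "aug_prog = While (Not (Eq (Reg ''h'') (Reg ''j''))) (half_prog;; back_prog);;
   half_prog;; Set_Arr ''inn'' (Reg ''j'') (N 1)"

definition round_prog :: com where
  "round_prog = clear_prog;; first_prog;; second_prog;; bfs_prog;; search_prog;;
   If (Less (N 0) (Reg ''fnd'')) aug_prog Skip"

definition main_prog :: com where
  "main_prog = While (Less (Reg ''j'') (Reg ''k'')) (round_prog;; incr ''j'')"

lemmas prog_defs = clear_prog_def first_prog_def second_prog_def bfs_prog_def bfs_step_def sel_prog_def
  visit_prog_def walk_prog_def search_prog_def search_step_def half_prog_def back_prog_def aug_prog_def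

lemma half_correct:
  assumes "reg s ''v'' \<le> B" "reg s ''ee'' \<le> B"
  shows "wp B half_prog (\<lambda>t s'. t \<le> 12 \<and> reg s' = reg s \<and>
    arr s' ''x'' = slots.move (reg s ''sd'' \<noteq> 0) (reg s ''h'') (reg s ''v'') (arr s ''x'') \<and>
    arr s' ''y'' = slots.move (\<not> reg s ''sd'' \<noteq> 0) (reg s ''h'') (reg s ''v'') (arr s ''y'') \<and>
    arr s' ''ea'' = slots.move (reg s ''sd'' \<noteq> 0) (reg s ''h'') (reg s ''ee'') (arr s ''ea'') \<and>
    arr s' ''eb'' = slots.move (\<not> reg s ''sd'' \<noteq> 0) (reg s ''h'') (reg s ''ee'') (arr s ''eb'')) s"
  using assms by (simp add: half_prog_def slots.move_def)

lemma back_correct: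
  assumes "reg s ''h'' = h" "h \<le> B" "arr s ''ph'' h \<le> B" "arr s ''pv'' h \<le> B" "arr s ''pe'' h \<le> B" "1 \<le> B"
  shows "wp B back_prog (\<lambda>t s'. t \<le> 30 \<and> reg s' ''h'' = arr s ''ph'' h \<and>
    (reg s' ''sd'' \<noteq> 0 \<longleftrightarrow> arr s ''ps'' h \<noteq> 0) \<and> reg s' ''v'' = arr s ''pv'' h \<and>
    reg s' ''ee'' = arr s ''pe'' h) s"
  using assms by (simp add: back_prog_def)

context ear_ram
begin

definition legs where
  "legs J x y ea eb \<longleftrightarrow> (\<forall>g\<in>J. leg True g (ea g) (x g) \<and> leg False g (eb g) (y g))"

lemma legs_move:
  "legs J x' y' ea eb \<Longrightarrow> leg c g e v \<Longrightarrow>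
    legs J (move c g v x') (move (\<not> c) g v y') (move c g e ea) (move (\<not> c) g e eb)"
  by (cases c) (auto simp: legs_def move_def)

end

context ear_search
begin

lemma aug_correct:
  assumes fx: "fixed s0" and se: "searched s0 K" and hit: "hit s0" and acc: "accepted s0 = F"
    and lg: "legs (insert j F) x y (arr s0 ''ea'') (arr s0 ''eb'')"
  shows "wp Bd aug_prog (\<lambda>t s'. t \<le> 100 * n + 50 \<and> accepted s' = insert j F \<and>
    fits (arr s' ''x'') (arr s' ''y'') (insert j F) \<and>
    legs (insert j F) (arr s' ''x'') (arr s' ''y'') (arr s' ''ea'') (arr s' ''eb'')) s0"
proof -
  let ?D = "found s0"
  let ?ps = "\<lambda>g. arr s0 ''ps'' g \<noteq> 0"
  have sr: "search x y F (x j) j ?D (seen s0) (arr s0 ''ph'') (arr s0 ''pv'') ?ps K"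
    and dl: "\<forall>g\<in>?D. leg (?ps g) (arr s0 ''ph'' g) (arr s0 ''pe'' g) (arr s0 ''pv'' g)"
    using se by (auto simp: searched_iff)
  have D: "?D \<subseteq> F" "finite ?D" "K j = {}" using sr by (auto simp: search_def tree_def)
  have jF: "insert j F \<subseteq> {..<k}" using F j by auto
  define pend where "pend s \<longleftrightarrow> pending x y F j ?D K (arr s ''x'') (arr s ''y'') (reg s ''h'') (reg s ''v'') (reg s ''sd'' \<noteq> 0)
      \<and> leg (reg s ''sd'' \<noteq> 0) (reg s ''h'') (reg s ''ee'') (reg s ''v'')
      \<and> legs (insert j F) (arr s ''x'') (arr s ''y'') (arr s ''ea'') (arr s ''eb'')" for s :: ram_state
  \<comment> \<open>\<open>K\<close> shrinks strictly with every move, so its cardinality bounds the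
    number of moves.\<close>
  let ?\<phi> = "\<lambda>s. 80 * card (K (reg s ''h''))"
  let ?G = "Not (Eq (Reg ''h'') (Reg ''j''))"
  have Kcard: "K g \<subseteq> ?D" if "g \<in> insert j ?D" for g
    using sr D that by (auto simp: search_def)
  have init: "pend s0"
  proof -
    have "pending x y F j ?D K x y (reg s0 ''h'') (reg s0 ''v'') (reg s0 ''sd'' \<noteq> 0)"
    proof (rule pending_init[OF fits sr])
      show "(reg s0 ''v'', x j) \<notin> link x y F"
        using hit by (intro rooted_not_link[OF rooted]) (simp add: hit_def)
    qed (use hit leg_side in \<open>auto simp: hit_def\<close>)
    then show ?thesis using hit lg fx by (simp add: pend_def hit_def fixed_def)
  qed
  have main: "wp Bd (While ?G (half_prog;; back_prog)) (\<lambda>t s'. t \<le> 100 * n + 20 \<and> pend s' \<and>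
      reg s' ''h'' = j \<and> reg s' ''j'' = j \<and> arr s' ''inn'' = arr s0 ''inn'') s0"
  proof (rule wp_While[where Inv = pend and \<phi> = ?\<phi>], goal_cases)
    case 1
    show ?case by (rule init)
  next
    case (2 s)
    define h b v where "h = reg s ''h''" and "b = (reg s ''sd'' \<noteq> 0)" and "v = reg s ''v''"
    have keepa: "arr s ''ph'' = arr s0 ''ph''" "arr s ''pv'' = arr s0 ''pv''" "arr s ''ps'' = arr s0 ''ps''"
      "arr s ''pe'' = arr s0 ''pe''" "reg s ''j'' = j"
      using 2(2) fx by (simp_all add: prog_defs fixed_def)
    have pe: "pending x y F j ?D K (arr s ''x'') (arr s ''y'') h v b" and le: "leg b h (reg s ''ee'') v"
      and lgs: "legs (insert j F) (arr s ''x'') (arr s ''y'') (arr s ''ea'') (arr s ''eb'')"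
      using 2(1) by (simp_all add: pend_def h_def b_def v_def)
    have hj: "h \<noteq> j" using 2(3) unfolding h_def keepa(5)[symmetric] by (simp add: nat_neq_iff)
    note st = pending_step[OF sr pe hj]
    have hD: "h \<in> ?D" using pe hj by (auto simp: pending_def)
    have dl': "leg (?ps h) (arr s0 ''ph'' h) (arr s0 ''pe'' h) (arr s0 ''pv'' h)" using dl hD by blast
    have "arr s0 ''ph'' h \<in> insert j ?D" using st(1) by (auto simp: pending_def)
    then have phk: "arr s0 ''ph'' h < k" "h < k" using D jF hD by auto
    have vB: "reg s ''v'' \<le> Bd" "reg s ''ee'' \<le> Bd"
      using le outer_less[of v] Bd by (auto simp: leg_def v_def)
    have B: "h \<le> Bd" "arr s0 ''ph'' h \<le> Bd" "arr s0 ''pv'' h \<le> Bd" "arr s0 ''pe'' h \<le> Bd" "1 \<le> Bd"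
      using dl' outer_less[of "arr s0 ''pv'' h"] phk k_le_n Bd by (auto simp: leg_def)
    have "card (K (arr s0 ''ph'' h)) < card (K h)"
      using st(2) finite_subset[OF Kcard[of h] D(2)] hD by (intro psubset_card_mono) auto
    then have cK: "80 * card (K (arr s0 ''ph'' h)) + 80 \<le> 80 * card (K h)" by simp
    show ?case
      unfolding wp_Seq
    proof (rule wp_conseq[OF half_correct[OF vB]], goal_cases)
      case (1 t s')
      have a': "agree half_prog s s'" by fact
      have r': "reg s' = reg s" and t: "t \<le> 12"
        and xs: "arr s' ''x'' = move b h v (arr s ''x'')" "arr s' ''y'' = move (\<not> b) h v (arr s ''y'')"
          "arr s' ''ea'' = move b h (reg s ''ee'') (arr s ''ea'')" "arr s' ''eb'' = move (\<not> b) h (reg s ''ee'') (arr s ''eb'')"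
        using 1(2) by (simp_all add: b_def h_def v_def)
      have k': "arr s' ''ph'' = arr s0 ''ph''" "arr s' ''pv'' = arr s0 ''pv''" "arr s' ''ps'' = arr s0 ''ps''"
        "arr s' ''pe'' = arr s0 ''pe''"
        using a' keepa by (simp_all add: prog_defs)
      have hs: "reg s' ''h'' = h" using r' by (simp add: h_def)
      show ?case
      proof (rule wp_conseq[OF back_correct[OF hs]], goal_cases)
        case (6 u s'')
        have a'': "agree back_prog s' s''" by fact
        have arr: "arr s'' z = arr s' z" for z using a'' by (simp add: prog_defs)
        have "pend s''"
          using st(1) dl' legs_move[OF lgs le] 6(2) unfolding pend_def arr xs k' by simp
        then show ?case using 6(2) t cK by (simp add: k' h_def)
      qed (use B k' in simp_all)
    qed
  next
    case (3 T s)
    have "reg s ''h'' = j" "reg s ''j'' = j" "arr s ''inn'' = arr s0 ''inn''"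
      using 3(2,3) fx by (auto simp: prog_defs fixed_def)
    moreover have "card (K (reg s0 ''h'')) \<le> n"
    proof -
      have "K (reg s0 ''h'') \<subseteq> {..<k}" using Kcard[of "reg s0 ''h''"] hit D F by (auto simp: hit_def)
      then have "card (K (reg s0 ''h'')) \<le> k" using card_mono[of "{..<k}"] by auto
      then show ?thesis using k_le_n by simp
    qed
    ultimately show ?case using 3(1,4) by simp
  qed
  show ?thesis
    unfolding aug_prog_def wp_Seq
  proof (rule wp_conseq[OF main], goal_cases)
    case (1 t s)
    have pe: "pending x y F j ?D K (arr s ''x'') (arr s ''y'') j (reg s ''v'') (reg s ''sd'' \<noteq> 0)"
      and le: "leg (reg s ''sd'' \<noteq> 0) j (reg s ''ee'') (reg s ''v'')"
      and lgs: "legs (insert j F) (arr s ''x'') (arr s ''y'') (arr s ''ea'') (arr s ''eb'')"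
      and hs: "reg s ''h'' = j" "reg s ''j'' = j" "arr s ''inn'' = arr s0 ''inn''" "t \<le> 100 * n + 20"
      using 1(2) by (auto simp: pend_def)
    have vB: "reg s ''v'' \<le> Bd" "reg s ''ee'' \<le> Bd" "Suc 0 \<le> Bd"
      using le outer_less[of "reg s ''v''"] Bd by (auto simp: leg_def)
    show ?case
    proof (rule wp_conseq[OF half_correct[OF vB(1,2)]], goal_cases)
      case (1 u s')
      have i: "arr s' ''inn'' = arr s0 ''inn''" using 1(1) hs by (simp add: prog_defs)
      have acc': "{i. i < k \<and> ((arr s0 ''inn'')(j := Suc 0)) i \<noteq> 0} = insert j F"
        using acc j(1) by (auto simp: accepted_def)
      have "fits (move (reg s ''sd'' \<noteq> 0) j (reg s ''v'') (arr s ''x''))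
        (move (\<not> reg s ''sd'' \<noteq> 0) j (reg s ''v'') (arr s ''y'')) (insert j F)"
        by (rule pending_finish[OF pe j(2-4)])
      then show ?case
        using 1(2) hs i vB acc' legs_move[OF lgs le] by (simp add: accepted_def)
    qed
  qed
qed

end

lemma wp_obtain:
  assumes "wp B c Q s"
  obtains t s' where "exec B c s t s'" "agree c s s'" "Q t s'"
  using assms exec_agree unfolding wp_def by blast

section \<open>Output, main loop and total time\<close>

definition out_prog :: com where
  "out_prog = Set_Reg ''i'' (N 0);;
   While (Less (Reg ''i'') (Reg ''k''))
     (If (Less (N 0) (Arr ''inn'' (Reg ''i'')))
        (Set_Arr ''v0'' (Reg ''count'') (Arr ''x'' (Reg ''i''));;
         Set_Arr ''v1'' (Reg ''count'') (Arr ''p'' (Reg ''i''));;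
         Set_Arr ''e0'' (Reg ''count'') (Arr ''ea'' (Reg ''i''));;
         If (Eq (Arr ''p'' (Reg ''i'')) (Arr ''q'' (Reg ''i'')))
           (Set_Arr ''len'' (Reg ''count'') (N 2);;
            Set_Arr ''v2'' (Reg ''count'') (Arr ''y'' (Reg ''i''));;
            Set_Arr ''e1'' (Reg ''count'') (Arr ''eb'' (Reg ''i'')))
           (Set_Arr ''len'' (Reg ''count'') (N 3);;
            Set_Arr ''v2'' (Reg ''count'') (Arr ''q'' (Reg ''i''));;
            Set_Arr ''v3'' (Reg ''count'') (Arr ''y'' (Reg ''i''));;
            Set_Arr ''e1'' (Reg ''count'') (Arr ''em'' (Reg ''i''));;
            Set_Arr ''e2'' (Reg ''count'') (Arr ''eb'' (Reg ''i'')));;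
         incr ''count'')
        Skip;;
      incr ''i'')"

definition ear_prog :: com where
  "ear_prog = own_prog;; adj_prog;; main_prog;; out_prog"

definition row :: "ram_state \<Rightarrow> nat \<Rightarrow> nat list \<times> nat list" where
  "row s l = (take (Suc (arr s ''len'' l)) (map (\<lambda>x. arr s x l) [''v0'', ''v1'', ''v2'', ''v3'']),
     take (arr s ''len'' l) (map (\<lambda>x. arr s x l) [''e0'', ''e1'', ''e2'']))"

lemma output_paths_row: "output_paths s = map (row s) [0..<reg s ''count'']"
  by (simp add: output_paths_def row_def)

context ear_ram
begin

text \<open>The invariant of the main loop. At \<open>j = k\<close> it contains the hypotheses of
  \<open>mu_eq\<close>, the tight sets being the certificates of rejection.\<close>

definition good :: "nat \<Rightarrow> ram_state \<Rightarrow> bool" where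
  "good j s \<longleftrightarrow> env s \<and> accepted s \<subseteq> {..<j} \<and> fits (arr s ''x'') (arr s ''y'') (accepted s) \<and>
     legs (accepted s) (arr s ''x'') (arr s ''y'') (arr s ''ea'') (arr s ''eb'') \<and>
     (\<forall>i\<in>accepted s. p i \<noteq> q i \<longrightarrow> mid i (arr s ''em'' i)) \<and>
     (\<forall>i<j. i \<notin> accepted s \<longrightarrow> (\<exists>W. tight (accepted s) W \<and> U i \<subseteq> W))"

lemma round_correct:
  assumes good: "good j s0" and j: "reg s0 ''j'' = j" "j < k"
  shows "wp Bd round_prog (\<lambda>t s'. t \<le> 2000 * (n + m) + 1000 \<and> good (Suc j) s') s0"
proof -
  define F where "F = accepted s0"
  have g: "env s0" "F \<subseteq> {..<j}" "fits (arr s0 ''x'') (arr s0 ''y'') F"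
    "legs F (arr s0 ''x'') (arr s0 ''y'') (arr s0 ''ea'') (arr s0 ''eb'')"
    "\<forall>i\<in>F. p i \<noteq> q i \<longrightarrow> mid i (arr s0 ''em'' i)"
    "\<forall>i<j. i \<notin> F \<longrightarrow> (\<exists>W. tight F W \<and> U i \<subseteq> W)"
    using good unfolding good_def F_def by blast+
  have jF: "j \<notin> F" "F \<subseteq> {..<k}" "finite F" using g(2) j(2) by (auto intro: finite_subset)
  have "params s0" using g(1) by (simp add: env_def)
  from clear_correct[OF this] obtain t1 s1 where e1: "exec Bd clear_prog s0 t1 s1" and a1: "agree clear_prog s0 s1"
    and c1: "t1 \<le> 30 * n + 10 \<and> (\<forall>v<n. arr s1 ''vis'' v = 0 \<and> arr s1 ''ins'' v = 0)"
    by (rule wp_obtain)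
  have env1: "env s1" by (rule env_agree[OF a1 _ _ g(1)]) (simp_all add: prog_defs)
  have j1: "reg s1 ''j'' = j" using a1 j by (simp add: prog_defs)
  have k1: "arr s1 z = arr s0 z" if "z \<in> {''x'', ''y'', ''ea'', ''eb'', ''em'', ''inn''}" for z
    using a1 that by (auto simp: prog_defs)
  from first_correct[OF env1 j1 j(2)] obtain t2 s2 where e2: "exec Bd first_prog s1 t2 s2" and a2: "agree first_prog s1 s2"
    and c2: "t2 \<le> 60 * dg (p j) + 40 \<and> leg True j (arr s2 ''ea'' j) (arr s2 ''x'' j) \<and>
      (p j \<noteq> q j \<longrightarrow> mid j (arr s2 ''em'' j)) \<and>
      (\<forall>i. i \<noteq> j \<longrightarrow> arr s2 ''x'' i = arr s1 ''x'' i \<and> arr s2 ''ea'' i = arr s1 ''ea'' i \<and>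
        arr s2 ''em'' i = arr s1 ''em'' i)"
    by (rule wp_obtain)
  have env2: "env s2" by (rule env_agree[OF a2 _ _ env1]) (simp_all add: prog_defs)
  have j2: "reg s2 ''j'' = j" using a2 j1 by (simp add: prog_defs)
  have k2: "arr s2 z = arr s1 z" if "z \<in> {''y'', ''eb'', ''inn'', ''vis'', ''ins''}" for z
    using a2 that by (auto simp: prog_defs)
  from second_correct[OF env2 j2 j(2)] obtain t3 s3 where e3: "exec Bd second_prog s2 t3 s3" and a3: "agree second_prog s2 s3"
    and c3: "t3 \<le> 60 * dg (q j) + 40 \<and> leg False j (arr s3 ''eb'' j) (arr s3 ''y'' j) \<and>
      (\<forall>i. i \<noteq> j \<longrightarrow> arr s3 ''y'' i = arr s2 ''y'' i \<and> arr s3 ''eb'' i = arr s2 ''eb'' i)"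
    by (rule wp_obtain)
  have env3: "env s3" by (rule env_agree[OF a3 _ _ env2]) (simp_all add: prog_defs)
  have j3: "reg s3 ''j'' = j" using a3 j2 by (simp add: prog_defs)
  have k3: "arr s3 z = arr s2 z" if "z \<in> {''x'', ''ea'', ''em'', ''inn'', ''vis'', ''ins''}" for z
    using a3 that by (auto simp: prog_defs)
  define x y ea eb em where "x = arr s3 ''x''" and "y = arr s3 ''y''" and "ea = arr s3 ''ea''"
    and "eb = arr s3 ''eb''" and "em = arr s3 ''em''"
  \<comment> \<open>Choosing provisional ends for \<open>j\<close> touches only position
    \<open>j\<close>, which is not in \<open>F\<close>, so the current forest is unchanged.\<close>
  have old: "x i = arr s0 ''x'' i" "y i = arr s0 ''y'' i" "ea i = arr s0 ''ea'' i" "eb i = arr s0 ''eb'' i"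
    "em i = arr s0 ''em'' i" if "i \<in> F" for i
  proof -
    have "i \<noteq> j" using that jF by auto
    then show "x i = arr s0 ''x'' i" "y i = arr s0 ''y'' i" "ea i = arr s0 ''ea'' i" "eb i = arr s0 ''eb'' i"
      "em i = arr s0 ''em'' i"
      using c2 c3 k1 k2 k3 by (simp_all add: x_def y_def ea_def eb_def em_def)
  qed
  have "acyc x y F = acyc (arr s0 ''x'') (arr s0 ''y'') F" by (rule acyc_cong) (use old in auto)
  then have fits: "fits x y F" using g(3) old by (simp add: fits_def)
  have lj: "leg True j (ea j) (x j)" "leg False j (eb j) (y j)" "p j \<noteq> q j \<longrightarrow> mid j (em j)"
    using c2 c3 k3 by (simp_all add: x_def y_def ea_def eb_def em_def)
  have lg: "legs (insert j F) x y ea eb" using g(4) old lj(1,2) by (simp add: legs_def)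
  have md: "\<forall>i\<in>insert j F. p i \<noteq> q i \<longrightarrow> mid i (em i)" using g(5) old lj(3) by simp
  have xA: "x j \<in> A j" "y j \<in> B j" using leg_side[OF lj(1)] leg_side[OF lj(2)] by (simp_all add: side_def)
  then have xo: "x j \<in> outer" by (simp add: A_def)
  have "accepted s3 = F" using k1 k2 k3 by (simp add: accepted_def F_def)
  moreover have "\<forall>v<n. arr s3 ''vis'' v = 0" using c1 k2 k3 by simp
  ultimately obtain t4 s4 where e4: "exec Bd bfs_prog s3 t4 s4" and a4: "agree bfs_prog s3 s4"
    and c4: "t4 \<le> 300 * (n + m) + 100 \<and> marked (arr s4 ''vis'') \<subseteq> outer \<and>
      (\<exists>dp. rooted x y F (x j) (marked (arr s4 ''vis'')) (arr s4 ''par'') (arr s4 ''pg'') dp)"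
    using wp_obtain[OF bfs_correct[OF env3 j3 x_def y_def _ fits xo]] by metis
  then obtain dp where rt: "rooted x y F (x j) (marked (arr s4 ''vis'')) (arr s4 ''par'') (arr s4 ''pg'') dp"
    by blast
  have env4: "env s4" by (rule env_agree[OF a4 _ _ env3]) (simp_all add: prog_defs)
  have j4: "reg s4 ''j'' = j" using a4 j3 by (simp add: prog_defs)
  have k4: "arr s4 z = arr s3 z" if "z \<in> {''x'', ''y'', ''ea'', ''eb'', ''em'', ''inn'', ''ins''}" for z
    using a4 that by (auto simp: prog_defs)
  interpret S: ear_search G M k p q n m a b Bd x y F j "marked (arr s4 ''vis'')" "arr s4 ''par''" "arr s4 ''pg''" dp
    by unfold_locales (use rt fits jF j xA c4 in auto)
  have fx: "S.fixed s4" unfolding S.fixed_def using env4 j4 k4 by (simp add: x_def y_def)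
  have "\<forall>v<n. arr s4 ''ins'' v = 0" using c1 k2 k3 k4 by simp
  from S.search_correct[OF fx this] obtain t5 s5 where e5: "exec Bd search_prog s4 t5 s5" and a5: "agree search_prog s4 s5"
    and c5: "t5 \<le> 1000 * (n + m) + 300 \<and>
      (reg s5 ''fnd'' = 0 \<longrightarrow> (\<exists>W. tight F W \<and> U j \<subseteq> W)) \<and>
      (reg s5 ''fnd'' \<noteq> 0 \<longrightarrow> S.hit s5 \<and> (\<exists>K. S.searched s5 K))"
    by (rule wp_obtain)
  have env5: "env s5" by (rule env_agree[OF a5 _ _ env4]) (simp_all add: prog_defs)
  have fx5: "S.fixed s5" by (rule S.fixed_agree[OF a5 _ _ fx]) (simp_all add: prog_defs)
  have k5: "arr s5 z = arr s4 z" if "z \<in> {''x'', ''y'', ''ea'', ''eb'', ''em'', ''inn''}" for z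
    using a5 that by (auto simp: prog_defs)
  have v5: "arr s5 ''x'' = x" "arr s5 ''y'' = y" "arr s5 ''ea'' = ea" "arr s5 ''eb'' = eb" "arr s5 ''em'' = em"
    "accepted s5 = F"
    using k1 k2 k3 k4 k5 by (simp_all add: x_def y_def ea_def eb_def em_def accepted_def F_def)
  have "wp Bd (If (Less (N 0) (Reg ''fnd'')) aug_prog Skip) (\<lambda>t s'. t \<le> 100 * n + 60 \<and> good (Suc j) s') s5"
  proof (cases "reg s5 ''fnd'' = 0")
    case True
    then obtain W where W: "tight F W" "U j \<subseteq> W" using c5 by blast
    have "good (Suc j) s5"
      unfolding good_def v5
    proof (intro conjI env5 fits)
      show "F \<subseteq> {..<Suc j}" using g(2) by auto
      show "legs F x y ea eb" using lg by (simp add: legs_def)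
      show "\<forall>i\<in>F. p i \<noteq> q i \<longrightarrow> mid i (em i)" using md by simp
      show "\<forall>i<Suc j. i \<notin> F \<longrightarrow> (\<exists>W. tight F W \<and> U i \<subseteq> W)" using g(6) W by (auto simp: less_Suc_eq)
    qed
    then show ?thesis using True by simp
  next
    case False
    then obtain K where K: "S.hit s5" "S.searched s5 K" using c5 by blast
    have lg5: "legs (insert j F) x y (arr s5 ''ea'') (arr s5 ''eb'')" using lg v5 by simp
    from S.aug_correct[OF fx5 K(2) K(1) v5(6) lg5] obtain t6 s6 where e6: "exec Bd aug_prog s5 t6 s6"
      and a6: "agree aug_prog s5 s6"
      and c6: "t6 \<le> 100 * n + 50 \<and> accepted s6 = insert j F \<and> fits (arr s6 ''x'') (arr s6 ''y'') (insert j F) \<and>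
        legs (insert j F) (arr s6 ''x'') (arr s6 ''y'') (arr s6 ''ea'') (arr s6 ''eb'')"
      by (rule wp_obtain)
    have acc: "accepted s6 = insert j F" and f6: "fits (arr s6 ''x'') (arr s6 ''y'') (insert j F)"
      using c6 by blast+
    have em6: "arr s6 ''em'' = em" using a6 v5(5) by (simp add: prog_defs)
    have env6: "env s6" by (rule env_agree[OF a6 _ _ env5]) (simp_all add: prog_defs)
    have "good (Suc j) s6"
      unfolding good_def acc em6
    proof (intro conjI env6 f6 md)
      show "insert j F \<subseteq> {..<Suc j}" using g(2) by auto
      show "legs (insert j F) (arr s6 ''x'') (arr s6 ''y'') (arr s6 ''ea'') (arr s6 ''eb'')" using c6 by blast
      show "\<forall>i<Suc j. i \<notin> insert j F \<longrightarrow> (\<exists>W. tight (insert j F) W \<and> U i \<subseteq> W)"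
      proof (intro allI impI)
        fix i assume "i < Suc j" "i \<notin> insert j F"
        then obtain W where W: "tight F W" "U i \<subseteq> W" using g(6) by (auto simp: less_Suc_eq)
        have "tight (insert j F) W" by (rule tight_mono[OF W(1) f6]) (use jF in auto)
        then show "\<exists>W. tight (insert j F) W \<and> U i \<subseteq> W" using W(2) by blast
      qed
    qed
    then have "wp Bd aug_prog (\<lambda>t s'. t \<le> 100 * n + 50 \<and> good (Suc j) s') s5"
      using e6 c6 unfolding wp_def by blast
    then have "wp Bd aug_prog (\<lambda>t s'. 1 + bcost (Less (N 0) (Reg ''fnd'')) + t \<le> 100 * n + 60 \<and> good (Suc j) s') s5"
      by (rule wp_conseq) auto
    then show ?thesis using False by simp
  qed
  then obtain t6 s6 where e6: "exec Bd (If (Less (N 0) (Reg ''fnd'')) aug_prog Skip) s5 t6 s6"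
    and c6: "t6 \<le> 100 * n + 60" "good (Suc j) s6"
    unfolding wp_def by blast
  have "exec Bd round_prog s0 (t1 + (t2 + (t3 + (t4 + (t5 + t6))))) s6"
    unfolding round_prog_def by (intro exec_Seq) (fact e1 e2 e3 e4 e5 e6)+
  moreover have "t1 + (t2 + (t3 + (t4 + (t5 + t6)))) \<le> 2000 * (n + m) + 1000"
  proof -
    have "t1 \<le> 30 * n + 10" "t2 \<le> 60 * dg (p j) + 40" "t3 \<le> 60 * dg (q j) + 40"
      "t4 \<le> 300 * (n + m) + 100" "t5 \<le> 1000 * (n + m) + 300"
      using c1 c2 c3 c4 c5 by blast+
    then show ?thesis using c6(1) dg_le[of "p j"] dg_le[of "q j"] by simp
  qed
  ultimately show ?thesis using c6(2) unfolding wp_def by blast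
qed

lemma main_correct:
  assumes s0: "good 0 s0" and j: "reg s0 ''j'' = 0"
  shows "wp Bd main_prog (\<lambda>t s'. t \<le> (2000 * (n + m) + 1100) * k + 10 \<and> good k s') s0"
  unfolding main_prog_def
proof (rule wp_While[where Inv = "\<lambda>s. reg s ''j'' \<le> k \<and> good (reg s ''j'') s"
      and \<phi> = "\<lambda>s. (2000 * (n + m) + 1100) * (k - reg s ''j'')"], goal_cases)
  case 1
  show ?case using assms by simp
next
  case (2 s)
  define j where "j = reg s ''j''"
  have g: "good j s" using 2(1) by (simp add: j_def)
  then have kk: "reg s ''k'' = k" by (simp add: good_def env_def params_def)
  then have jk: "j < k" using 2(3) by (simp add: j_def)
  have pot: "(2000 * (n + m) + 1100) * (k - j) = (2000 * (n + m) + 1100) * (k - Suc j) + (2000 * (n + m) + 1100)"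
    using jk by (metis Suc_diff_Suc add.commute mult_Suc_right)
  show ?case
    unfolding wp_Seq
  proof (rule wp_conseq[OF round_correct[OF g j_def[symmetric] jk]], goal_cases)
    case (1 t s')
    have "reg s' ''j'' = j"
      using 1(1) by (simp add: round_prog_def prog_defs j_def)
    moreover have "good (Suc j) (s'\<lparr>reg := (reg s')(''j'' := Suc j)\<rparr>)"
      using 1(2) by (simp add: good_def env_def params_def own_ok_def adj_ok_def accepted_def)
    ultimately show ?case using 1(2) jk k_le_n Bd pot by (simp add: j_def[symmetric])
  qed
next
  case (3 T s)
  have g: "good (reg s ''j'') s" using 3(1) by blast
  then have "reg s ''k'' = k" by (simp add: good_def env_def params_def)
  then have "reg s ''j'' = k" using 3(1,3) by simp
  then show ?case using g 3(4) j by simp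
qed

definition ear_path :: "ram_state \<Rightarrow> nat \<Rightarrow> nat list \<times> nat list" where
  "ear_path s i = (if p i = q i
     then ([arr s ''x'' i, p i, arr s ''y'' i], [arr s ''ea'' i, arr s ''eb'' i])
     else ([arr s ''x'' i, p i, q i, arr s ''y'' i], [arr s ''ea'' i, arr s ''em'' i, arr s ''eb'' i]))"

lemma out_correct:
  assumes g: "good k s0" and c: "reg s0 ''count'' = 0"
  shows "wp Bd out_prog (\<lambda>t s'. t \<le> 100 * k + 20 \<and>
    output_paths s' = map (ear_path s0) (filter (\<lambda>i. i \<in> accepted s0) [0..<k])) s0"
proof -
  let ?fl = "\<lambda>i. filter (\<lambda>i. i \<in> accepted s0) [0..<i]"
  define written where "written s \<longleftrightarrow> reg s ''count'' = length (?fl (reg s ''i'')) \<and>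
    map (row s) [0..<reg s ''count''] = map (ear_path s0) (?fl (reg s ''i''))" for s
  let ?I = "\<lambda>s. reg s ''i'' \<le> k \<and> written s"
  have ps: "params s0" using g by (simp add: good_def env_def)
  have legs: "legs (accepted s0) (arr s0 ''x'') (arr s0 ''y'') (arr s0 ''ea'') (arr s0 ''eb'')"
    and mid: "\<forall>i\<in>accepted s0. p i \<noteq> q i \<longrightarrow> mid i (arr s0 ''em'' i)"
    using g unfolding good_def by blast+
  show ?thesis
    unfolding out_prog_def
  proof (simp, rule wp_While[where Inv = ?I and \<phi> = "\<lambda>s. 90 * (k - reg s ''i'')"], goal_cases)
    case 1
    show ?case using c by (simp add: written_def)
  next
    case (2 s)
    define i c where "i = reg s ''i''" and "c = reg s ''count''"
    have kp: "reg s ''k'' = k" "arr s ''p'' = p" "arr s ''q'' = q" "arr s ''x'' = arr s0 ''x''"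
      "arr s ''y'' = arr s0 ''y''" "arr s ''ea'' = arr s0 ''ea''" "arr s ''eb'' = arr s0 ''eb''"
      "arr s ''em'' = arr s0 ''em''" "arr s ''inn'' = arr s0 ''inn''"
      using 2(2) ps by (simp_all add: params_def)
    have i: "i < k" using 2(3) kp by (simp add: i_def)
    have d: "c = length (?fl i)" "map (row s) [0..<c] = map (ear_path s0) (?fl i)"
      using 2(1) unfolding written_def i_def c_def by blast+
    have "length (?fl i) \<le> i" using length_filter_le[of _ "[0..<i]"] by simp
    then have B0: "Suc c \<le> Bd" "Suc i \<le> Bd" using d(1) i k_le_n Bd by auto
    have acc: "0 < arr s0 ''inn'' i \<longleftrightarrow> i \<in> accepted s0" using i by (simp add: accepted_def)
    show ?case
    proof (cases "i \<in> accepted s0")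
      case True
      have l: "leg True i (arr s0 ''ea'' i) (arr s0 ''x'' i)" "leg False i (arr s0 ''eb'' i) (arr s0 ''y'' i)"
        using legs True by (auto simp: legs_def)
      have B: "arr s0 ''x'' i \<le> Bd" "arr s0 ''y'' i \<le> Bd" "arr s0 ''ea'' i \<le> Bd" "arr s0 ''eb'' i \<le> Bd"
        "p i \<le> Bd" "q i \<le> Bd" "2 \<le> Bd" "3 \<le> Bd"
        using l outer_less[of "arr s0 ''x'' i"] outer_less[of "arr s0 ''y'' i"] pq_less[OF i] Bd by (auto simp: leg_def)
      have Bm: "arr s0 ''em'' i \<le> Bd" if "p i \<noteq> q i"
        using mid True that Bd by (auto simp: mid_def)
      have push: "written s'" if r: "reg s' ''count'' = Suc c" "reg s' ''i'' = Suc i"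
        "map (row s') [0..<c] = map (row s) [0..<c]" "row s' c = ear_path s0 i" for s'
      proof -
        have fl: "?fl (Suc i) = ?fl i @ [i]" using True by simp
        have "map (row s') [0..<Suc c] = map (row s) [0..<c] @ [ear_path s0 i]"
          by (simp only: upt_Suc_append[OF le0] map_append r(3,4) list.map)
        also have "\<dots> = map (ear_path s0) (?fl (Suc i))"
          by (simp only: fl d(2) map_append list.map)
        finally show ?thesis
          unfolding written_def r(1,2) using fl d(1) by simp
      qed
      show ?thesis
      proof (cases "p i = q i")
        case eq: True
        define s' where "s' = s\<lparr>arr := (arr s)(''v0'' := (arr s ''v0'')(c := arr s0 ''x'' i),
            ''v1'' := (arr s ''v1'')(c := q i), ''e0'' := (arr s ''e0'')(c := arr s0 ''ea'' i),
            ''len'' := (arr s ''len'')(c := 2), ''v2'' := (arr s ''v2'')(c := arr s0 ''y'' i),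
            ''e1'' := (arr s ''e1'')(c := arr s0 ''eb'' i)),
          reg := (reg s)(''count'' := Suc c, ''i'' := Suc i)\<rparr>"
        have "written s'"
          by (rule push) (use eq in \<open>simp_all add: row_def s'_def ear_path_def\<close>)
        then show ?thesis
          using i B B0 acc True eq by (simp add: i_def[symmetric] c_def[symmetric] kp s'_def)
      next
        case ne: False
        define s' where "s' = s\<lparr>arr := (arr s)(''v0'' := (arr s ''v0'')(c := arr s0 ''x'' i),
            ''v1'' := (arr s ''v1'')(c := p i), ''e0'' := (arr s ''e0'')(c := arr s0 ''ea'' i),
            ''len'' := (arr s ''len'')(c := 3), ''v2'' := (arr s ''v2'')(c := q i),
            ''v3'' := (arr s ''v3'')(c := arr s0 ''y'' i), ''e1'' := (arr s ''e1'')(c := arr s0 ''em'' i),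
            ''e2'' := (arr s ''e2'')(c := arr s0 ''eb'' i)),
          reg := (reg s)(''count'' := Suc c, ''i'' := Suc i)\<rparr>"
        have dn: "written s'"
          by (rule push) (use ne in \<open>simp_all add: row_def s'_def ear_path_def\<close>)
        have "p i < q i \<or> q i < p i" using ne by auto
        then show ?thesis
          using dn i B Bm[OF ne] B0 acc True by (auto simp: i_def[symmetric] c_def[symmetric] kp s'_def)
      qed
    next
      case False
      moreover have "row (s\<lparr>reg := (reg s)(''i'' := Suc i)\<rparr>) = row s"
        by (simp add: row_def fun_eq_iff)
      ultimately have "written (s\<lparr>reg := (reg s)(''i'' := Suc i)\<rparr>)"
        using d by (simp add: written_def c_def[symmetric])
      then show ?thesis using i B0 acc False by (simp add: i_def[symmetric] kp)
    qed
  next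
    case (3 T s)
    have "reg s ''i'' = k" using 3 ps by (auto simp: params_def)
    moreover have "map (row s) [0..<reg s ''count''] = map (ear_path s0) (?fl (reg s ''i''))"
      using 3(1) unfolding written_def by blast
    ultimately show ?case using 3(4) by (simp only: output_paths_row) simp
  qed
qed

lemma output_max:
  assumes g: "good k s"
  shows "max_earmuff_list G M (map (ear_path s) (filter (\<lambda>i. i \<in> accepted s) [0..<k]))"
proof -
  define F where "F = accepted s"
  have F: "F \<subseteq> {..<k}" and f: "fits (arr s ''x'') (arr s ''y'') F"
    and lg: "legs F (arr s ''x'') (arr s ''y'') (arr s ''ea'') (arr s ''eb'')"
    and md: "\<forall>i\<in>F. p i \<noteq> q i \<longrightarrow> mid i (arr s ''em'' i)"
    and tg: "\<And>i. i \<in> {..<k} - F \<Longrightarrow> \<exists>W. tight F W \<and> U i \<subseteq> W"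
    using g unfolding good_def F_def by auto
  have P: "ear_path s i \<in> ear_paths G (ear i)" "hd (fst (ear_path s i)) = arr s ''x'' i"
    "last (fst (ear_path s i)) = arr s ''y'' i" if i: "i \<in> F" for i
  proof -
    have l: "leg True i (arr s ''ea'' i) (arr s ''x'' i)" "leg False i (arr s ''eb'' i) (arr s ''y'' i)"
      using lg i by (auto simp: legs_def)
    have "arr s ''x'' i \<noteq> arr s ''y'' i" using f i by (auto simp: fits_def acyc_def)
    then show "ear_path s i \<in> ear_paths G (ear i)"
      unfolding ear_path_def using l md i F edges
      by (intro ear_pathI) (auto simp: leg_def mid_def)
    show "hd (fst (ear_path s i)) = arr s ''x'' i" "last (fst (ear_path s i)) = arr s ''y'' i"
      by (simp_all add: ear_path_def)
  qed
  note mu = mu_eq[OF F f tg]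
  have muff: "earmuff G M (ear ` F) (ear_path s \<circ> the_inv_into {..<k} ear)"
    by (rule mu(3)) (use P in auto)
  have "card (ear ` F) = mu G M" using inj_ear F mu(1) by (simp add: card_image inj_on_subset)
  moreover have "ear_path s ` F = (ear_path s \<circ> the_inv_into {..<k} ear) ` (ear ` F)"
    using the_inv_into_f_f[OF inj_ear] F by (force simp: image_iff)
  \<comment> \<open>The second vertex of the path is \<open>p i\<close>, and this determines
    \<open>i\<close>.\<close>
  moreover have "inj_on (ear_path s) F"
  proof (rule inj_onI)
    fix i i' assume ii: "i \<in> F" "i' \<in> F" "ear_path s i = ear_path s i'"
    then have "p i = p i'" by (auto simp: ear_path_def split: if_splits)
    then show "i = i'" using same_index[of i i' "p i"] ii F by auto
  qed
  moreover have "set (filter (\<lambda>i. i \<in> F) [0..<k]) = F" using F by auto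
  ultimately show ?thesis
    unfolding max_earmuff_list_def F_def[symmetric] using muff
    by (intro exI[of _ "ear ` F"] exI[of _ "ear_path s \<circ> the_inv_into {..<k} ear"])
      (simp add: distinct_map)
qed

text \<open>Without edges \<open>k = 0\<close>, and the constant 60 remains. Otherwise
  \<open>k \<le> n\<close> and \<open>k \<le> m\<close> bound every product by \<open>n * m\<close>,
  with total coefficient 2000 + 2000 + 1230 + 60 = 5290.\<close>

lemma time_bound:
  "30 * k + 10 + (60 * m + 20 + ((2000 * (n + m) + 1100) * k + 10 + (100 * k + 20))) \<le> 6000 * max 1 (n * m)"
proof (cases "m = 0")
  case True
  then show ?thesis using k_le_m by simp
next
  case False
  then have "0 < n" using ends_less[of 0] by auto
  then have m: "m \<le> n * m" by simp
  have eq: "30 * k + 10 + (60 * m + 20 + ((2000 * (n + m) + 1100) * k + 10 + (100 * k + 20))) =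
      2000 * (n * k) + 2000 * (m * k) + 1230 * k + 60 * m + 60"
    by (simp add: algebra_simps)
  have "n * k \<le> n * m" "m * k \<le> n * m" using k_le_m k_le_n by (auto simp: mult.commute)
  moreover have "k \<le> n * m" using k_le_m m by (rule order_trans)
  ultimately have "30 * k + 10 + (60 * m + 20 + ((2000 * (n + m) + 1100) * k + 10 + (100 * k + 20))) \<le> 5290 * (n * m) + 60"
    unfolding eq using m by linarith
  also have "\<dots> \<le> 6000 * (n * m)" using m False by linarith
  finally show ?thesis by simp
qed

lemma ear_prog_correct:
  assumes ps: "params s" and reg0: "reg s ''i'' = 0" "reg s ''e'' = 0" "reg s ''j'' = 0" "reg s ''count'' = 0"
    and arr0: "\<forall>v. arr s ''own'' v = 0" "\<forall>v. arr s ''hd'' v = 0" "\<forall>v. arr s ''inn'' v = 0"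
  shows "\<exists>t s'. exec Bd ear_prog s t s' \<and> t \<le> 6000 * max 1 (n * m) \<and> max_earmuff_list G M (output_paths s')"
proof -
  from own_correct[OF ps reg0(1) arr0(1)] obtain t1 s1 where e1: "exec Bd own_prog s t1 s1"
    and a1: "agree own_prog s s1" and c1: "t1 \<le> 30 * k + 10 \<and> own_ok s1"
    by (rule wp_obtain)
  have k1: "reg s1 ''e'' = 0" "reg s1 ''j'' = 0" "reg s1 ''count'' = 0" "\<forall>v. arr s1 ''hd'' v = 0"
    "\<forall>v. arr s1 ''inn'' v = 0"
    using a1 reg0 arr0 by (simp_all add: own_prog_def)
  have ps1: "params s1" by (rule params_agree[OF a1 _ _ ps]) (simp_all add: own_prog_def)
  from adj_correct[OF ps1 k1(1,4)] obtain t2 s2 where e2: "exec Bd adj_prog s1 t2 s2"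
    and a2: "agree adj_prog s1 s2" and c2: "t2 \<le> 60 * m + 20 \<and> adj_ok s2"
    by (rule wp_obtain)
  have k2: "reg s2 ''j'' = 0" "reg s2 ''count'' = 0" "\<forall>v. arr s2 ''inn'' v = 0" "arr s2 ''own'' = arr s1 ''own''"
    using a2 k1 by (simp_all add: adj_prog_def)
  have "params s2" by (rule params_agree[OF a2 _ _ ps1]) (simp_all add: adj_prog_def)
  moreover have "own_ok s2" using c1 k2(4) by (simp add: own_ok_def)
  ultimately have env2: "env s2" using c2 by (simp add: env_def)
  have "accepted s2 = {}" using k2(3) by (simp add: accepted_def)
  then have good2: "good 0 s2" using env2 by (simp add: good_def fits_def acyc_def legs_def)
  from main_correct[OF good2 k2(1)] obtain t3 s3 where e3: "exec Bd main_prog s2 t3 s3"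
    and a3: "agree main_prog s2 s3" and c3: "t3 \<le> (2000 * (n + m) + 1100) * k + 10 \<and> good k s3"
    by (rule wp_obtain)
  have cnt: "reg s3 ''count'' = 0"
    using a3 k2(2) by (simp add: main_prog_def round_prog_def prog_defs)
  have good3: "good k s3" using c3 by blast
  from out_correct[OF good3 cnt] obtain t4 s4 where e4: "exec Bd out_prog s3 t4 s4"
    and c4: "t4 \<le> 100 * k + 20 \<and>
      output_paths s4 = map (ear_path s3) (filter (\<lambda>i. i \<in> accepted s3) [0..<k])"
    by (rule wp_obtain)
  have "exec Bd ear_prog s (t1 + (t2 + (t3 + t4))) s4"
    unfolding ear_prog_def by (intro exec_Seq) (fact e1 e2 e3 e4)+
  moreover have "t1 + (t2 + (t3 + t4)) \<le> 6000 * max 1 (n * m)"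
  proof (rule order_trans[OF _ time_bound])
    show "t1 + (t2 + (t3 + t4)) \<le>
      30 * k + 10 + (60 * m + 20 + ((2000 * (n + m) + 1100) * k + 10 + (100 * k + 20)))"
      by (intro add_mono) (use c1 c2 c3 c4 in blast)+
  qed
  moreover have "max_earmuff_list G M (output_paths s4)"
    using c4 output_max[OF good3] by simp
  ultimately show ?thesis by blast
qed

end

theorem theorem16:
  "max_earmuff_computable_in (\<lambda>n m. n * m) \<and>
   (\<forall>(G :: ('v, 'e) mgraph) M.
      multigraph G \<and> eardrum G M \<and> (\<forall>f\<in>M. ear_paths G f \<noteq> {}) \<longrightarrow>
      int (mu G M) =
        Min {int (card M) - (\<Sum>W\<in>\<W>. sur G M W) | \<W>. partition_on (verts G - \<Union>M) \<W>})"
proof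
  show "max_earmuff_computable_in (\<lambda>n m. n * m)"
    unfolding max_earmuff_computable_in_def
  \<comment> \<open>The exponent is 2 because the word bound must cover \<open>2 * m\<close> and
    offers no constant factor.\<close>
  proof (rule exI[of _ ear_prog], rule exI[of _ 6000], rule exI[of _ 2], intro allI impI)
    fix G :: "(nat, nat) mgraph" and M s
    assume a: "multigraph G \<and> eardrum G M \<and> (\<forall>f\<in>M. ear_paths G f \<noteq> {}) \<and> encodes s G M"
    define n m where "n = reg s ''n''" and "m = reg s ''m''"
    have enc: "verts G = {..<n}" "edges G = {..<m}"
      "\<forall>e\<in>edges G. ends G e = {arr s ''a'' e, arr s ''b'' e}"
      "bij_betw (\<lambda>j. {arr s ''p'' j, arr s ''q'' j}) {..<reg s ''k''} M"
      "\<forall>x. x \<notin> {''n'', ''m'', ''k''} \<longrightarrow> reg s x = 0"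
      "\<forall>x i. \<not> (x \<in> {''a'', ''b''} \<and> i < reg s ''m'') \<longrightarrow>
        \<not> (x \<in> {''p'', ''q''} \<and> i < reg s ''k'') \<longrightarrow> arr s x i = 0"
      using a unfolding encodes_def n_def m_def by - (elim conjE, assumption)+
    interpret ear_ram G M "reg s ''k''" "arr s ''p''" "arr s ''q''" n m "arr s ''a''" "arr s ''b''" "(n + m + 2) ^ 2"
    proof unfold_locales
      show "n + 2 * m + 2 \<le> (n + m + 2) ^ 2" by (simp add: power2_eq_square algebra_simps)
    qed (use a enc in auto)
    have "params s" unfolding params_def by (simp add: n_def m_def)
    from ear_prog_correct[OF this] enc(5,6)
    show "\<exists>t s'. exec ((card (verts G) + card (edges G) + 2) ^ 2) ear_prog s t s' \<and>
        t \<le> 6000 * max 1 (card (verts G) * card (edges G)) \<and> max_earmuff_list G M (output_paths s')"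
      by (simp add: enc(1,2))
  qed
  show "\<forall>(G :: ('v, 'e) mgraph) M.
      multigraph G \<and> eardrum G M \<and> (\<forall>f\<in>M. ear_paths G f \<noteq> {}) \<longrightarrow>
      int (mu G M) =
        Min {int (card M) - (\<Sum>W\<in>\<W>. sur G M W) | \<W>. partition_on (verts G - \<Union>M) \<W>}"
    using mu_min_max by blast
qed

end
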